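(* Let $P$ be an $m\times n$ matrix, with entries summing to $1$ and with a factorization $P=AB$, $A\in\mathbb R^{m\times3}$, $B\in\mathbb R^{3\times n}$. Then $P$ lies on the topological boundary $\partial\mathcal M$ of the set $\mathcal M$ of matrices in $\Delta_{mn-1}$ of nonnegative rank at most $3$ if and only if both of the following hold: (1) $P\ge0$ entrywise, and either $\operatorname{rank}(P)<3$, or $\operatorname{rank}(P)=3$ and there exists a valid quadruple for $(A,B)$ or for $(B^T,A^T)$; (2) $P$ contains a zero, or $\operatorname{rank}(P)=3$ and for each valid quadruple $(i,j,i',j')$ (for $(A,B)$ or for $(B^T,A^T)$) there exist $k,l$ (and $k'$) such that $F_{k,l,k'}\cdot F_{l,k,k'}=0$, with $F$ formed from the corresponding pair.
   Context: $\Delta_{mn-1}$ is the simplex of nonnegative $m\times n$ matrices with entries summing to $1$. A matrix has nonnegative rank $\le3$ if it is a product of a nonnegative $m\times3$ matrix and a nonnegative $3\times n$ matrix. Let $\mathcal V$ be the set of real $m\times n$ matrices of rank $\le 3$ with entries summing to $1$. A point $P\in\mathcal M$ is an interior point of $\mathcal M$ if there is an open ball $W\subset\Delta_{mn-1}$ containing $P$ with $W\cap\mathcal V=W\cap\mathcal M$; $\partial\mathcal M$ is the set of points of $\mathcal M$ that are not interior points. Notation: $[m]=\{1,\dots,m\}$, $\times$ is the cross product in $\mathbb R^3$, $\det(x,y,z)$ is the determinant with rows $x,y,z$. For an $m\times3$ matrix $A$ with rows $a_1,\dots,a_m$ and a $3\times n$ matrix $B$ with columns $b_1,\dots,b_n$,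 and given $i,j\in[m]$, $i',j'\in[n]$, put $$F_{k,l,k'}=\det\Big(\big((a_i\times a_j)\times b_{i'}\big)\times a_k,\ \big((a_i\times a_j)\times b_{j'}\big)\times a_l,\ b_{k'}\Big)$$ for $\{k,l\}\subseteq[m]\setminus\{i,j\}$ and $k'\in[n]\setminus\{i',j'\}$; the indices $k,l,k'$ in (2) range over these sets. Call $(i,j,i',j')$, with $i,j\in[m]$ and $i',j'\in[n]$, a valid quadruple for $(A,B)$ if: (i) the numbers $\det(a_i,a_j,a_k)$, $k\in[m]\setminus\{i,j\}$, all have the same sign or are zero; (ii) the numbers $\det(a_i\times a_j,b_{i'},b_{k'})$, $k'\in[n]\setminus\{i'\}$, all have the same sign or are zero; (iii) the numbers $\det(a_i\times a_j,b_{j'},b_{k'})$, $k'\in[n]\setminus\{j'\}$, all have the same sign or are zero; (iv) $F_{k,l,k'}F_{l,k,k'}\ge0$ for all $\{k,l\}\subseteq[m]\setminus\{i,j\}$ and all $k'\in[n]\setminus\{i',j'\}$. A valid quadruple for $(B^T,A^T)$ is defined in the same way with the roles swapped: the $a$'s are the columns of $B$, the $b$'s are the rows of $A$, and $m$ and $n$ are interchanged.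
   Formalization: A valid quadruple must also have (a_i×a_j)×b_{i'} and (a_i×a_j)×b_{j'} nonzero, and in (2) the k,l must satisfy det(a_i,a_j,a_k)≠0 and det(a_i,a_j,a_l)≠0; without these conditions the equivalence fails in degenerate cases. *)

theory Defs
  imports "HOL-Analysis.Analysis"
begin

definition entry_sum :: "real^'n^'m \<Rightarrow> real" where
  "entry_sum P = (\<Sum>p\<in>UNIV. \<Sum>q\<in>UNIV. P $ p $ q)"

definition nonneg_matrix :: "real^'n^'m \<Rightarrow> bool" where
  "nonneg_matrix P \<longleftrightarrow> (\<forall>p q. 0 \<le> P $ p $ q)"

definition matrix_simplex :: "(real^'n^'m) set" where
  "matrix_simplex = {P. nonneg_matrix P \<and> entry_sum P = 1}"

definition nonneg_rank_le_3 :: "real^'n^'m \<Rightarrow> bool" where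
  "nonneg_rank_le_3 P \<longleftrightarrow>
     (\<exists>(A :: real^3^'m) (B :: real^'n^3). nonneg_matrix A \<and> nonneg_matrix B \<and> P = A ** B)"

definition mixture_model :: "(real^'n^'m) set" where
  "mixture_model = {P \<in> matrix_simplex. nonneg_rank_le_3 P}"

definition rank_variety :: "(real^'n^'m) set" where
  "rank_variety = {P. rank P \<le> 3 \<and> entry_sum P = 1}"

text \<open>
  The simplex has empty interior in the space of all matrices, so an open ball contained in it
  is a ball of the affine hyperplane of matrices with entries summing to 1. It is not merely
  relatively open in the simplex: a matrix with a zero entry (when there is more than one entry)
  lies in no such ball.
\<close>

definition simplex_ball :: "(real^'n^'m) set \<Rightarrow> bool" where
  "simplex_ball W \<longleftrightarrow>
     (\<exists>Q r. entry_sum Q = 1 \<and> 0 < r \<and> W = ball Q r \<inter> {X. entry_sum X = 1}) \<and> W \<subseteq> matrix_simplex"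

definition model_interior :: "(real^'n^'m) set" where
  "model_interior = {P \<in> mixture_model.
     \<exists>W. simplex_ball W \<and> P \<in> W \<and> W \<inter> rank_variety = W \<inter> mixture_model}"

definition model_boundary :: "(real^'n^'m) set" where
  "model_boundary = mixture_model - model_interior"

definition det3 :: "real^3 \<Rightarrow> real^3 \<Rightarrow> real^3 \<Rightarrow> real" where
  "det3 x y z = det (vector [x, y, z] :: real^3^3)"

definition same_sign_or_zero :: "'i set \<Rightarrow> ('i \<Rightarrow> real) \<Rightarrow> bool" where
  "same_sign_or_zero S f \<longleftrightarrow> (\<forall>k\<in>S. 0 \<le> f k) \<or> (\<forall>k\<in>S. f k \<le> 0)"

definition vtx :: "real^3^'m \<Rightarrow> 'm \<Rightarrow> 'm \<Rightarrow> real^3" where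
  "vtx A i j = cross3 (row i A) (row j A)"

definition F :: "real^3^'m \<Rightarrow> real^'n^3 \<Rightarrow> 'm \<Rightarrow> 'm \<Rightarrow> 'n \<Rightarrow> 'n \<Rightarrow> 'm \<Rightarrow> 'm \<Rightarrow> 'n \<Rightarrow> real" where
  "F A B i j i' j' k l k' =
     det3 (cross3 (cross3 (vtx A i j) (column i' B)) (row k A))
          (cross3 (cross3 (vtx A i j) (column j' B)) (row l A))
          (column k' B)"

text \<open>
  Vectors of length 3 are homogeneous coordinates of points and lines of the projective plane,
  so the vertex \<open>a\<^sub>i \<times> a\<^sub>j\<close> and the lines joining it to \<open>b\<^sub>i\<^sub>'\<close> and to \<open>b\<^sub>j\<^sub>'\<close> have to be nonzero.
  This is the first pair of conjuncts below (it forces \<open>i \<noteq> j\<close>). Without it, (i)-(iv) hold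
  vacuously for \<open>i = j\<close>, for proportional rows \<open>a\<^sub>i, a\<^sub>j\<close>, and, up to the choice of \<open>j'\<close>, whenever
  \<open>b\<^sub>i\<^sub>'\<close> is a multiple of the vertex.
\<close>

definition valid_quadruple :: "real^3^'m \<Rightarrow> real^'n^3 \<Rightarrow> 'm \<Rightarrow> 'm \<Rightarrow> 'n \<Rightarrow> 'n \<Rightarrow> bool" where
  "valid_quadruple A B i j i' j' \<longleftrightarrow>
     cross3 (vtx A i j) (column i' B) \<noteq> 0 \<and>
     cross3 (vtx A i j) (column j' B) \<noteq> 0 \<and>
     same_sign_or_zero (UNIV - {i, j}) (\<lambda>k. det3 (row i A) (row j A) (row k A)) \<and>
     same_sign_or_zero (UNIV - {i'}) (\<lambda>k'. det3 (vtx A i j) (column i' B) (column k' B)) \<and>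
     same_sign_or_zero (UNIV - {j'}) (\<lambda>k'. det3 (vtx A i j) (column j' B) (column k' B)) \<and>
     (\<forall>k l k'. {k, l} \<subseteq> UNIV - {i, j} \<longrightarrow> k' \<in> UNIV - {i', j'} \<longrightarrow>
        0 \<le> F A B i j i' j' k l k' * F A B i j i' j' l k k')"

text \<open>
  The vanishing of the product means that \<open>b\<^sub>k\<^sub>'\<close> lies on the third side of the triangle whose first
  two sides leave the vertex \<open>a\<^sub>i \<times> a\<^sub>j\<close>. If a line \<open>a\<^sub>k\<close> passes through that vertex it meets these
  two sides only there, no triangle arises, and the product may vanish identically (for instance
  when \<open>a\<^sub>k, a\<^sub>l\<close> repeat \<open>a\<^sub>i, a\<^sub>j\<close>). Such \<open>k\<close> and \<open>l\<close> are not admitted as witnesses.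
\<close>

definition has_vanishing_product :: "real^3^'m \<Rightarrow> real^'n^3 \<Rightarrow> 'm \<Rightarrow> 'm \<Rightarrow> 'n \<Rightarrow> 'n \<Rightarrow> bool" where
  "has_vanishing_product A B i j i' j' \<longleftrightarrow>
     (\<exists>k l k'. {k, l} \<subseteq> UNIV - {i, j} \<and> k' \<in> UNIV - {i', j'} \<and>
        det3 (row i A) (row j A) (row k A) \<noteq> 0 \<and>
        det3 (row i A) (row j A) (row l A) \<noteq> 0 \<and>
        F A B i j i' j' k l k' * F A B i j i' j' l k k' = 0)"

end

theory Submission
  imports Defs
begin

text \<open>
  For \<open>P = AB\<close> of rank 3, a nonnegative factorization is a triangle between the polygon spanned by
  the columns of \<open>B\<close> and the polygon cut out by the rows of \<open>A\<close>. If no triangle has a vertex at a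
  vertex of the outer polygon or a side along an edge of the inner one, then every triangle can be
  moved into the interior of the outer polygon: either some vertex or side is free and shears
  suffice, or all six contacts are active and rotating the triangle with five of them kept gains
  room at the sixth, to second order if not to first. Shrinking the room by passing to
  \<open>P - \<delta> r c\<^sup>T\<close> with the marginals \<open>r, c\<close> of \<open>P\<close>, which is a homothety of the outer polygon,
  a triangle for the largest feasible \<open>\<delta>\<close> therefore has such a special position. Homothety carries it
  back to a special triangle for \<open>P\<close>, with strict containments if \<open>\<delta> > 0\<close>, and \<open>\<delta> > 0\<close> is possible
  precisely at interior points when \<open>P\<close> is positive. Special triangles are valid quadruples, those with
  strict containments are valid quadruples without vanishing product. Positive matrices of smaller rank
  are interior because the inner polygon degenerates to a segment.
\<close>

section \<open>Nonnegative factorizations in coordinates\<close>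

text \<open>The triangle is always the standard one: \<open>nonneg_factor Q A B\<close> writes lines
  and points in its homogeneous barycentric coordinates, so \<open>A$k$r = 0\<close> puts vertex
  \<open>r\<close> on line \<open>k\<close>, and \<open>B$l$r = 0\<close> puts point
  \<open>l\<close> on the side opposite to \<open>r\<close>. Moving the triangle is a change of
  coordinates, and exchanging \<open>A\<close> and \<open>B\<close> is projective duality. The
  marginals are taken because every factorization sees them: with g the sum of the points and h the
  sum of the lines they are the values of the lines at g and of h at the points. Subtracting
  \<delta> times their product keeps the points and contracts the outer polygon about g with ratio 1
  - \<delta>. When a special triangle is carried back, only its special vertex follows the inverse
  homothety; the other two vertices stay in the contracted polygon, and that gives the strictness.
  The obstacle at interior points is that the factors of a nearby matrix do not depend continuously
  on it. Compactness replaces continuity, but it gives no control over the limiting factorization of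
  \<open>P\<close>, so a strictly positive change of coordinates has to be found for every
  factorization.\<close>

lemma inner_real3: "x \<bullet> y = x$1 * y$1 + x$2 * y$2 + x$3 * y$3" for x y :: "real^3"
  by (simp add: inner_vec_def sum_3)

lemma vec3_eq_iff: "x = y \<longleftrightarrow> x$1 = y$1 \<and> x$2 = y$2 \<and> x$3 = y$3" for x y :: "'a^3"
  by (simp add: vec_eq_iff forall_3)

lemma cross3_nth:
  "cross3 x y $ 1 = x$2 * y$3 - x$3 * y$2"
  "cross3 x y $ 2 = x$3 * y$1 - x$1 * y$3"
  "cross3 x y $ 3 = x$1 * y$2 - x$2 * y$1"
  by (simp_all add: cross3_def)

lemma det3_expand:
  "det3 x y z = x$1 * y$2 * z$3 + x$2 * y$3 * z$1 + x$3 * y$1 * z$2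
     - x$1 * y$3 * z$2 - x$2 * y$1 * z$3 - x$3 * y$2 * z$1"
  by (simp add: det3_def det_3)

lemma eventually_pos_at_right_0:
  fixes f :: "real \<Rightarrow> real"
  assumes "isCont f 0" "0 < f 0"
  shows "\<forall>\<^sub>F x in at_right 0. 0 < f x"
proof -
  have "(f \<longlongrightarrow> f 0) (at_right 0)"
    using assms(1) by (simp add: isCont_def filterlim_at_split)
  then show ?thesis using assms(2) by (rule order_tendstoD)
qed

lemma UNIV_3_distinct:
  fixes r s t :: 3
  assumes "r \<noteq> s" "s \<noteq> t" "r \<noteq> t"
  shows "UNIV = {r, s, t}"
proof -
  have "card {r, s, t} = CARD(3)" using assms by simp
  then show ?thesis by (metis card_subset_eq finite subset_UNIV)
qed

lemma all_3_distinct: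
  fixes r s t :: 3
  assumes "r \<noteq> s" "s \<noteq> t" "r \<noteq> t"
  shows "(\<forall>i. Q i) \<longleftrightarrow> Q r \<and> Q s \<and> Q t"
  using UNIV_3_distinct[OF assms] by (metis UNIV_I empty_iff insert_iff)

lemma inner_3_distinct:
  fixes x y :: "real^3"
  assumes "r \<noteq> s" "s \<noteq> t" "r \<noteq> t"
  shows "x \<bullet> y = x$r * y$r + x$s * y$s + x$t * y$t"
proof -
  have "x \<bullet> y = (\<Sum>i\<in>{r,s,t}. x$i * y$i)"
    by (simp add: inner_vec_def UNIV_3_distinct[OF assms, symmetric])
  then show ?thesis using assms by simp
qed

lemma ex_3_distinct: "\<exists>s t. (r::3) \<noteq> s \<and> s \<noteq> t \<and> r \<noteq> t"
proof -
  have "r = 1 \<or> r = 2 \<or> r = 3" by (rule exhaust_3)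
  moreover have "(1::3) \<noteq> 2" "(2::3) \<noteq> 3" "(1::3) \<noteq> 3" by simp_all
  ultimately show ?thesis by metis
qed

lemma ex_3_third: "\<exists>t. (r::3) \<noteq> t \<and> s \<noteq> t"
proof -
  have "card {r, s} \<le> 2" by (simp add: card_insert_if)
  then have "card {r, s} \<noteq> CARD(3)" by simp
  then have "{r, s} \<noteq> UNIV" by metis
  then show ?thesis by auto
qed

section \<open>Contacts of a triangle with the two polygons, and moves that remove them\<close>

definition nonneg_factor :: "real^'n^'m \<Rightarrow> real^3^'m \<Rightarrow> real^3^'n \<Rightarrow> bool" where
  "nonneg_factor Q A B \<longleftrightarrow>
     (\<forall>k i. 0 \<le> A$k$i) \<and> (\<forall>l i. 0 \<le> B$l$i) \<and> (\<forall>k l. A$k \<bullet> B$l = Q$k$l)"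

text \<open>For lines: a vertex of the triangle is the intersection of two different lines. Applied
  to \<open>B\<close>: one side of the triangle carries two different points.\<close>

definition tight_corner :: "real^3^'m \<Rightarrow> bool" where
  "tight_corner A \<longleftrightarrow> (\<exists>i j r. A$i$r = 0 \<and> A$j$r = 0 \<and> cross3 (A$i) (A$j) \<noteq> 0)"

text \<open>A row with two zeros is a line that contains a side of the triangle, or, for
  \<open>B\<close>, a point that sits at a vertex.\<close>

definition axis_free :: "real^3^'m \<Rightarrow> bool" where
  "axis_free A \<longleftrightarrow> (\<forall>k r s. r \<noteq> s \<longrightarrow> A$k$r = 0 \<longrightarrow> A$k$s = 0 \<longrightarrow> A$k = 0)"

text \<open>The triangle lies in the interior of the outer polygon. Zero rows are exempt because
  \<open>P\<close> may have zero rows, for which there is no line.\<close>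

definition positive_rows :: "real^3^'m \<Rightarrow> bool" where
  "positive_rows A \<longleftrightarrow> (\<forall>k. A$k = 0 \<or> (\<forall>i. 0 < A$k$i))"

lemma nonneg_factor_transpose:
  "nonneg_factor Q A B \<Longrightarrow> nonneg_factor (transpose Q) B A"
  by (simp add: nonneg_factor_def transpose_def inner_commute)

text \<open>Vertex \<open>s\<close> slides towards \<open>t\<close> and so leaves the lines that
  meet the side from \<open>s\<close> to \<open>t\<close> only at \<open>s\<close>. To keep the
  points inside, vertex \<open>r\<close> slides away from \<open>t\<close>, which it can do because
  no line passes through it. The condition on \<open>B\<close> excludes a point at \<open>s\<close>,
  which would fall outside.\<close>

lemma shear:
  fixes Q :: "real^'n^'m"
  assumes nf: "nonneg_factor Q A B" and d: "r \<noteq> s" "s \<noteq> t" "r \<noteq> t"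
    and Ar: "\<And>k. A$k \<noteq> 0 \<Longrightarrow> 0 < A$k$r"
    and Bt: "\<And>l. B$l$t = 0 \<Longrightarrow> B$l$r = 0 \<Longrightarrow> B$l$s = 0"
  obtains A' B' where "nonneg_factor Q A' B'"
    "\<And>k. A'$k$t = A$k$t" "\<And>k. A$k \<noteq> 0 \<Longrightarrow> 0 < A'$k$r"
    "\<And>k. 0 < A$k$s + A$k$t \<Longrightarrow> 0 < A'$k$s" "\<And>k. A$k = 0 \<Longrightarrow> A'$k = 0"
    "\<And>l. B'$l$r = B$l$r" "\<And>l. B'$l$s = B$l$s" "\<And>l. B$l = 0 \<Longrightarrow> B'$l = 0"
proof -
  have A0: "0 \<le> A$k$i" and B0: "0 \<le> B$l$i" and AB: "A$k \<bullet> B$l = Q$k$l" for k l i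
    using nf by (auto simp: nonneg_factor_def)
  \<comment> \<open>For points on the side opposite to \<open>t\<close> the motion of
    \<open>r\<close> must outweigh that of \<open>s\<close> by the ratio of their coordinates. The
    sum of all ratios bounds each of them; a denominator 0 contributes 0.\<close>
  define \<kappa> where "\<kappa> = (\<Sum>l\<in>UNIV. B$l$s / B$l$r)"
  have \<kappa>: "B$l$s \<le> \<kappa> * B$l$r" if "B$l$t = 0" for l
  proof (cases "B$l$r = 0")
    case True then show ?thesis using Bt that by simp
  next
    case False
    then have "0 < B$l$r" using B0[of l r] by simp
    moreover have "B$l$s / B$l$r \<le> \<kappa>"
      unfolding \<kappa>_def by (rule member_le_sum) (auto intro: divide_nonneg_nonneg B0)
    ultimately show ?thesis by (simp add: field_simps)
  qed
  have "\<forall>\<^sub>F \<epsilon> in at_right (0::real). A$k \<noteq> 0 \<longrightarrow> 0 < A$k$r - \<kappa> * \<epsilon> * A$k$t" for k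
  proof (cases "A$k = 0")
    case False
    have "\<forall>\<^sub>F \<epsilon> in at_right (0::real). 0 < A$k$r - \<kappa> * \<epsilon> * A$k$t"
      by (rule eventually_pos_at_right_0) (use Ar[OF False] in \<open>auto intro!: continuous_intros\<close>)
    then show ?thesis by (rule eventually_mono) simp
  qed simp
  then have e1: "\<forall>\<^sub>F \<epsilon> in at_right (0::real). \<forall>k. A$k \<noteq> 0 \<longrightarrow> 0 < A$k$r - \<kappa> * \<epsilon> * A$k$t"
    by (simp add: eventually_all_finite)
  have "\<forall>\<^sub>F \<epsilon> in at_right (0::real). 0 \<le> B$l$t + \<epsilon> * (\<kappa> * B$l$r - B$l$s)" for l
  proof (cases "B$l$t = 0")
    case False
    then have pos: "0 < B$l$t" using B0[of l t] by simp
    have "\<forall>\<^sub>F \<epsilon> in at_right (0::real). 0 < B$l$t + \<epsilon> * (\<kappa> * B$l$r - B$l$s)"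
      by (rule eventually_pos_at_right_0) (use pos in \<open>auto intro!: continuous_intros\<close>)
    then show ?thesis by (rule eventually_mono) simp
  next
    case True
    then show ?thesis using \<kappa>[OF True] eventually_at_right_less[of 0]
      by (auto elim!: eventually_mono)
  qed
  then have e2: "\<forall>\<^sub>F \<epsilon> in at_right (0::real). \<forall>l. 0 \<le> B$l$t + \<epsilon> * (\<kappa> * B$l$r - B$l$s)"
    by (simp add: eventually_all_finite)
  obtain \<epsilon> :: real where \<epsilon>: "0 < \<epsilon>"
    and \<epsilon>A: "\<And>k. A$k \<noteq> 0 \<Longrightarrow> 0 < A$k$r - \<kappa> * \<epsilon> * A$k$t"
    and \<epsilon>B: "\<And>l. 0 \<le> B$l$t + \<epsilon> * (\<kappa> * B$l$r - B$l$s)"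
    using eventually_happens'[OF _ eventually_conj[OF eventually_at_right_less[of 0] eventually_conj[OF e1 e2]]]
    by auto
  define A' :: "real^3^'m" where "A' = (\<chi> k i. if i = r then A$k$r - \<kappa> * \<epsilon> * A$k$t
      else if i = s then A$k$s + \<epsilon> * A$k$t else A$k$t)"
  define B' :: "real^3^'n" where "B' = (\<chi> l i. if i = t then B$l$t + \<epsilon> * (\<kappa> * B$l$r - B$l$s) else B$l$i)"
  have A': "A'$k$r = A$k$r - \<kappa> * \<epsilon> * A$k$t" "A'$k$s = A$k$s + \<epsilon> * A$k$t" "A'$k$t = A$k$t" for k
    using d by (auto simp: A'_def)
  have B': "B'$l$r = B$l$r" "B'$l$s = B$l$s" "B'$l$t = B$l$t + \<epsilon> * (\<kappa> * B$l$r - B$l$s)" for l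
    using d by (auto simp: B'_def)
  have Ar0: "0 \<le> A$k$r - \<kappa> * \<epsilon> * A$k$t" for k
    by (cases "A$k = 0") (use \<epsilon>A[of k] in auto)
  show ?thesis
  proof (rule that[of A' B'])
    have "A'$k \<bullet> B'$l = A$k \<bullet> B$l" for k l
      by (simp add: inner_3_distinct[OF d] A' B' algebra_simps)
    moreover have "0 \<le> A'$k$i" for k i
      using Ar0[of k] A0 \<epsilon> by (auto simp: A'_def intro!: add_nonneg_nonneg mult_nonneg_nonneg)
    moreover have "0 \<le> B'$l$i" for l i using B0 \<epsilon>B by (auto simp: B'_def)
    ultimately show "nonneg_factor Q A' B'" using AB by (auto simp: nonneg_factor_def)
    show "0 < A'$k$s" if "0 < A$k$s + A$k$t" for k
    proof (cases "A$k$t = 0")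
      case True then show ?thesis using that A'(2)[of k] by simp
    next
      case False
      then have "0 < \<epsilon> * A$k$t" using A0[of k t] \<epsilon> by simp
      then show ?thesis using A0[of k s] A'(2)[of k] by simp
    qed
    show "A$k = 0 \<Longrightarrow> A'$k = 0" for k
      using A'[of k] all_3_distinct[OF d, of "\<lambda>i. A'$k$i = 0"] by (simp add: vec_eq_iff)
    show "B$l = 0 \<Longrightarrow> B'$l = 0" for l
      using B'[of l] all_3_distinct[OF d, of "\<lambda>i. B'$l$i = 0"] by (simp add: vec_eq_iff)
  qed (use A' B' \<epsilon>A in auto)
qed

text \<open>The first shear frees \<open>s\<close> while \<open>r\<close> gives way; the second
  slides \<open>t\<close> towards \<open>r\<close> while the freed \<open>s\<close> gives way.
  \<open>axis_free\<close> provides that no line contains the side from \<open>s\<close> to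
  \<open>t\<close> and that no point sits at a sliding vertex.\<close>

lemma positive_rows_if_positive_column:
  fixes Q :: "real^'n^'m"
  assumes nf: "nonneg_factor Q A B" and af: "axis_free A" "axis_free B"
    and Ar: "\<And>k. A$k \<noteq> 0 \<Longrightarrow> 0 < A$k$r"
  obtains A' B' where "nonneg_factor Q A' B'" "positive_rows A'"
proof -
  obtain s t :: 3 where d: "r \<noteq> s" "s \<noteq> t" "r \<noteq> t" using ex_3_distinct[of r] by auto
  have A0: "0 \<le> A$k$i" for k i using nf by (auto simp: nonneg_factor_def)
  have st: "0 < A$k$s + A$k$t" if "A$k \<noteq> 0" for k
  proof (rule ccontr)
    assume "\<not> ?thesis"
    then have "A$k$s = 0" "A$k$t = 0" using A0[of k s] A0[of k t] by auto
    then show False using af(1) that d(2) by (auto simp: axis_free_def)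
  qed
  have "B$l$s = 0" if "B$l$t = 0" "B$l$r = 0" for l
  proof -
    have "B$l = 0" using af(2) that d(3) unfolding axis_free_def by blast
    then show ?thesis by simp
  qed
  from shear[OF nf d Ar this] obtain A1 B1 where 1: "nonneg_factor Q A1 B1"
    "\<And>k. A1$k$t = A$k$t" "\<And>k. A$k \<noteq> 0 \<Longrightarrow> 0 < A1$k$r"
    "\<And>k. 0 < A$k$s + A$k$t \<Longrightarrow> 0 < A1$k$s" "\<And>k. A$k = 0 \<Longrightarrow> A1$k = 0"
    "\<And>l. B1$l$r = B$l$r" "\<And>l. B1$l$s = B$l$s" "\<And>l. B$l = 0 \<Longrightarrow> B1$l = 0" by metis
  have A1s: "0 < A1$k$s" if "A1$k \<noteq> 0" for k using 1 st that by metis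
  have A1r: "0 < A1$k$r" if "A1$k \<noteq> 0" for k using 1 that by metis
  have B1: "B1$l$t = 0" if "B1$l$r = 0" "B1$l$s = 0" for l
  proof -
    have "B$l = 0" using that 1(6,7)[of l] af(2) d(1) by (auto simp: axis_free_def)
    then show ?thesis using 1(8) by simp
  qed
  have d': "s \<noteq> t" "t \<noteq> r" "s \<noteq> r" using d by auto
  from shear[OF 1(1) d' A1s B1] obtain A2 B2 where 2: "nonneg_factor Q A2 B2"
    "\<And>k. A2$k$r = A1$k$r" "\<And>k. A1$k \<noteq> 0 \<Longrightarrow> 0 < A2$k$s"
    "\<And>k. 0 < A1$k$t + A1$k$r \<Longrightarrow> 0 < A2$k$t" "\<And>k. A1$k = 0 \<Longrightarrow> A2$k = 0" by metis
  have "positive_rows A2" unfolding positive_rows_def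
  proof
    fix k
    show "A2$k = 0 \<or> (\<forall>i. 0 < A2$k$i)"
    proof (cases "A1$k = 0")
      case False
      have "0 \<le> A1$k$t" using 1(1) by (auto simp: nonneg_factor_def)
      then show ?thesis using 2 A1r[OF False] False all_3_distinct[OF d, of "\<lambda>i. 0 < A2$k$i"] by auto
    qed (use 2 in auto)
  qed
  then show ?thesis using that 2(1) by blast
qed

text \<open>If all points are strictly inside, the triangle can shrink towards its centre. With J
  the all-ones matrix, J^2 = 3J, so I + \<epsilon>J and I - \<eta>J are inverse to each other for
  \<epsilon> = \<eta> / (1 - 3\<eta>); the bound \<eta> < 1/4 keeps this positive.\<close>

lemma positive_rows_swap:
  fixes Q :: "real^'n^'m"
  assumes nf: "nonneg_factor Q A B" and pB: "positive_rows B"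
  obtains A' B' where "nonneg_factor Q A' B'" "positive_rows A'"
proof -
  have A0: "0 \<le> A$k$i" and AB: "A$k \<bullet> B$l = Q$k$l" for k l i
    using nf by (auto simp: nonneg_factor_def)
  let ?b = "\<lambda>l. B$l$1 + B$l$2 + B$l$3" and ?a = "\<lambda>k. A$k$1 + A$k$2 + A$k$3"
  have "\<forall>\<^sub>F \<eta> in at_right (0::real). 0 \<le> B$l$i - \<eta> * ?b l" for l i
  proof (cases "B$l = 0")
    case False
    then have pos: "0 < B$l$i" using pB by (auto simp: positive_rows_def)
    have "\<forall>\<^sub>F \<eta> in at_right (0::real). 0 < B$l$i - \<eta> * ?b l"
      by (rule eventually_pos_at_right_0) (use pos in \<open>auto intro!: continuous_intros\<close>)
    then show ?thesis by (rule eventually_mono) simp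
  qed simp
  then have e1: "\<forall>\<^sub>F \<eta> in at_right (0::real). \<forall>l i. 0 \<le> B$l$i - \<eta> * ?b l"
    by (simp add: eventually_all_finite)
  have e2: "\<forall>\<^sub>F \<eta> in at_right (0::real). \<eta> < 1/4"
    by (rule eventually_mono[OF eventually_at_right_real[of 0 "1/4"]]) auto
  obtain \<eta> :: real where \<eta>: "0 < \<eta>" "\<eta> < 1/4" and \<eta>B: "\<And>l i. 0 \<le> B$l$i - \<eta> * ?b l"
    using eventually_happens'[OF _ eventually_conj[OF eventually_at_right_less[of 0] eventually_conj[OF e2 e1]]]
    by auto
  define \<epsilon> where "\<epsilon> = \<eta> / (1 - 3 * \<eta>)"
  have \<epsilon>: "0 < \<epsilon>" "\<epsilon> - \<eta> - 3 * \<epsilon> * \<eta> = 0" using \<eta> by (simp_all add: \<epsilon>_def field_simps)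
  define A' :: "real^3^'m" where "A' = (\<chi> k i. A$k$i + \<epsilon> * ?a k)"
  define B' :: "real^3^'n" where "B' = (\<chi> l i. B$l$i - \<eta> * ?b l)"
  have "A'$k \<bullet> B'$l = A$k \<bullet> B$l + (\<epsilon> - \<eta> - 3 * \<epsilon> * \<eta>) * ?a k * ?b l" for k l
    by (simp add: inner_real3 A'_def B'_def algebra_simps)
  then have "nonneg_factor Q A' B'" using \<epsilon> A0 \<eta>B AB
    by (auto simp: nonneg_factor_def A'_def B'_def intro!: add_nonneg_nonneg mult_nonneg_nonneg)
  moreover have "positive_rows A'" unfolding positive_rows_def
  proof
    fix k
    show "A'$k = 0 \<or> (\<forall>i. 0 < A'$k$i)"
    proof (cases "A$k = 0")
      case True then show ?thesis by (simp add: A'_def vec_eq_iff)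
    next
      case False
      then have "0 < ?a k" using A0[of k 1] A0[of k 2] A0[of k 3]
        by (auto simp: vec3_eq_iff less_le)
      then have "0 < \<epsilon> * ?a k" using \<epsilon> by simp
      then have "0 < A'$k$i" for i using A0[of k i] by (simp add: A'_def)
      then show ?thesis by blast
    qed
  qed
  ultimately show ?thesis using that by blast
qed

section \<open>Triangles in general position\<close>

lemma finite_ex_min:
  fixes f :: "'a \<Rightarrow> real"
  assumes "finite S" "S \<noteq> {}"
  obtains x where "x \<in> S" "\<And>y. y \<in> S \<Longrightarrow> f x \<le> f y"
  using that[of "arg_min_on f S"] arg_min_if_finite(1)[OF assms] arg_min_least[OF assms] by blast

lemma cross3_eq_0_minors:
  "cross3 x y = 0 \<longleftrightarrow> (\<forall>i j. x$i * y$j = x$j * y$i)"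
  by (auto simp: vec3_eq_iff cross3_nth forall_3 algebra_simps)

lemma factor_nondegenerate:
  fixes Q :: "real^'n^'m" and A :: "real^3^'m" and B :: "real^3^'n"
  assumes "rank Q = 3" "\<And>k l. A$k \<bullet> B$l = Q$k$l"
  shows "(\<And>k. A$k \<bullet> x = 0) \<Longrightarrow> x = 0" "(\<And>l. B$l \<bullet> x = 0) \<Longrightarrow> x = 0"
proof -
  have Q: "Q = A ** transpose B"
    using assms(2) by (simp add: vec_eq_iff matrix_matrix_mult_def transpose_def inner_vec_def)
  have "rank A = 3" "rank B = 3"
    using rank_mul_le_left[of A "transpose B"] rank_mul_le_right[of A "transpose B"]
      rank_bound[of A] rank_bound[of B] assms(1) Q by (auto simp: rank_transpose)
  then have inj: "inj ((*v) A)" "inj ((*v) B)" by (simp_all flip: full_rank_injective)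
  show "x = 0" if "\<And>k. A$k \<bullet> x = 0"
    using injD[OF inj(1), of x 0] that by (simp add: vec_eq_iff matrix_vector_mult_def inner_vec_def)
  show "x = 0" if "\<And>l. B$l \<bullet> x = 0"
    using injD[OF inj(2), of x 0] that by (simp add: vec_eq_iff matrix_vector_mult_def inner_vec_def)
qed

lemma factor_column_nonzero:
  fixes Q :: "real^'n^'m" and A :: "real^3^'m" and B :: "real^3^'n"
  assumes "rank Q = 3" "\<And>k l. A$k \<bullet> B$l = Q$k$l"
  shows "\<exists>k. A$k$i \<noteq> 0" "\<exists>l. B$l$i \<noteq> 0"
  using factor_nondegenerate[OF assms, of "axis i 1"] by (auto simp: inner_axis axis_eq_0_iff)

text \<open>The point at vertex \<open>t\<close> is a pivot: the side through \<open>r\<close> and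
  \<open>t\<close> turns about it, with \<open>r\<close> sliding towards \<open>s\<close>, until it
  meets a point off the side through \<open>s\<close> and \<open>t\<close>. The smallest ratio
  \<tau> is where this happens first, and the side then carries two different points.\<close>

lemma tight_corner_if_not_axis_free:
  fixes Q :: "real^'n^'m"
  assumes rank: "rank Q = 3" and nf: "nonneg_factor Q A B" and naf: "\<not> axis_free B"
  obtains A' B' where "nonneg_factor Q A' B'" "tight_corner B'"
proof -
  have A0: "0 \<le> A$k$i" and B0: "0 \<le> B$l$i" and AB: "A$k \<bullet> B$l = Q$k$l" for k l i
    using nf by (auto simp: nonneg_factor_def)
  obtain l0 r s where l0: "r \<noteq> s" "B$l0$r = 0" "B$l0$s = 0" "B$l0 \<noteq> 0"
    using naf by (auto simp: axis_free_def)
  obtain t where d: "r \<noteq> s" "s \<noteq> t" "r \<noteq> t"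
    using ex_3_third[of r s] l0(1) by auto
  have l0t: "B$l0$t \<noteq> 0"
    using l0 all_3_distinct[OF d, of "\<lambda>i. B$l0$i = 0"] by (auto simp: vec_eq_iff)
  define R where "R = {l. B$l$r \<noteq> 0}"
  have "R \<noteq> {}" using factor_column_nonzero(2)[OF rank AB] by (auto simp: R_def)
  then obtain l1 where l1: "l1 \<in> R" and min: "\<And>l. l \<in> R \<Longrightarrow> B$l1$s / B$l1$r \<le> B$l$s / B$l$r"
    using finite_ex_min[of R "\<lambda>l. B$l$s / B$l$r"] by auto
  define \<tau> where "\<tau> = B$l1$s / B$l1$r"
  define A' :: "real^3^'m" where "A' = (\<chi> k i. if i = r then A$k$r + \<tau> * A$k$s else A$k$i)"
  define B' :: "real^3^'n" where "B' = (\<chi> l i. if i = s then B$l$s - \<tau> * B$l$r else B$l$i)"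
  have A': "A'$k$r = A$k$r + \<tau> * A$k$s" "A'$k$s = A$k$s" "A'$k$t = A$k$t" for k
    using d by (auto simp: A'_def)
  have B': "B'$l$r = B$l$r" "B'$l$s = B$l$s - \<tau> * B$l$r" "B'$l$t = B$l$t" for l
    using d by (auto simp: B'_def)
  have \<tau>: "0 \<le> \<tau>" by (simp add: \<tau>_def B0)
  have "0 \<le> B$l$s - \<tau> * B$l$r" for l
  proof (cases "l \<in> R")
    case True
    then have "0 < B$l$r" using B0[of l r] by (simp add: R_def)
    then show ?thesis using min[OF True] by (simp add: \<tau>_def[symmetric] field_simps)
  qed (use B0 in \<open>simp add: R_def\<close>)
  moreover have "A'$k \<bullet> B'$l = A$k \<bullet> B$l" for k l
    by (simp add: inner_3_distinct[OF d] A' B' algebra_simps)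
  ultimately have "nonneg_factor Q A' B'"
    using A0 B0 AB \<tau> by (auto simp: nonneg_factor_def A'_def B'_def)
  moreover have "tight_corner B'"
  proof -
    have "B'$l1$s = 0" "B'$l0$s = 0" using l1 l0 B' by (auto simp: R_def \<tau>_def)
    moreover have "B'$l0$t * B'$l1$r \<noteq> B'$l0$r * B'$l1$t"
      using l0t l1 l0 B' by (auto simp: R_def)
    ultimately show ?thesis unfolding tight_corner_def cross3_eq_0_minors by metis
  qed
  ultimately show ?thesis using that by blast
qed

text \<open>Passage to the triangle \<open>c1\<close>, \<open>c2\<close>, \<open>c3\<close>: by
  Cramer's rule, each new coordinate of a point is its pairing with the cross product of the other
  two vertices, divided by the determinant.\<close>

lemma nonneg_factor_frame:
  fixes Q :: "real^'n^'m"
  assumes nf: "nonneg_factor Q A B" and D: "0 < c1 \<bullet> cross3 c2 c3"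
    and A: "\<And>k. 0 \<le> A$k \<bullet> c1" "\<And>k. 0 \<le> A$k \<bullet> c2" "\<And>k. 0 \<le> A$k \<bullet> c3"
    and B: "\<And>l. 0 \<le> B$l \<bullet> cross3 c2 c3" "\<And>l. 0 \<le> B$l \<bullet> cross3 c3 c1" "\<And>l. 0 \<le> B$l \<bullet> cross3 c1 c2"
  shows "nonneg_factor Q (\<chi> k. vector [A$k \<bullet> c1, A$k \<bullet> c2, A$k \<bullet> c3])
     (\<chi> l. (1 / (c1 \<bullet> cross3 c2 c3)) *\<^sub>R
        vector [B$l \<bullet> cross3 c2 c3, B$l \<bullet> cross3 c3 c1, B$l \<bullet> cross3 c1 c2])"
proof -
  have cramer: "(a \<bullet> c1) * (b \<bullet> cross3 c2 c3) + (a \<bullet> c2) * (b \<bullet> cross3 c3 c1) + (a \<bullet> c3) * (b \<bullet> cross3 c1 c2)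
      = (c1 \<bullet> cross3 c2 c3) * (a \<bullet> b)" for a b :: "real^3"
    unfolding inner_real3 cross3_nth by algebra
  let ?D = "c1 \<bullet> cross3 c2 c3"
  have "(A$k \<bullet> c1) * (1 / ?D * (B$l \<bullet> cross3 c2 c3)) + (A$k \<bullet> c2) * (1 / ?D * (B$l \<bullet> cross3 c3 c1))
      + (A$k \<bullet> c3) * (1 / ?D * (B$l \<bullet> cross3 c1 c2)) = Q$k$l" for k l
  proof -
    have "?thesis \<longleftrightarrow> ((A$k \<bullet> c1) * (B$l \<bullet> cross3 c2 c3) + (A$k \<bullet> c2) * (B$l \<bullet> cross3 c3 c1)
      + (A$k \<bullet> c3) * (B$l \<bullet> cross3 c1 c2)) / ?D = Q$k$l"
      by (simp add: add_divide_distrib)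
    then show ?thesis unfolding cramer using D nf by (simp add: nonneg_factor_def)
  qed
  then show ?thesis using A B D
    unfolding nonneg_factor_def inner_real3[of "(\<chi> k. vector [A$k \<bullet> c1, A$k \<bullet> c2, A$k \<bullet> c3])$_"]
    by (auto simp: forall_3)
qed

text \<open>Keeping three vertices on their lines and two points on their sides leaves one degree of
  freedom. Moving along it in the right direction frees the third side, which is the conclusion
  about coordinate 2.\<close>

lemma rotate_tight_triangle:
  fixes Q :: "real^'n^'m"
  assumes nf: "nonneg_factor Q A B" and af: "axis_free A" "axis_free B"
    and ntc: "\<not> tight_corner A" "\<not> tight_corner B"
    and tA: "\<And>i. \<exists>k. A$k \<noteq> 0 \<and> A$k$i = 0" and tB: "\<And>i. \<exists>l. B$l \<noteq> 0 \<and> B$l$i = 0"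
  obtains A' B' where "nonneg_factor Q A' B'" "\<And>l. B'$l \<noteq> 0 \<Longrightarrow> 0 < B'$l$2"
proof -
  have A0: "0 \<le> A$k$i" and B0: "0 \<le> B$l$i" for k l i
    using nf by (auto simp: nonneg_factor_def)
  have Apos: "0 < A$k$j" if "A$k \<noteq> 0" "A$k$i = 0" "i \<noteq> j" for k i j
    using af(1) that A0[of k j] by (metis axis_free_def less_le)
  have Bpos: "0 < B$l$j" if "B$l \<noteq> 0" "B$l$i = 0" "i \<noteq> j" for l i j
    using af(2) that B0[of l j] by (metis axis_free_def less_le)
  obtain k1 k2 k3 where k: "A$k1 \<noteq> 0" "A$k1$1 = 0" "A$k2 \<noteq> 0" "A$k2$2 = 0" "A$k3 \<noteq> 0" "A$k3$3 = 0"
    using tA[of 1] tA[of 2] tA[of 3] by blast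
  obtain l1 l2 l3 where l: "B$l1 \<noteq> 0" "B$l1$1 = 0" "B$l2 \<noteq> 0" "B$l2$2 = 0" "B$l3 \<noteq> 0" "B$l3$3 = 0"
    using tB[of 1] tB[of 2] tB[of 3] by blast
  define w1 u1 u2 w2 w3 u3 where wu: "w1 = A$k1$2" "u1 = A$k1$3" "u2 = A$k2$1" "w2 = A$k2$3"
    "w3 = A$k3$1" "u3 = A$k3$2"
  define x1 y1 y2 x2 x3 y3 where xy: "x1 = B$l1$2" "y1 = B$l1$3" "y2 = B$l2$1" "x2 = B$l2$3"
    "x3 = B$l3$1" "y3 = B$l3$2"
  have p: "0 < w1" "0 < u1" "0 < w2" "0 < u2" "0 < w3" "0 < u3"
    "0 < x1" "0 < y1" "0 < x2" "0 < y2" "0 < x3" "0 < y3"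
    unfolding wu xy using k l by (auto intro: Apos Bpos)
  \<comment> \<open>Without tight corners the rows vanishing at one vertex are proportional, and so
    are the points on one side. One representative for each vertex and each side therefore stands
    for all contacts.\<close>
  have parA: "A$k$i * A$k'$j = A$k$j * A$k'$i" if "A$k$r = 0" "A$k'$r = 0" for k k' i j r
    using ntc(1) that unfolding tight_corner_def cross3_eq_0_minors by metis
  have parB: "B$k$i * B$k'$j = B$k$j * B$k'$i" if "B$k$r = 0" "B$k'$r = 0" for k k' i j r
    using ntc(2) that unfolding tight_corner_def cross3_eq_0_minors by metis
  \<comment> \<open>These constants solve two equations that are linear in the middle coordinate of
    \<open>c2\<close> and the last one of \<open>c3\<close>: the side through \<open>c1\<close> and
    \<open>c2\<close> keeps the point \<open>l3\<close>, and the side through \<open>c2\<close> and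
    \<open>c3\<close> keeps \<open>l1\<close>.\<close>
  define \<alpha> \<beta> where \<alpha>\<beta>: "\<alpha> = y3 * u2 / (x3 * w1)" "\<beta> = (x3 * u1 * u2 + y3 * w1 * w2) / (x3 * w1)"
  define \<gamma> \<kappa> where \<gamma>\<kappa>: "\<gamma> = y1 * u3 / (x1 * w2)" "\<kappa> = (x1 * u2 * u3 + y1 * w2 * w3) / (x1 * w2)"
  have \<alpha>: "x3 * w1 * \<alpha> = y3 * u2" and \<beta>: "x3 * w1 * \<beta> = x3 * u1 * u2 + y3 * w1 * w2"
    and \<gamma>: "x1 * w2 * \<gamma> = y1 * u3" and \<kappa>: "x1 * w2 * \<kappa> = x1 * u2 * u3 + y1 * w2 * w3"
    using p by (simp_all add: \<alpha>\<beta> \<gamma>\<kappa>)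
  have pos: "0 < \<alpha>" "0 < \<beta>" "0 < \<gamma>" "0 < \<kappa>"
    using p by (auto simp: \<alpha>\<beta> \<gamma>\<kappa> intro!: divide_pos_pos add_pos_pos mult_pos_pos)
  define g where "g = x2 * w3 - y2 * u1 * \<gamma> * \<alpha>"
  define \<sigma> :: real where "\<sigma> = (if 0 \<le> g then 1 else - 1)"
  have \<sigma>: "0 \<le> \<sigma> * g" "\<sigma> \<noteq> 0" by (auto simp: \<sigma>_def)
  define S where "S e = \<alpha> - \<beta> * (\<sigma> * e)" for e
  define R where "R e = \<gamma> * S e - \<kappa> * (\<sigma> * e)" for e
  \<comment> \<open>The off-diagonal entries of each vector are orthogonal to the line through that
    vertex, so the vertex moves along its line. The diagonal entries 1, \<open>S\<close> and
    \<open>R\<close> adjust the relative speeds.\<close>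
  define c1 :: "real \<Rightarrow> real^3" where "c1 e = vector [1, \<sigma> * e * u1, - (\<sigma> * e * w1)]" for e
  define c2 :: "real \<Rightarrow> real^3" where "c2 e = vector [- (\<sigma> * e * w2), S e, \<sigma> * e * u2]" for e
  define c3 :: "real \<Rightarrow> real^3" where "c3 e = vector [\<sigma> * e * u3, - (\<sigma> * e * w3), R e]" for e
  note c = c1_def c2_def c3_def inner_real3 cross3_nth vector_3
  have cont: "isCont S 0" "isCont R 0"
    unfolding R_def S_def by (auto intro!: continuous_intros)
  have at0: "S 0 = \<alpha>" "R 0 = \<gamma> * \<alpha>" by (simp_all add: S_def R_def)
  note ev = eventually_pos_at_right_0
  have evA: "\<forall>\<^sub>F e in at_right 0. \<forall>k. (A$k$1 \<noteq> 0 \<longrightarrow> 0 < A$k \<bullet> c1 e) \<and> (A$k$2 \<noteq> 0 \<longrightarrow> 0 < A$k \<bullet> c2 e)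
      \<and> (A$k$3 \<noteq> 0 \<longrightarrow> 0 < A$k \<bullet> c3 e)"
  proof (intro eventually_all_finite eventually_conj)
    fix k
    show "\<forall>\<^sub>F e in at_right 0. A$k$1 \<noteq> 0 \<longrightarrow> 0 < A$k \<bullet> c1 e"
    proof (cases "A$k$1 = 0")
      case False
      have "\<forall>\<^sub>F e in at_right 0. 0 < A$k \<bullet> c1 e" unfolding c
        by (rule ev) (use A0[of k 1] False in \<open>auto intro!: continuous_intros cont\<close>)
      then show ?thesis by (rule eventually_mono) simp
    qed simp
    show "\<forall>\<^sub>F e in at_right 0. A$k$2 \<noteq> 0 \<longrightarrow> 0 < A$k \<bullet> c2 e"
    proof (cases "A$k$2 = 0")
      case False
      have "\<forall>\<^sub>F e in at_right 0. 0 < A$k \<bullet> c2 e" unfolding c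
        by (rule ev) (use A0[of k 2] False pos in \<open>auto simp: at0 intro!: continuous_intros cont\<close>)
      then show ?thesis by (rule eventually_mono) simp
    qed simp
    show "\<forall>\<^sub>F e in at_right 0. A$k$3 \<noteq> 0 \<longrightarrow> 0 < A$k \<bullet> c3 e"
    proof (cases "A$k$3 = 0")
      case False
      have "\<forall>\<^sub>F e in at_right 0. 0 < A$k \<bullet> c3 e" unfolding c
        by (rule ev) (use A0[of k 3] False pos in \<open>auto simp: at0 intro!: continuous_intros cont\<close>)
      then show ?thesis by (rule eventually_mono) simp
    qed simp
  qed
  have evB: "\<forall>\<^sub>F e in at_right 0. \<forall>l. (B$l$1 \<noteq> 0 \<longrightarrow> 0 < B$l \<bullet> cross3 (c2 e) (c3 e))
      \<and> (B$l$2 \<noteq> 0 \<longrightarrow> 0 < B$l \<bullet> cross3 (c3 e) (c1 e)) \<and> (B$l$3 \<noteq> 0 \<longrightarrow> 0 < B$l \<bullet> cross3 (c1 e) (c2 e))"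
  proof (intro eventually_all_finite eventually_conj)
    fix l
    show "\<forall>\<^sub>F e in at_right 0. B$l$1 \<noteq> 0 \<longrightarrow> 0 < B$l \<bullet> cross3 (c2 e) (c3 e)"
    proof (cases "B$l$1 = 0")
      case False
      have "\<forall>\<^sub>F e in at_right 0. 0 < B$l \<bullet> cross3 (c2 e) (c3 e)" unfolding c
        by (rule ev) (use B0[of l 1] False pos in \<open>auto simp: at0 intro!: continuous_intros cont\<close>)
      then show ?thesis by (rule eventually_mono) simp
    qed simp
    show "\<forall>\<^sub>F e in at_right 0. B$l$2 \<noteq> 0 \<longrightarrow> 0 < B$l \<bullet> cross3 (c3 e) (c1 e)"
    proof (cases "B$l$2 = 0")
      case False
      have "\<forall>\<^sub>F e in at_right 0. 0 < B$l \<bullet> cross3 (c3 e) (c1 e)" unfolding c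
        by (rule ev) (use B0[of l 2] False pos in \<open>auto simp: at0 intro!: continuous_intros cont\<close>)
      then show ?thesis by (rule eventually_mono) simp
    qed simp
    show "\<forall>\<^sub>F e in at_right 0. B$l$3 \<noteq> 0 \<longrightarrow> 0 < B$l \<bullet> cross3 (c1 e) (c2 e)"
    proof (cases "B$l$3 = 0")
      case False
      have "\<forall>\<^sub>F e in at_right 0. 0 < B$l \<bullet> cross3 (c1 e) (c2 e)" unfolding c
        by (rule ev) (use B0[of l 3] False pos in \<open>auto simp: at0 intro!: continuous_intros cont\<close>)
      then show ?thesis by (rule eventually_mono) simp
    qed simp
  qed
  have evD: "\<forall>\<^sub>F e in at_right 0. 0 < c1 e \<bullet> cross3 (c2 e) (c3 e)" unfolding c
    by (rule ev) (use pos in \<open>auto simp: at0 intro!: continuous_intros cont\<close>)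
  obtain e where e: "0 < e" and D: "0 < c1 e \<bullet> cross3 (c2 e) (c3 e)"
    and eA: "\<And>k. A$k$1 \<noteq> 0 \<Longrightarrow> 0 < A$k \<bullet> c1 e" "\<And>k. A$k$2 \<noteq> 0 \<Longrightarrow> 0 < A$k \<bullet> c2 e"
      "\<And>k. A$k$3 \<noteq> 0 \<Longrightarrow> 0 < A$k \<bullet> c3 e"
    and eB: "\<And>l. B$l$1 \<noteq> 0 \<Longrightarrow> 0 < B$l \<bullet> cross3 (c2 e) (c3 e)"
      "\<And>l. B$l$2 \<noteq> 0 \<Longrightarrow> 0 < B$l \<bullet> cross3 (c3 e) (c1 e)"
      "\<And>l. B$l$3 \<noteq> 0 \<Longrightarrow> 0 < B$l \<bullet> cross3 (c1 e) (c2 e)"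
    using eventually_happens'[OF _ eventually_conj[OF eventually_at_right_less[of 0]
      eventually_conj[OF evD eventually_conj[OF evA evB]]]] by auto
  define t where "t = \<sigma> * e"
  have A1: "A$k \<bullet> c1 e = 0" if "A$k$1 = 0" for k
    using parA[OF that k(2), of 2 3] that unfolding c wu by (simp add: algebra_simps)
  have A2: "A$k \<bullet> c2 e = 0" if "A$k$2 = 0" for k
    using parA[OF that k(4), of 1 3] that unfolding c wu by (simp add: algebra_simps)
  have A3: "A$k \<bullet> c3 e = 0" if "A$k$3 = 0" for k
    using parA[OF that k(6), of 1 2] that unfolding c wu by (simp add: algebra_simps)
  have B3: "B$l \<bullet> cross3 (c1 e) (c2 e) = 0" if "B$l$3 = 0" for l
  proof -
    have par: "B$l$1 * y3 = B$l$2 * x3" using parB[OF that l(6), of 1 2] by (simp add: xy)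
    have "x3 * (B$l \<bullet> cross3 (c1 e) (c2 e)) = 0"
    proof -
      have "x3 * (B$l \<bullet> cross3 (c1 e) (c2 e))
        = B$l$1 * t * (x3 * u1 * u2 * t + (x3 * w1 * \<alpha> - x3 * w1 * \<beta> * t))
          + (B$l$2 * x3) * (t * t * w1 * w2 - t * u2)"
        unfolding c S_def t_def[symmetric] using that by (simp add: algebra_simps)
      also have "\<dots> = 0" unfolding \<alpha> \<beta> par[symmetric] by (simp add: algebra_simps)
      finally show ?thesis .
    qed
    then show ?thesis using p by simp
  qed
  have B1: "B$l \<bullet> cross3 (c2 e) (c3 e) = 0" if "B$l$1 = 0" for l
  proof -
    have par: "B$l$2 * y1 = B$l$3 * x1" using parB[OF that l(2), of 2 3] by (simp add: xy)
    have "x1 * (B$l \<bullet> cross3 (c2 e) (c3 e)) = 0"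
    proof -
      have "x1 * (B$l \<bullet> cross3 (c2 e) (c3 e))
        = B$l$2 * t * (x1 * u2 * u3 * t + (x1 * w2 * \<gamma> * S e - x1 * w2 * \<kappa> * t))
          + (B$l$3 * x1) * (t * t * w2 * w3 - t * S e * u3)"
        unfolding c R_def t_def[symmetric] using that by (simp add: algebra_simps)
      also have "\<dots> = 0" unfolding \<gamma> \<kappa> par[symmetric] by (simp add: algebra_simps)
      finally show ?thesis .
    qed
    then show ?thesis using p by simp
  qed
  \<comment> \<open>The third side moves strictly away: its displacement is \<open>t * g\<close> to first order, which the
     choice of \<open>\<sigma>\<close> makes nonnegative, and its second-order part is positive in both directions.\<close>
  have B2: "0 < B$l \<bullet> cross3 (c3 e) (c1 e)" if "B$l$2 = 0" "B$l \<noteq> 0" for l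
  proof -
    have par: "B$l$1 * x2 = B$l$3 * y2" using parB[OF that(1) l(4), of 1 3] by (simp add: xy)
    have b3: "0 < B$l$3" using Bpos that by auto
    have "x2 * (B$l \<bullet> cross3 (c3 e) (c1 e))
        = (B$l$1 * x2) * (t * t * w1 * w3 - t * R e * u1) + x2 * B$l$3 * (t * t * u1 * u3 + t * w3)"
      unfolding c t_def[symmetric] using that by (simp add: algebra_simps)
    also have "\<dots> = B$l$3 * (t * g + t * t * (y2 * u1 * (\<gamma> * \<beta> + \<kappa>) + x2 * u1 * u3 + y2 * w1 * w3))"
      unfolding par g_def R_def S_def t_def[symmetric] by (simp add: algebra_simps)
    also have "\<dots> > 0"
    proof -
      have "0 \<le> e * (\<sigma> * g)" by (rule mult_nonneg_nonneg[OF less_imp_le[OF e] \<sigma>(1)])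
      also have "\<dots> = t * g" by (simp add: t_def)
      finally have "0 \<le> t * g" .
      moreover have "t \<noteq> 0" using \<sigma>(2) e by (simp add: t_def)
      then have "0 < t * t" using not_real_square_gt_zero[of t] by blast
      moreover have "0 < y2 * u1 * (\<gamma> * \<beta> + \<kappa>) + x2 * u1 * u3 + y2 * w1 * w3"
        using p pos by (intro add_pos_pos mult_pos_pos) auto
      ultimately show ?thesis by (rule mult_pos_pos[OF b3 add_nonneg_pos[OF _ mult_pos_pos]])
    qed
    finally show ?thesis using p by (simp add: zero_less_mult_iff)
  qed
  have B2': "0 < B$l \<bullet> cross3 (c3 e) (c1 e)" if "B$l \<noteq> 0" for l
    using B2 eB(2) that by blast
  have "nonneg_factor Q (\<chi> k. vector [A$k \<bullet> c1 e, A$k \<bullet> c2 e, A$k \<bullet> c3 e])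
     (\<chi> l. (1 / (c1 e \<bullet> cross3 (c2 e) (c3 e))) *\<^sub>R
        vector [B$l \<bullet> cross3 (c2 e) (c3 e), B$l \<bullet> cross3 (c3 e) (c1 e), B$l \<bullet> cross3 (c1 e) (c2 e)])"
    (is "nonneg_factor Q ?A ?B")
  proof (rule nonneg_factor_frame[OF nf D])
    show "0 \<le> A$k \<bullet> c1 e" "0 \<le> A$k \<bullet> c2 e" "0 \<le> A$k \<bullet> c3 e" for k
      using A1 A2 A3 eA by (metis less_le order_refl)+
    show "0 \<le> B$l \<bullet> cross3 (c2 e) (c3 e)" "0 \<le> B$l \<bullet> cross3 (c1 e) (c2 e)" for l
      using B1 B3 eB by (metis less_le order_refl)+
    show "0 \<le> B$l \<bullet> cross3 (c3 e) (c1 e)" for l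
      using B2'[of l] by (cases "B$l = 0") auto
  qed
  moreover have "0 < ?B$l$2" if "?B$l \<noteq> 0" for l
  proof -
    have "B$l \<noteq> 0"
    proof
      assume "B$l = 0"
      then have "B$l \<bullet> x = 0" for x by simp
      then have "?B$l = 0" by (simp add: vec3_eq_iff)
      then show False using that by blast
    qed
    then show ?thesis using B2' D by simp
  qed
  ultimately show ?thesis using that by blast
qed

text \<open>If no factorization is special, all are axis-free. Then some vertex is on no line, or
  some side carries no point, or all six contacts occur. The first case is settled by shears, the
  second is its dual followed by a shrinking, and the rotation reduces the third to the
  second.\<close>

lemma positive_rows_or_tight_corner:
  fixes Q :: "real^'n^'m"
  assumes rank: "rank Q = 3" and nf: "nonneg_factor Q A B"
  obtains A' B' where "nonneg_factor Q A' B'" "positive_rows A' \<or> tight_corner A' \<or> tight_corner B'"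
proof (cases "\<exists>A' B'. nonneg_factor Q A' B' \<and> (tight_corner A' \<or> tight_corner B')")
  case True then show ?thesis using that by blast
next
  case False
  have rankT: "rank (transpose Q) = 3" using rank by (simp add: rank_transpose)
  have ntc: "\<not> tight_corner A'" "\<not> tight_corner B'" if "nonneg_factor Q A' B'" for A' B'
    using False that by blast+
  have af: "axis_free A'" "axis_free B'" if "nonneg_factor Q A' B'" for A' B'
  proof -
    show "axis_free B'"
      using tight_corner_if_not_axis_free[OF rank that] ntc by metis
    show "axis_free A'"
      using tight_corner_if_not_axis_free[OF rankT nonneg_factor_transpose[OF that]] ntc
      by (metis nonneg_factor_transpose transpose_transpose)
  qed
  have B_case: "\<exists>A2 B2. nonneg_factor Q A2 B2 \<and> positive_rows A2"
    if h: "nonneg_factor Q A1 B1" "\<And>l. B1$l \<noteq> 0 \<Longrightarrow> 0 < B1$l$r" for A1 B1 r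
  proof -
    obtain B2 A2 where "nonneg_factor (transpose Q) B2 A2" "positive_rows B2"
      using positive_rows_if_positive_column[OF nonneg_factor_transpose[OF h(1)] af(2,1)[OF h(1)] h(2)]
      by blast
    then show ?thesis using positive_rows_swap nonneg_factor_transpose transpose_transpose by metis
  qed
  consider (A) r where "\<And>k. A$k \<noteq> 0 \<Longrightarrow> A$k$r \<noteq> 0" | (B) r where "\<And>l. B$l \<noteq> 0 \<Longrightarrow> B$l$r \<noteq> 0"
    | (C) "\<And>i. \<exists>k. A$k \<noteq> 0 \<and> A$k$i = 0" "\<And>i. \<exists>l. B$l \<noteq> 0 \<and> B$l$i = 0" by metis
  then have "\<exists>A2 B2. nonneg_factor Q A2 B2 \<and> positive_rows A2"
  proof cases
    case A
    have "0 < A$k$r" if "A$k \<noteq> 0" for k using A[OF that] nf by (simp add: nonneg_factor_def less_le)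
    then show ?thesis using positive_rows_if_positive_column[OF nf af[OF nf]] by metis
  next
    case B
    have "0 < B$l$r" if "B$l \<noteq> 0" for l using B[OF that] nf by (simp add: nonneg_factor_def less_le)
    then show ?thesis using B_case[OF nf] by blast
  next
    case C
    then show ?thesis using rotate_tight_triangle[OF nf af[OF nf] ntc[OF nf]] B_case by metis
  qed
  then show ?thesis using that by blast
qed

section \<open>Perturbation by the product of the marginals\<close>

lemma nonneg_rank_le_3_iff: "nonneg_rank_le_3 Q \<longleftrightarrow> (\<exists>A B. nonneg_factor Q A B)"
proof
  assume "nonneg_rank_le_3 Q"
  then obtain A :: "real^3^_" and B :: "real^_^3"
    where "nonneg_matrix A" "nonneg_matrix B" "Q = A ** B"
    by (auto simp: nonneg_rank_le_3_def)
  then have "nonneg_factor Q A (transpose B)"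
    by (auto simp: nonneg_factor_def nonneg_matrix_def transpose_def matrix_matrix_mult_def inner_vec_def)
  then show "\<exists>A B. nonneg_factor Q A B" by blast
next
  assume "\<exists>A B. nonneg_factor Q A B"
  then obtain A B where "nonneg_factor Q A B" by blast
  then have "nonneg_matrix A" "nonneg_matrix (transpose B)" "Q = A ** transpose B"
    by (auto simp: nonneg_factor_def nonneg_matrix_def transpose_def matrix_matrix_mult_def inner_vec_def vec_eq_iff)
  then show "nonneg_rank_le_3 Q" by (auto simp: nonneg_rank_le_3_def)
qed

section \<open>Closedness of the set of matrices of nonnegative rank at most 3\<close>

lemma norm_matrix_le_sum: "norm A \<le> (\<Sum>k\<in>UNIV. \<Sum>i\<in>UNIV. \<bar>A$k$i\<bar>)" for A :: "real^'n^'m"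
proof -
  have "norm A \<le> (\<Sum>k\<in>UNIV. norm (A$k))" by (simp add: norm_vec_def L2_set_le_sum)
  also have "\<dots> \<le> (\<Sum>k\<in>UNIV. \<Sum>i\<in>UNIV. \<bar>A$k$i\<bar>)" by (intro sum_mono norm_le_l1_cart)
  finally show ?thesis .
qed

lemma compact_bounded_matrices: "compact {A :: real^'n^'m. \<forall>k i. l \<le> A$k$i \<and> A$k$i \<le> u}"
proof -
  have "norm A \<le> real CARD('m) * (real CARD('n) * (\<bar>l\<bar> + \<bar>u\<bar>))"
    if "\<forall>k i. l \<le> A$k$i \<and> A$k$i \<le> u" for A :: "real^'n^'m"
  proof -
    have "\<bar>A$k$i\<bar> \<le> \<bar>l\<bar> + \<bar>u\<bar>" for k i using that[rule_format, of k i] by linarith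
    then have "(\<Sum>k\<in>UNIV. \<Sum>i\<in>UNIV. \<bar>A$k$i\<bar>) \<le> (\<Sum>k\<in>(UNIV::'m set). \<Sum>i\<in>(UNIV::'n set). \<bar>l\<bar> + \<bar>u\<bar>)"
      by (intro sum_mono) auto
    then show ?thesis using norm_matrix_le_sum[of A] by simp
  qed
  then have "bounded {A :: real^'n^'m. \<forall>k i. l \<le> A$k$i \<and> A$k$i \<le> u}"
    unfolding bounded_iff by blast
  moreover have "closed {A :: real^'n^'m. \<forall>k i. l \<le> A$k$i \<and> A$k$i \<le> u}"
    by (intro closed_Collect_all closed_Collect_conj closed_Collect_le continuous_intros)
  ultimately show ?thesis by (simp add: compact_eq_bounded_closed)
qed

text \<open>Divide each column of \<open>A\<close> by its maximum and multiply the column of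
  \<open>B\<close> accordingly. As the maximum is attained at some row, each new entry of
  \<open>B\<close> is one of the nonnegative terms summing to an entry of \<open>Q\<close>.\<close>

lemma nonneg_factor_unit_entries:
  fixes Q :: "real^'n^'m"
  assumes nf: "nonneg_factor Q A B" and Q1: "\<And>k l. Q$k$l \<le> 1"
  obtains A' B' where "nonneg_factor Q A' B'" "\<And>k i. A'$k$i \<le> 1" "\<And>l i. B'$l$i \<le> 1"
proof -
  have A0: "0 \<le> A$k$i" and B0: "0 \<le> B$l$i" and AB: "A$k \<bullet> B$l = Q$k$l" for k l i
    using nf by (auto simp: nonneg_factor_def)
  define M where "M i = Max (range (\<lambda>k. A$k$i))" for i
  have M: "A$k$i \<le> M i" for k i unfolding M_def by (rule Max_ge) auto
  have M': "\<exists>k. M i = A$k$i" for i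
  proof -
    have "M i \<in> range (\<lambda>k. A$k$i)" unfolding M_def by (rule Max_in) auto
    then show ?thesis by auto
  qed
  have M0: "0 \<le> M i" for i using M' A0 by metis
  \<comment> \<open>If \<open>M i = 0\<close>, column \<open>i\<close> of \<open>A\<close> vanishes,
    and both products get the term 0 because division by 0 yields 0.\<close>
  define A' :: "real^3^'m" where "A' = (\<chi> k i. A$k$i / M i)"
  define B' :: "real^3^'n" where "B' = (\<chi> l i. M i * B$l$i)"
  show ?thesis
  proof (rule that[of A' B'])
    have "A'$k$i * B'$l$i = A$k$i * B$l$i" for k l i
    proof (cases "M i = 0")
      case True
      then have "A$k$i = 0" using M[of k i] A0[of k i] by simp
      then show ?thesis by (simp add: A'_def)
    qed (simp add: A'_def B'_def)
    then have "A'$k \<bullet> B'$l = Q$k$l" for k l using AB[of k l] by (simp add: inner_vec_def)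
    then show "nonneg_factor Q A' B'" using A0 B0 M0 by (auto simp: nonneg_factor_def A'_def B'_def)
    show "A'$k$i \<le> 1" for k i using M[of k i] M0[of i] by (cases "M i = 0") (auto simp: A'_def divide_simps)
    show "B'$l$i \<le> 1" for l i
    proof -
      obtain k where k: "M i = A$k$i" using M' by blast
      have "A$k$i * B$l$i \<le> A$k \<bullet> B$l" unfolding inner_vec_def inner_real_def
        by (rule member_le_sum) (auto intro: mult_nonneg_nonneg[OF A0 B0])
      then show ?thesis using Q1[of k l] AB[of k l] by (simp add: B'_def k)
    qed
  qed
qed

text \<open>The bound on the entries allows bounded factors, so that the set is cut out of the
  continuous image of a compact set of factor pairs by closed conditions.\<close>

lemma closed_nonneg_rank_le_3:
  "closed {Q :: real^'n^'m. nonneg_rank_le_3 Q \<and> (\<forall>k l. Q$k$l \<le> 1)}"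
proof -
  let ?K = "{A :: real^3^'m. \<forall>k i. 0 \<le> A$k$i \<and> A$k$i \<le> 1} \<times> {B :: real^3^'n. \<forall>k i. 0 \<le> B$k$i \<and> B$k$i \<le> 1}"
  let ?f = "\<lambda>(A :: real^3^'m, B :: real^3^'n). (\<chi> k l. A$k \<bullet> B$l) :: real^'n^'m"
  have "compact (?f ` ?K)"
    by (intro compact_continuous_image compact_Times compact_bounded_matrices)
      (auto simp: case_prod_unfold intro!: continuous_intros)
  then have "closed (?f ` ?K \<inter> {Q. \<forall>k l. Q$k$l \<le> 1})"
    by (intro closed_Int compact_imp_closed closed_Collect_all closed_Collect_le continuous_intros) auto
  also have "?f ` ?K \<inter> {Q. \<forall>k l. Q$k$l \<le> 1} = {Q. nonneg_rank_le_3 Q \<and> (\<forall>k l. Q$k$l \<le> 1)}"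
  proof (intro set_eqI iffI)
    fix Q :: "real^'n^'m" assume "Q \<in> {Q. nonneg_rank_le_3 Q \<and> (\<forall>k l. Q$k$l \<le> 1)}"
    then obtain A B where "nonneg_factor Q A B" and Q1: "\<And>k l. Q$k$l \<le> 1"
      by (auto simp: nonneg_rank_le_3_iff)
    then obtain A B where "nonneg_factor Q A B" "\<And>k i. A$k$i \<le> 1" "\<And>l i. B$l$i \<le> 1"
      using nonneg_factor_unit_entries by metis
    then have "Q = ?f (A, B)" "(A, B) \<in> ?K" by (auto simp: nonneg_factor_def vec_eq_iff)
    then show "Q \<in> ?f ` ?K \<inter> {Q. \<forall>k l. Q$k$l \<le> 1}" using Q1 by blast
  next
    fix Q assume "Q \<in> ?f ` ?K \<inter> {Q. \<forall>k l. Q$k$l \<le> 1}"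
    then obtain A B where "Q = ?f (A, B)" "(A, B) \<in> ?K" and Q1: "\<forall>k l. Q$k$l \<le> 1" by blast
    then have "nonneg_factor Q A B" by (auto simp: nonneg_factor_def)
    then show "Q \<in> {Q. nonneg_rank_le_3 Q \<and> (\<forall>k l. Q$k$l \<le> 1)}"
      using Q1 by (auto simp: nonneg_rank_le_3_iff)
  qed
  finally show ?thesis .
qed

section \<open>Contraction of the outer polygon\<close>

definition marginal_shift :: "real^'n^'m \<Rightarrow> real \<Rightarrow> real^'n^'m" where
  "marginal_shift P \<delta> =
     (\<chi> k l. P$k$l - \<delta> * (\<Sum>l'\<in>UNIV. P$k$l') * (\<Sum>k'\<in>UNIV. P$k'$l))"

lemma marginal_shift_0 [simp]: "marginal_shift P 0 = P"
  by (simp add: marginal_shift_def vec_eq_iff)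

lemma transpose_marginal_shift: "transpose (marginal_shift P \<delta>) = marginal_shift (transpose P) \<delta>"
  by (simp add: marginal_shift_def transpose_def vec_eq_iff)

lemma entry_sum_alt: "entry_sum P = (\<Sum>q\<in>UNIV. \<Sum>p\<in>UNIV. P$p$q)"
  unfolding entry_sum_def by (rule sum.swap)

lemma entry_sum_transpose: "entry_sum (transpose P) = entry_sum P"
  by (simp add: entry_sum_alt[of P]) (simp add: entry_sum_def transpose_def)

lemma marginal_shift_row_sum:
  assumes "entry_sum P = 1"
  shows "(\<Sum>l\<in>UNIV. marginal_shift P \<delta> $ k $ l) = (1 - \<delta>) * (\<Sum>l\<in>UNIV. P$k$l)"
proof -
  have "(\<Sum>l\<in>UNIV. \<Sum>k'\<in>UNIV. P$k'$l) = 1" using assms by (simp add: entry_sum_alt)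
  then show ?thesis
    by (simp add: marginal_shift_def sum_subtractf sum_distrib_left[symmetric] algebra_simps)
qed

lemma marginal_shift_column_sum:
  assumes "entry_sum P = 1"
  shows "(\<Sum>k\<in>UNIV. marginal_shift P \<delta> $ k $ l) = (1 - \<delta>) * (\<Sum>k\<in>UNIV. P$k$l)"
  using marginal_shift_row_sum[of "transpose P" \<delta> l] assms
  by (simp add: entry_sum_transpose transpose_marginal_shift[symmetric]) (simp add: transpose_def)

lemma entry_sum_marginal_shift:
  assumes "entry_sum P = 1" shows "entry_sum (marginal_shift P \<delta>) = 1 - \<delta>"
proof -
  have "entry_sum (marginal_shift P \<delta>) = (\<Sum>k\<in>UNIV. (1 - \<delta>) * (\<Sum>l\<in>UNIV. P$k$l))"
    using marginal_shift_row_sum[OF assms] by (simp add: entry_sum_def)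
  also have "\<dots> = 1 - \<delta>" using assms by (simp add: entry_sum_def sum_distrib_left[symmetric])
  finally show ?thesis .
qed

text \<open>The shift is right multiplication by I - \<delta> 1 c^T, where c is the column marginal.
  Since c sums to 1, the inverse is I + (\<delta> / (1 - \<delta>)) 1 c^T.\<close>

lemma rank_marginal_shift:
  fixes P :: "real^'n^'m"
  assumes "entry_sum P = 1" "\<delta> \<noteq> 1"
  shows "rank (marginal_shift P \<delta>) = rank P"
proof (rule antisym)
  let ?c = "\<lambda>l. \<Sum>k\<in>UNIV. P$k$l"
  have mult: "(Q ** (\<chi> l' l. (if l' = l then 1 else 0) + t * ?c l)) $ k $ l = Q$k$l + t * (\<Sum>l'\<in>UNIV. Q$k$l') * ?c l"
    for Q :: "real^'n^'m" and t k l
  proof -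
    have "(Q ** (\<chi> l' l. (if l' = l then 1 else 0) + t * ?c l)) $ k $ l
        = (\<Sum>l'\<in>UNIV. (if l' = l then Q$k$l' else 0) + Q$k$l' * (t * ?c l))"
      unfolding matrix_matrix_mult_def by (auto intro!: sum.cong simp: algebra_simps)
    also have "\<dots> = Q$k$l + (\<Sum>l'\<in>UNIV. Q$k$l') * (t * ?c l)"
      unfolding sum.distrib sum_distrib_right by simp
    finally show ?thesis by (simp add: mult_ac)
  qed
  have "marginal_shift P \<delta> = P ** (\<chi> l' l. (if l' = l then 1 else 0) + (- \<delta>) * ?c l)"
    unfolding vec_eq_iff mult by (simp add: marginal_shift_def)
  then show "rank (marginal_shift P \<delta>) \<le> rank P"
    using rank_mul_le_left[of P "\<chi> l' l. (if l' = l then 1 else 0) + (- \<delta>) * ?c l"] by simp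
  have P: "P = marginal_shift P \<delta> ** (\<chi> l' l. (if l' = l then 1 else 0) + (\<delta> / (1 - \<delta>)) * ?c l)"
    unfolding vec_eq_iff mult marginal_shift_row_sum[OF assms(1)]
    using assms(2) by (simp add: marginal_shift_def)
  show "rank P \<le> rank (marginal_shift P \<delta>)" by (subst P) (rule rank_mul_le_left)
qed

text \<open>For \<delta> = 1 the entries of the shift sum to 0. If they are nonnegative they all
  vanish, and \<open>P\<close> is the product of its marginals. This keeps the largest feasible
  \<delta> below 1.\<close>

lemma marginal_shift_1_rank:
  assumes "nonneg_matrix (marginal_shift P 1)" "entry_sum P = 1"
  shows "rank P \<noteq> 3"
proof
  assume rank: "rank P = 3"
  let ?Q = "marginal_shift P 1"
  have Q0: "0 \<le> ?Q$k$l" for k l using assms(1) by (simp add: nonneg_matrix_def)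
  have "(\<Sum>k\<in>UNIV. \<Sum>l\<in>UNIV. ?Q$k$l) = 0"
    using entry_sum_marginal_shift[OF assms(2), of 1] by (simp add: entry_sum_def)
  then have "?Q$k$l = 0" for k l
    using Q0 by (simp add: sum_nonneg_eq_0_iff sum_nonneg)
  then have P: "P$k$l = (\<Sum>l'\<in>UNIV. P$k$l') * (\<Sum>k'\<in>UNIV. P$k'$l)" for k l
    unfolding marginal_shift_def by (metis (no_types, lifting) eq_iff_diff_eq_0 mult_1 vec_lambda_beta)
  define A :: "real^3^_" where "A = (\<chi> k. vector [\<Sum>l\<in>UNIV. P$k$l, 0, 0])"
  define B :: "real^3^_" where "B = (\<chi> l. vector [\<Sum>k\<in>UNIV. P$k$l, 0, 0])"
  have "A$k \<bullet> B$l = P$k$l" for k l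
    by (simp add: A_def B_def inner_real3 flip: P[of k l])
  then show False using factor_column_nonzero(1)[OF rank, of A B 2] by (auto simp: A_def)
qed

text \<open>The largest feasible perturbation has no triangle in general position, since such a triangle
  would leave room for a larger one.\<close>

lemma critical_marginal_shift:
  fixes P :: "real^'n^'m"
  assumes rank: "rank P = 3" and nn: "nonneg_matrix P" and sum1: "entry_sum P = 1"
    and \<delta>0: "0 \<le> \<delta>\<^sub>0" "\<delta>\<^sub>0 \<le> 1" "nonneg_rank_le_3 (marginal_shift P \<delta>\<^sub>0)"
  obtains \<delta> A B where "\<delta>\<^sub>0 \<le> \<delta>" "\<delta> < 1" "nonneg_factor (marginal_shift P \<delta>) A B"
    "tight_corner A \<or> tight_corner B"
proof -
  have P0: "0 \<le> P$k$l" for k l using nn by (simp add: nonneg_matrix_def)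
  have P1: "P$k$l \<le> 1" for k l
  proof -
    have "P$k$l \<le> (\<Sum>l\<in>UNIV. P$k$l)" by (rule member_le_sum) (auto intro: P0)
    also have "\<dots> \<le> (\<Sum>k\<in>UNIV. \<Sum>l\<in>UNIV. P$k$l)"
      by (rule member_le_sum[of k UNIV "\<lambda>k. \<Sum>l\<in>UNIV. P$k$l"]) (auto intro: P0 sum_nonneg)
    finally show ?thesis using sum1 by (simp add: entry_sum_def)
  qed
  have le1: "marginal_shift P \<delta> $ k $ l \<le> 1" if "0 \<le> \<delta>" for \<delta> k l
  proof -
    have "0 \<le> \<delta> * (\<Sum>l'\<in>UNIV. P$k$l') * (\<Sum>k'\<in>UNIV. P$k'$l)"
      by (intro mult_nonneg_nonneg sum_nonneg) (auto intro: P0 that)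
    then show ?thesis using P1[of k l] by (simp add: marginal_shift_def)
  qed
  let ?S = "{0..1} \<inter> marginal_shift P -` {Q. nonneg_rank_le_3 Q \<and> (\<forall>k l. Q$k$l \<le> 1)}"
  have "continuous_on UNIV (marginal_shift P)"
    unfolding marginal_shift_def by (intro continuous_intros)
  then have "compact ?S"
    by (intro compact_Int_closed closed_vimage closed_nonneg_rank_le_3) auto
  moreover have "\<delta>\<^sub>0 \<in> ?S" using \<delta>0 le1 by auto
  ultimately obtain \<delta> where \<delta>: "\<delta> \<in> ?S" and max: "\<And>t. t \<in> ?S \<Longrightarrow> t \<le> \<delta>"
    using compact_attains_sup[of ?S] by blast
  have max': "\<not> nonneg_rank_le_3 (marginal_shift P t)" if "\<delta> < t" "t \<le> 1" for t
    using max[of t] that \<delta> le1[of t] by fastforce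
  obtain A0 B0 where nf0: "nonneg_factor (marginal_shift P \<delta>) A0 B0"
    using \<delta> by (auto simp: nonneg_rank_le_3_iff)
  have "nonneg_matrix (marginal_shift P \<delta>)"
    unfolding nonneg_matrix_def
  proof (intro allI)
    fix k l
    have "marginal_shift P \<delta> $ k $ l = A0$k \<bullet> B0$l" using nf0 by (simp add: nonneg_factor_def)
    also have "\<dots> \<ge> 0" unfolding inner_vec_def using nf0
      by (intro sum_nonneg) (simp add: nonneg_factor_def)
    finally show "0 \<le> marginal_shift P \<delta> $ k $ l" .
  qed
  then have \<delta>1: "\<delta> \<noteq> 1" "0 \<le> \<delta>" "\<delta> < 1" using marginal_shift_1_rank[of P] rank sum1 \<delta> by (auto simp: less_le)
  have "rank (marginal_shift P \<delta>) = 3" using rank_marginal_shift[OF sum1 \<delta>1(1)] rank by simp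
  from positive_rows_or_tight_corner[OF this nf0] obtain A B
    where nf: "nonneg_factor (marginal_shift P \<delta>) A B"
      and alt: "positive_rows A \<or> tight_corner A \<or> tight_corner B" by blast
  have "\<not> positive_rows A"
  proof
    assume pA: "positive_rows A"
    have B0: "0 \<le> B$l$i" and AB: "A$k \<bullet> B$l = marginal_shift P \<delta> $ k $ l" for k l i
      using nf by (auto simp: nonneg_factor_def)
    \<comment> \<open>The sum of the lines pairs with the points to 1 - \<delta> times the column
      sums. Subtracting \<epsilon> / (1 - \<delta>) times the row sum times \<psi> from each line
      therefore raises \<delta> by \<epsilon>.\<close>
    define \<psi> where "\<psi> = (\<Sum>k\<in>UNIV. A$k)"
    let ?r = "\<lambda>k. \<Sum>l\<in>UNIV. P$k$l" and ?c = "\<lambda>l. \<Sum>k\<in>UNIV. P$k$l"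
    have c: "\<psi> \<bullet> B$l = (1 - \<delta>) * ?c l" for l
      by (simp add: \<psi>_def inner_sum_left AB marginal_shift_column_sum[OF sum1])
    have r: "?r k = 0" if "A$k = 0" for k
    proof -
      have "(1 - \<delta>) * ?r k = (\<Sum>l\<in>UNIV. A$k \<bullet> B$l)"
        by (simp add: AB marginal_shift_row_sum[OF sum1])
      then show ?thesis using that \<delta>1 by simp
    qed
    have "\<forall>\<^sub>F \<epsilon> in at_right 0. 0 \<le> A$k$i - \<epsilon> * (?r k / (1 - \<delta>)) * \<psi>$i" for k i
    proof (cases "A$k = 0")
      case False
      then have "0 < A$k$i" using pA by (auto simp: positive_rows_def)
      then have "\<forall>\<^sub>F \<epsilon> in at_right 0. 0 < A$k$i - \<epsilon> * (?r k / (1 - \<delta>)) * \<psi>$i"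
        by (intro eventually_pos_at_right_0) (use \<delta>1 in \<open>auto intro!: continuous_intros\<close>)
      then show ?thesis by (rule eventually_mono) simp
    qed (simp add: r)
    then have e1: "\<forall>\<^sub>F \<epsilon> in at_right 0. \<forall>k i. 0 \<le> A$k$i - \<epsilon> * (?r k / (1 - \<delta>)) * \<psi>$i"
      by (simp add: eventually_all_finite)
    have e2: "\<forall>\<^sub>F \<epsilon> in at_right 0. \<epsilon> < 1 - \<delta>"
      by (rule eventually_mono[OF eventually_at_right_real[of 0 "1 - \<delta>"]]) (use \<delta>1 in auto)
    obtain \<epsilon> where \<epsilon>: "0 < \<epsilon>" "\<epsilon> < 1 - \<delta>"
      and \<epsilon>A: "\<And>k i. 0 \<le> A$k$i - \<epsilon> * (?r k / (1 - \<delta>)) * \<psi>$i"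
      using eventually_happens'[OF _ eventually_conj[OF eventually_at_right_less[of 0] eventually_conj[OF e2 e1]]]
      by auto
    define A' where "A' = (\<chi> k. A$k - (\<epsilon> * (?r k / (1 - \<delta>))) *\<^sub>R \<psi>)"
    have "A'$k \<bullet> B$l = marginal_shift P (\<delta> + \<epsilon>) $ k $ l" for k l
    proof -
      have "A'$k \<bullet> B$l = A$k \<bullet> B$l - \<epsilon> * (?r k / (1 - \<delta>)) * ((1 - \<delta>) * ?c l)"
        by (simp add: A'_def inner_diff_left c)
      also have "\<dots> = marginal_shift P (\<delta> + \<epsilon>) $ k $ l"
        using \<delta>1 by (simp add: AB) (simp add: marginal_shift_def algebra_simps)
      finally show ?thesis .
    qed
    then have "nonneg_factor (marginal_shift P (\<delta> + \<epsilon>)) A' B"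
      using \<epsilon>A B0 by (auto simp: nonneg_factor_def A'_def)
    then show False using max'[of "\<delta> + \<epsilon>"] \<epsilon> by (auto simp: nonneg_rank_le_3_iff)
  qed
  moreover have "\<delta>\<^sub>0 \<le> \<delta>" using max \<open>\<delta>\<^sub>0 \<in> ?S\<close> by blast
  ultimately show ?thesis using that nf alt \<delta>1 by blast
qed

section \<open>Triangles at a vertex of the outer polygon\<close>

lemma nondegenerate_left_inverse:
  fixes B :: "real^3^'n"
  assumes "\<And>x. (\<And>l. B$l \<bullet> x = 0) \<Longrightarrow> x = 0"
  obtains R :: "real^'n^3" where "\<And>r s. (\<Sum>l\<in>UNIV. R$r$l * B$l$s) = (if r = s then 1 else 0)"
proof -
  have "\<forall>x. B *v x = 0 \<longrightarrow> x = 0"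
  proof (intro allI impI)
    fix x assume x: "B *v x = 0"
    have "B$l \<bullet> x = (B *v x)$l" for l by (simp add: matrix_vector_mult_def inner_vec_def)
    then have "B$l \<bullet> x = 0" for l by (simp add: x)
    then show "x = 0" by (rule assms)
  qed
  then obtain R where R: "R ** B = mat 1" using matrix_left_invertible_ker[of B] by blast
  have "(\<Sum>l\<in>UNIV. R$r$l * B$l$s) = (if r = s then 1 else 0)" for r s
    using arg_cong[OF R, of "\<lambda>M. M$r$s"] by (simp add: matrix_matrix_mult_def mat_def)
  then show ?thesis using that by blast
qed

text \<open>The triangle is given by vectors in the coordinates of the original factorization, so
  that its special vertex can be compared with \<open>vtx A i j\<close>.\<close>

definition corner_triangle ::
    "real^3^'m \<Rightarrow> real^3^'n \<Rightarrow> 'm \<Rightarrow> 'm \<Rightarrow> real^3 \<Rightarrow> real^3 \<Rightarrow> real^3 \<Rightarrow> bool" where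
  "corner_triangle A B i j v c d \<longleftrightarrow> cross3 (A$i) (A$j) \<noteq> 0 \<and> v \<noteq> 0 \<and> A$i \<bullet> v = 0 \<and> A$j \<bullet> v = 0 \<and>
     (\<forall>k. 0 \<le> A$k \<bullet> v \<and> 0 \<le> A$k \<bullet> c \<and> 0 \<le> A$k \<bullet> d) \<and>
     (\<forall>l. \<exists>x y z. 0 \<le> x \<and> 0 \<le> y \<and> 0 \<le> z \<and> B$l = x *\<^sub>R v + y *\<^sub>R c + z *\<^sub>R d)"

text \<open>The triangle of the shifted matrix already surrounds the points. Only \<open>w r\<close>
  is replaced, by its image \<open>v\<close> under the inverse homothety \<open>m\<close>. No point
  is lost: \<open>w r\<close> lies between \<open>v\<close> and the centre \<open>g\<close>, which
  itself belongs to the old triangle, so \<open>w r\<close> lies in the new one.\<close>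

lemma corner_triangle_if_tight_corner:
  fixes P :: "real^'n^'m"
  assumes rank: "rank P = 3" and nn: "nonneg_matrix P" and sum1: "entry_sum P = 1"
    and AB: "\<And>k l. A$k \<bullet> B$l = P$k$l"
    and \<delta>: "0 \<le> \<delta>" "\<delta> < 1" and nf: "nonneg_factor (marginal_shift P \<delta>) A' B'" and tc: "tight_corner A'"
  obtains i j v c d where "corner_triangle A B i j v c d"
    "0 < \<delta> \<Longrightarrow> (\<And>k l. 0 < P$k$l) \<Longrightarrow> \<forall>k. 0 < A$k \<bullet> c \<and> 0 < A$k \<bullet> d"
proof -
  have A'0: "0 \<le> A'$k$i" and B'0: "0 \<le> B'$l$i"
    and AB': "A'$k \<bullet> B'$l = marginal_shift P \<delta> $ k $ l" for k l i
    using nf by (auto simp: nonneg_factor_def)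
  have P0: "0 \<le> P$k$l" for k l using nn by (simp add: nonneg_matrix_def)
  have rank': "rank (marginal_shift P \<delta>) = 3" using rank_marginal_shift[OF sum1] rank \<delta> by simp
  note ndA = factor_nondegenerate(1)[OF rank AB] and ndB' = factor_nondegenerate(2)[OF rank' AB']
  define g where "g = (\<Sum>l\<in>UNIV. B$l)"
  define h where "h = (\<Sum>k\<in>UNIV. A$k)"
  have r: "(\<Sum>l\<in>UNIV. P$k$l) = A$k \<bullet> g" for k by (simp add: g_def inner_sum_right AB)
  have c: "(\<Sum>k\<in>UNIV. P$k$l) = h \<bullet> B$l" for l by (simp add: h_def inner_sum_left AB)
  have hg: "h \<bullet> g = 1"
    using sum1 by (simp add: entry_sum_def r h_def inner_sum_left)
  have shift: "A'$k \<bullet> B'$l = A$k \<bullet> B$l - \<delta> * (A$k \<bullet> g) * (h \<bullet> B$l)" for k l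
    by (simp add: AB' marginal_shift_def r c AB)
  obtain R where R: "\<And>r s. (\<Sum>l\<in>UNIV. R$r$l * B'$l$s) = (if r = s then 1 else 0)"
    using nondegenerate_left_inverse[of B', OF ndB'] by blast
  \<comment> \<open>The vertices of the triangle in the original coordinates, recovered from the
    points through a left inverse of \<open>B'\<close>.\<close>
  define w where "w r = (\<Sum>l\<in>UNIV. R$r$l *\<^sub>R B$l)" for r
  define m where "m x = x - (\<delta> * (h \<bullet> x)) *\<^sub>R g" for x
  have hm: "h \<bullet> m x = (1 - \<delta>) * (h \<bullet> x)" for x
    by (simp add: m_def inner_diff_right hg algebra_simps)
  have Am: "A$k \<bullet> m (w r) = A'$k$r" for k r
  proof -
    have "A$k \<bullet> m (w r) = (\<Sum>l\<in>UNIV. R$r$l * (A$k \<bullet> B$l)) - \<delta> * (\<Sum>l\<in>UNIV. R$r$l * (h \<bullet> B$l)) * (A$k \<bullet> g)"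
      by (simp add: m_def w_def inner_diff_right inner_sum_right)
    also have "\<dots> = (\<Sum>l\<in>UNIV. R$r$l * (A'$k \<bullet> B'$l))"
      unfolding shift by (simp add: sum_subtractf sum_distrib_left sum_distrib_right algebra_simps)
    also have "\<dots> = (\<Sum>l\<in>UNIV. \<Sum>s\<in>UNIV. A'$k$s * (R$r$l * B'$l$s))"
      by (simp add: inner_vec_def sum_distrib_left mult_ac)
    also have "\<dots> = (\<Sum>s\<in>UNIV. A'$k$s * (\<Sum>l\<in>UNIV. R$r$l * B'$l$s))"
      by (subst sum.swap) (simp add: sum_distrib_left)
    also have "\<dots> = A'$k$r" by (simp add: R if_distrib cong: if_cong)
    finally show ?thesis .
  qed
  have B: "B$l = (\<Sum>r\<in>UNIV. B'$l$r *\<^sub>R w r)" for l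
  proof -
    define x where "x = B$l - (\<Sum>r\<in>UNIV. B'$l$r *\<^sub>R w r)"
    have mx: "m x = m (B$l) - (\<Sum>r\<in>UNIV. B'$l$r *\<^sub>R m (w r))"
    proof -
      have "linear m" unfolding m_def
        by (intro linearI) (simp_all add: inner_add_right algebra_simps)
      then show ?thesis unfolding x_def by (simp add: linear_diff linear_sum linear_scale)
    qed
    have "A$k \<bullet> m x = 0" for k
    proof -
      have "A$k \<bullet> m (B$l) = A'$k \<bullet> B'$l" by (simp add: shift m_def inner_diff_right)
      then show ?thesis unfolding mx
        by (simp add: inner_diff_right inner_sum_right Am) (simp add: inner_vec_def mult_ac)
    qed
    then have m0: "m x = 0" by (rule ndA)
    then have "h \<bullet> x = 0" using hm[of x] \<delta> by simp
    then show ?thesis using m0 by (simp add: m_def x_def)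
  qed
  obtain i j r where ij: "A'$i$r = 0" "A'$j$r = 0" "cross3 (A'$i) (A'$j) \<noteq> 0"
    using tc by (auto simp: tight_corner_def)
  obtain s t where d: "r \<noteq> s" "s \<noteq> t" "r \<noteq> t" using ex_3_distinct by blast
  define v where "v = m (w r)"
  have hw: "0 < h \<bullet> w q" for q
  proof -
    obtain k where k: "A'$k$q \<noteq> 0" using factor_column_nonzero(1)[OF rank' AB'] by blast
    have "0 < (\<Sum>k\<in>UNIV. A'$k$q)"
      by (rule sum_pos2[of _ k]) (use A'0 k in \<open>auto simp: less_le\<close>)
    also have "\<dots> = h \<bullet> m (w q)" by (simp add: h_def inner_sum_left Am)
    finally show ?thesis using hm[of "w q"] \<delta> by (simp add: zero_less_mult_iff)
  qed
  have v0: "v \<noteq> 0" using hw[of r] hm[of "w r"] \<delta> by (auto simp: v_def)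
  have Ag: "0 \<le> A$k \<bullet> g" for k using P0 by (simp add: r[symmetric] sum_nonneg)
  have Aw: "A$k \<bullet> w q = A'$k$q + \<delta> * (h \<bullet> w q) * (A$k \<bullet> g)" for k q
    using Am[of k q] by (simp add: m_def inner_diff_right)
  have Aw0: "0 \<le> A$k \<bullet> w q" for k q
    unfolding Aw using hw[of q] Ag[of k] A'0 \<delta> by (intro add_nonneg_nonneg mult_nonneg_nonneg) auto
  have cross: "cross3 (A$i) (A$j) \<noteq> 0"
  proof
    assume "cross3 (A$i) (A$j) = 0"
    then have "(A$i \<bullet> x) * (A$j \<bullet> y) = (A$i \<bullet> y) * (A$j \<bullet> x)" for x y
      using dot_cross[of "A$i" "A$j" x y] by simp
    then have "A'$i$p * A'$j$q = A'$i$q * A'$j$p" for p q by (simp add: Am[symmetric])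
    then show False using ij(3) by (simp add: cross3_eq_0_minors)
  qed
  define \<beta> where "\<beta> q = (\<Sum>l\<in>UNIV. B'$l$q)" for q
  have \<beta>: "0 \<le> \<beta> q" for q unfolding \<beta>_def using B'0 by (simp add: sum_nonneg)
  define \<eta> where "\<eta> = \<delta> * (h \<bullet> w r)"
  have wr: "w r = v + \<eta> *\<^sub>R g" by (simp add: v_def m_def \<eta>_def)
  have B3: "B$l = B'$l$r *\<^sub>R (v + \<eta> *\<^sub>R g) + B'$l$s *\<^sub>R w s + B'$l$t *\<^sub>R w t" for l
    using B[of l] d by (simp add: UNIV_3_distinct[OF d] wr add.assoc)
  have g: "g = \<beta> r *\<^sub>R (v + \<eta> *\<^sub>R g) + \<beta> s *\<^sub>R w s + \<beta> t *\<^sub>R w t"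
  proof -
    have "g = (\<Sum>l\<in>UNIV. B'$l$r *\<^sub>R (v + \<eta> *\<^sub>R g) + B'$l$s *\<^sub>R w s + B'$l$t *\<^sub>R w t)"
      unfolding B3[symmetric] by (simp add: g_def)
    then show ?thesis by (simp add: \<beta>_def sum.distrib scaleR_left.sum)
  qed
  have \<eta>0: "0 \<le> \<eta>" using \<delta> hw[of r] by (simp add: \<eta>_def)
  \<comment> \<open>The three weights \<open>\<beta> q * (h \<bullet> w q)\<close> are nonnegative
    and sum to \<open>h \<bullet> g = 1\<close>. Multiplying the weight of \<open>w r\<close> by
    \<delta> < 1 brings it below 1, so the equation \<open>g\<close> can be solved for the vector g
    with nonnegative coefficients.\<close>
  have lt1: "\<beta> r * \<eta> < 1"
  proof -
    have "1 = \<beta> r * (h \<bullet> w r) + \<beta> s * (h \<bullet> w s) + \<beta> t * (h \<bullet> w t)"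
      using arg_cong[OF g, of "\<lambda>x. h \<bullet> x"] by (simp add: hg wr[symmetric] inner_add_right)
    moreover have "0 \<le> \<beta> q * (h \<bullet> w q)" for q using \<beta>[of q] hw[of q] by simp
    ultimately have "\<beta> r * (h \<bullet> w r) \<le> 1" by (metis add_increasing2 le_add_same_cancel1 add.assoc)
    then have "\<delta> * (\<beta> r * (h \<bullet> w r)) \<le> \<delta>" using \<delta> by (simp add: mult_left_le)
    then show ?thesis using \<delta> by (simp add: \<eta>_def mult_ac)
  qed
  define \<rho> where "\<rho> = 1 / (1 - \<beta> r * \<eta>)"
  have \<rho>: "0 \<le> \<rho>" and \<rho>1: "\<rho> * (1 - \<beta> r * \<eta>) = 1" using lt1 by (simp_all add: \<rho>_def)
  have "(1 - \<beta> r * \<eta>) *\<^sub>R g = \<beta> r *\<^sub>R v + \<beta> s *\<^sub>R w s + \<beta> t *\<^sub>R w t"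
    using g by (simp add: algebra_simps)
  then have g': "g = \<rho> *\<^sub>R (\<beta> r *\<^sub>R v + \<beta> s *\<^sub>R w s + \<beta> t *\<^sub>R w t)"
    by (metis \<rho>1 scaleR_one scaleR_scaleR)
  have cone: "\<exists>x y z. 0 \<le> x \<and> 0 \<le> y \<and> 0 \<le> z \<and> B$l = x *\<^sub>R v + y *\<^sub>R w s + z *\<^sub>R w t" for l
  proof -
    have "B$l = (B'$l$r + B'$l$r * \<eta> * \<rho> * \<beta> r) *\<^sub>R v + (B'$l$s + B'$l$r * \<eta> * \<rho> * \<beta> s) *\<^sub>R w s
        + (B'$l$t + B'$l$r * \<eta> * \<rho> * \<beta> t) *\<^sub>R w t"
      by (subst B3, subst g') (simp add: algebra_simps)
    moreover have "0 \<le> B'$l$q + B'$l$r * \<eta> * \<rho> * \<beta> q" for q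
      using B'0 \<eta>0 \<rho> \<beta> by (intro add_nonneg_nonneg mult_nonneg_nonneg) auto
    ultimately show ?thesis by blast
  qed
  have Av: "A$k \<bullet> v = A'$k$r" for k by (simp add: v_def Am)
  have "corner_triangle A B i j v (w s) (w t)"
    unfolding corner_triangle_def using cross v0 cone ij A'0 Aw0 by (auto simp: Av)
  moreover have "0 < A$k \<bullet> w q" if "0 < \<delta>" "\<And>k l. 0 < P$k$l" for k q
  proof -
    have "0 < A$k \<bullet> g" unfolding r[symmetric] by (rule sum_pos) (use that in auto)
    then show ?thesis unfolding Aw using hw[of q] that A'0 by (intro add_nonneg_pos mult_pos_pos) auto
  qed
  ultimately show ?thesis using that by blast
qed

section \<open>Determinants of a quadruple\<close>

lemma det3_inner: "det3 x y z = z \<bullet> cross3 x y"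
  by (simp add: det3_expand inner_real3 cross3_nth algebra_simps)

lemma inner_cross3_swap: "x \<bullet> cross3 y z = - (z \<bullet> cross3 y x)"
  by (simp add: inner_real3 cross3_nth algebra_simps)

lemma det3_scale: "det3 (c *\<^sub>R x) y z = c * det3 x y z" "det3 x (c *\<^sub>R y) z = c * det3 x y z"
  "det3 x y (c *\<^sub>R z) = c * det3 x y z"
  by (simp_all add: det3_expand algebra_simps)

lemma det3_add: "det3 (x + x') y z = det3 x y z + det3 x' y z"
  "det3 x (y + y') z = det3 x y z + det3 x y' z" "det3 x y (z + z') = det3 x y z + det3 x y z'"
  by (simp_all add: det3_expand algebra_simps)

lemma det3_eq_args [simp]: "det3 x x z = 0" "det3 x z x = 0" "det3 z x x = 0"
  by (simp_all add: det3_expand algebra_simps)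

lemma det3_swap: "det3 y x z = - det3 x y z" "det3 x z y = - det3 x y z"
  by (simp_all add: det3_expand algebra_simps)

lemma det3_cramer:
  "det3 v f g *\<^sub>R b = det3 f g b *\<^sub>R v - det3 v g b *\<^sub>R f + det3 v f b *\<^sub>R g"
  by (simp add: det3_expand vec3_eq_iff algebra_simps)

lemma det3_cramer_inner:
  "det3 v f g * (p \<bullet> b) = det3 f g b * (p \<bullet> v) - det3 v g b * (p \<bullet> f) + det3 v f b * (p \<bullet> g)"
  using arg_cong[OF det3_cramer[of v f g b], of "\<lambda>x. p \<bullet> x"] by (simp add: inner_diff_right inner_add_right)

text \<open>The inner cross products are the points where the line through \<open>v\<close> and
  \<open>f\<close> meets \<open>p\<close> and where the line through \<open>v\<close> and
  \<open>g\<close> meets \<open>q\<close>. The determinant locates \<open>b\<close> relative to the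
  third side, which joins them.\<close>

definition side_det :: "real^3 \<Rightarrow> real^3 \<Rightarrow> real^3 \<Rightarrow> real^3 \<Rightarrow> real^3 \<Rightarrow> real^3 \<Rightarrow> real" where
  "side_det v f g p q b = det3 (cross3 (cross3 v f) p) (cross3 (cross3 v g) q) b"

lemma cross3_cross3_left: "cross3 (cross3 x y) z = (x \<bullet> z) *\<^sub>R y - (y \<bullet> z) *\<^sub>R x"
  by (simp add: vec3_eq_iff cross3_nth inner_real3 algebra_simps)

lemma side_det_expand:
  "side_det v f g p q b = (p \<bullet> v) * (q \<bullet> v) * det3 f g b
     + (p \<bullet> v) * (q \<bullet> g) * det3 v f b - (q \<bullet> v) * (p \<bullet> f) * det3 v g b"
proof -
  have "det3 (\<alpha> *\<^sub>R f - \<beta> *\<^sub>R v) (\<alpha>' *\<^sub>R g - \<gamma> *\<^sub>R v) b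
      = \<alpha> * \<alpha>' * det3 f g b + \<alpha> * \<gamma> * det3 v f b - \<alpha>' * \<beta> * det3 v g b" for \<alpha> \<alpha>' \<beta> \<gamma>
    by (simp add: det3_expand algebra_simps)
  from this[of "p \<bullet> v" "p \<bullet> f" "q \<bullet> v" "q \<bullet> g"] show ?thesis
    by (simp add: side_det_def cross3_cross3_left inner_commute[of _ p] inner_commute[of _ q])
qed

lemma side_det_scale: "side_det (c *\<^sub>R v) f g p q b = c\<^sup>2 * side_det v f g p q b"
  by (simp add: side_det_expand det3_scale power2_eq_square algebra_simps)

text \<open>For equal lines the third side is the line \<open>p\<close> itself.\<close>

lemma side_det_same: "side_det v f g p p b = (p \<bullet> v) * det3 v f g * (p \<bullet> b)"
proof -
  have "(p \<bullet> v) * (det3 v f g * (p \<bullet> b)) = side_det v f g p p b"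
    unfolding det3_cramer_inner[of v f g p b] side_det_expand by (simp add: algebra_simps)
  then show ?thesis by simp
qed

text \<open>The two values whose product enters the definition of a valid quadruple have a sum of known
  sign, hence their product is nonnegative only if both of them have that sign.\<close>

lemma side_det_sum:
  "side_det v f g p q b + side_det v f g q p b
     = det3 v f g * ((q \<bullet> v) * (p \<bullet> b) + (p \<bullet> v) * (q \<bullet> b))"
proof -
  have "det3 v f g * ((q \<bullet> v) * (p \<bullet> b) + (p \<bullet> v) * (q \<bullet> b))
      = (q \<bullet> v) * (det3 v f g * (p \<bullet> b)) + (p \<bullet> v) * (det3 v f g * (q \<bullet> b))"
    by (simp add: algebra_simps)
  then show ?thesis
    unfolding det3_cramer_inner[of v f g p b] det3_cramer_inner[of v f g q b] side_det_expand
    by (simp add: algebra_simps)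
qed

lemma det3_coordinates:
  "det3 (x1 *\<^sub>R v + y1 *\<^sub>R c + z1 *\<^sub>R d) (x2 *\<^sub>R v + y2 *\<^sub>R c + z2 *\<^sub>R d)
     (x3 *\<^sub>R v + y3 *\<^sub>R c + z3 *\<^sub>R d)
   = det3 v c d * (x1 * (y2 * z3 - z2 * y3) - x2 * (y1 * z3 - z1 * y3) + x3 * (y1 * z2 - z1 * y2))"
proof -
  have "det3 v d c = - det3 v c d" "det3 c v d = - det3 v c d" "det3 c d v = det3 v c d"
    "det3 d v c = det3 v c d" "det3 d c v = - det3 v c d"
    by (simp_all add: det3_expand)
  then show ?thesis by (simp add: det3_add det3_scale algebra_simps)
qed

lemma det3_combination:
  assumes "f = x1 *\<^sub>R v + y1 *\<^sub>R c + z1 *\<^sub>R d" "g = x2 *\<^sub>R v + y2 *\<^sub>R c + z2 *\<^sub>R d"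
  shows "det3 v f g = det3 v c d * (y1 * z2 - z1 * y2)"
  using det3_coordinates[of 1 v 0 c 0 d x1 y1 z1 x2 y2 z2] by (simp add: assms)

text \<open>The determinant of \<open>f\<close>, \<open>g\<close>, \<open>b\<close> has no evident
  sign. Eliminating it leaves three terms whose signs are known when the points lie in the cone of
  \<open>v\<close>, \<open>c\<close>, \<open>d\<close> and between the two tangents from
  \<open>v\<close>.\<close>

lemma side_det_combination:
  assumes "f = x1 *\<^sub>R v + y1 *\<^sub>R c + z1 *\<^sub>R d" "g = x2 *\<^sub>R v + y2 *\<^sub>R c + z2 *\<^sub>R d"
    "b = x *\<^sub>R v + y *\<^sub>R c + z *\<^sub>R d"
  shows "side_det v f g p q b = (p \<bullet> v) * (q \<bullet> v) * x * det3 v f g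
    + (p \<bullet> v) * (y2 * (q \<bullet> c) + z2 * (q \<bullet> d)) * det3 v f b
    - (q \<bullet> v) * (y1 * (p \<bullet> c) + z1 * (p \<bullet> d)) * det3 v g b"
proof -
  have 1: "det3 f g b = x * det3 v f g - x2 * det3 v f b + x1 * det3 v g b"
  proof -
    have "det3 f g b = det3 v c d * (x * (y1 * z2 - z1 * y2) - x2 * (y1 * z - z1 * y) + x1 * (y2 * z - z2 * y))"
      unfolding assms det3_coordinates by (simp add: algebra_simps)
    then show ?thesis
      unfolding det3_combination[OF assms(1,2)] det3_combination[OF assms(1,3)] det3_combination[OF assms(2,3)]
      by (simp add: algebra_simps)
  qed
  have 2: "q \<bullet> g = x2 * (q \<bullet> v) + y2 * (q \<bullet> c) + z2 * (q \<bullet> d)" for q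
    by (simp add: assms inner_add_right)
  have 3: "p \<bullet> f = x1 * (p \<bullet> v) + y1 * (p \<bullet> c) + z1 * (p \<bullet> d)" for p
    by (simp add: assms inner_add_right)
  show ?thesis unfolding side_det_expand 1 2[of q] 3[of p] by (simp add: algebra_simps)
qed

lemma cross3_eq_0_imp_scale:
  fixes x y :: "real^3"
  assumes "cross3 x y = 0" "y \<noteq> 0"
  shows "x = ((x \<bullet> y) / (y \<bullet> y)) *\<^sub>R y"
proof -
  have "(y \<bullet> y) *\<^sub>R x = (x \<bullet> y) *\<^sub>R y"
    using assms(1) by (simp add: vec3_eq_iff cross3_nth inner_real3) algebra
  then have "(1 / (y \<bullet> y)) *\<^sub>R (y \<bullet> y) *\<^sub>R x = ((x \<bullet> y) / (y \<bullet> y)) *\<^sub>R y" by simp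
  then show ?thesis using assms(2) by simp
qed

section \<open>From corner triangles to valid quadruples\<close>

lemma row_eq: "row k A = A$k" by (simp add: row_def vec_eq_iff)
lemma column_eq: "column l B = transpose B $ l" by (simp add: column_def transpose_def vec_eq_iff)

lemma quadruple_F_eq: "F A B i j i' j' k l k' =
    side_det (vtx A i j) (transpose B $ i') (transpose B $ j') (A$k) (A$l) (transpose B $ k')"
  by (simp add: F_def side_det_def row_eq column_eq)

lemma quadruple_det_eq: "det3 (row i A) (row j A) (row k A) = A$k \<bullet> vtx A i j"
  by (simp add: det3_inner vtx_def row_eq)

lemma same_sign_or_zero_scale:
  assumes "same_sign_or_zero S f" shows "same_sign_or_zero S (\<lambda>k. c * f k)"
  using assms unfolding same_sign_or_zero_def
  by (cases "0 \<le> c") (auto simp: mult_nonneg_nonneg mult_nonneg_nonpos mult_nonpos_nonneg mult_nonpos_nonpos)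

text \<open>The points span the space and are combinations of \<open>v\<close>, \<open>c\<close>,
  \<open>d\<close>, so a vector orthogonal to these three is zero. If the determinant vanished, this
  would kill the cross products with \<open>v\<close> one after another.\<close>

lemma det3_nonzero_if_cone:
  assumes nd: "\<And>x. (\<And>l. B$l \<bullet> x = 0) \<Longrightarrow> x = 0" and v0: "v \<noteq> 0"
    and cone: "\<And>l. \<exists>x y z. B$l = x *\<^sub>R v + y *\<^sub>R c + z *\<^sub>R d"
  shows "det3 v c d \<noteq> 0"
proof
  assume 0: "det3 v c d = 0"
  have perp: "x = 0" if "v \<bullet> x = 0" "c \<bullet> x = 0" "d \<bullet> x = 0" for x
  proof (rule nd)
    fix l
    obtain p q r where "B$l = p *\<^sub>R v + q *\<^sub>R c + r *\<^sub>R d" using cone[of l] by blast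
    then show "B$l \<bullet> x = 0" by (simp add: inner_add_left that)
  qed
  have vc: "cross3 v c = 0"
    using 0 by (intro perp) (simp_all add: det3_inner dot_cross_self)
  have vd: "cross3 v d = 0"
    using 0 by (intro perp) (simp_all add: det3_inner dot_cross_self inner_cross3_swap[of c v d])
  have "cross3 v x = 0" for x
    by (intro perp) (simp_all add: dot_cross_self inner_cross3_swap[of c v x] inner_cross3_swap[of d v x] vc vd)
  then have "cross3 v (axis i 1) = 0" for i by blast
  from this[of 1] this[of 2] have "v = 0" by (simp add: vec3_eq_iff cross3_nth axis_def)
  then show False using v0 by blast
qed

text \<open>The tangents from \<open>v\<close> go through the points seen from \<open>v\<close> in
  the two extreme directions; these points give \<open>i'\<close> and \<open>j'\<close>. All values
  of \<open>F\<close> are then sums of nonnegative terms, and the terms with \<open>c\<close> and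
  \<open>d\<close> are responsible for strict positivity when both are strictly inside.\<close>

lemma valid_quadruple_if_corner_triangle_oriented:
  fixes A :: "real^3^'m" and B :: "real^'n^3"
  assumes rank: "rank (A ** B) = 3"
    and ct: "corner_triangle A (transpose B) i j v c d" and \<Delta>: "0 < det3 v c d"
  obtains i' j' where "valid_quadruple A B i j i' j'"
    "(\<And>k l. 0 < (A ** B)$k$l) \<Longrightarrow> (\<And>k. 0 < A$k \<bullet> c \<and> 0 < A$k \<bullet> d) \<Longrightarrow> \<not> has_vanishing_product A B i j i' j'"
proof -
  let ?b = "\<lambda>l. transpose B $ l" and ?V = "vtx A i j"
  have AB: "A$k \<bullet> ?b l = (A ** B)$k$l" for k l
    by (simp add: transpose_def matrix_matrix_mult_def inner_vec_def)
  note nd = factor_nondegenerate(2)[OF rank AB]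
  have cr: "cross3 (A$i) (A$j) \<noteq> 0" "v \<noteq> 0" "A$i \<bullet> v = 0" "A$j \<bullet> v = 0"
    and A0: "0 \<le> A$k \<bullet> v" "0 \<le> A$k \<bullet> c" "0 \<le> A$k \<bullet> d" for k
    using ct by (auto simp: corner_triangle_def)
  have "\<forall>l. \<exists>x y z. 0 \<le> x \<and> 0 \<le> y \<and> 0 \<le> z \<and> ?b l = x *\<^sub>R v + y *\<^sub>R c + z *\<^sub>R d"
    using ct by (auto simp: corner_triangle_def)
  then obtain x y z where xyz: "\<And>l. 0 \<le> x l \<and> 0 \<le> y l \<and> 0 \<le> z l"
    and b: "\<And>l. ?b l = x l *\<^sub>R v + y l *\<^sub>R c + z l *\<^sub>R d" by metis
  have det: "det3 v (?b l) (?b l') = det3 v c d * (y l * z l' - z l * y l')" for l l'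
    by (rule det3_combination[OF b b])
  \<comment> \<open>Multiples of \<open>v\<close> have no direction as seen from \<open>v\<close>
    and cannot serve as tangent points.\<close>
  define S where "S = {l. y l + z l \<noteq> 0}"
  have "S \<noteq> {}"
  proof
    assume "S = {}"
    then have "y l + z l = 0" for l by (auto simp: S_def)
    then have "y l = 0 \<and> z l = 0" for l using xyz[of l] by (smt (verit))
    then have "?b l \<bullet> cross3 v c = 0" for l by (simp add: b dot_cross_self)
    then have "cross3 v c = 0" by (rule nd)
    then show False using \<Delta> by (simp add: det3_inner)
  qed
  \<comment> \<open>The direction is measured by \<open>z / (y + z)\<close> because either
    coordinate alone may vanish.\<close>
  let ?\<rho> = "\<lambda>l. z l / (y l + z l)"
  obtain i' where i': "i' \<in> S" and mini: "\<And>l. l \<in> S \<Longrightarrow> ?\<rho> i' \<le> ?\<rho> l"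
    using finite_ex_min[of S ?\<rho>] \<open>S \<noteq> {}\<close> by auto
  obtain j' where j': "j' \<in> S" and maxj: "\<And>l. l \<in> S \<Longrightarrow> - ?\<rho> j' \<le> - ?\<rho> l"
    using finite_ex_min[of S "\<lambda>l. - ?\<rho> l"] \<open>S \<noteq> {}\<close> by auto
  have Spos: "0 < y l + z l" if "l \<in> S" for l using that xyz[of l] by (auto simp: S_def less_le)
  have cmp: "y l * z l' - z l * y l' = (y l + z l) * (y l' + z l') * (?\<rho> l' - ?\<rho> l)"
    if "l \<in> S" "l' \<in> S" for l l'
  proof -
    have *: "z q = ?\<rho> q * (y q + z q)" "y q = (y q + z q) - ?\<rho> q * (y q + z q)" if "q \<in> S" for q
      using Spos[OF that] by simp_all
    have "(s - \<rho>1 * s) * (\<rho>2 * t) - (\<rho>1 * s) * (t - \<rho>2 * t) = s * t * (\<rho>2 - \<rho>1)" for s t \<rho>1 \<rho>2 :: real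
      by (simp add: algebra_simps)
    from this[of "y l + z l" "?\<rho> l" "?\<rho> l'" "y l' + z l'"] show ?thesis
      unfolding *[OF that(1), symmetric] *[OF that(2), symmetric] by simp
  qed
  have notS: "y l = 0 \<and> z l = 0" if "l \<notin> S" for l using that xyz[of l] by (auto simp: S_def)
  have E: "0 \<le> det3 v (?b i') (?b l)" for l
  proof (cases "l \<in> S")
    case True
    show ?thesis unfolding det cmp[OF i' True]
      using \<Delta> Spos[OF i'] Spos[OF True] mini[OF True] by simp
  qed (simp add: det notS)
  have G: "det3 v (?b j') (?b l) \<le> 0" for l
  proof (cases "l \<in> S")
    case True
    have "0 \<le> det3 v c d * ((y j' + z j') * (y l + z l) * (?\<rho> j' - ?\<rho> l))"
      using \<Delta> Spos[OF j'] Spos[OF True] maxj[OF True] by simp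
    then show ?thesis unfolding det cmp[OF j' True] by (simp add: algebra_simps)
  qed (simp add: det notS)
  \<comment> \<open>If both extreme directions coincided, all points would lie on one line through
    \<open>v\<close>, against rank 3.\<close>
  have \<delta>: "0 < det3 v (?b i') (?b j')"
  proof (rule ccontr)
    assume "\<not> ?thesis"
    then have "det3 v (?b i') (?b j') = 0" using E[of j'] by simp
    then have "?\<rho> i' = ?\<rho> j'" unfolding det cmp[OF i' j'] using \<Delta> Spos[OF i'] Spos[OF j'] by simp
    then have "det3 v (?b i') (?b l) = 0" for l
    proof (cases "l \<in> S")
      case True
      then have "?\<rho> l = ?\<rho> i'" using mini[OF True] maxj[OF True] \<open>?\<rho> i' = ?\<rho> j'\<close> by simp
      then show ?thesis unfolding det cmp[OF i' True] by simp
    qed (simp add: det notS)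
    then have "?b l \<bullet> cross3 v (?b i') = 0" for l by (simp add: det3_inner)
    then have 0: "cross3 v (?b i') = 0" by (rule nd)
    have "det3 v (?b i') d = 0" "det3 v (?b i') c = 0" by (simp_all add: det3_inner 0)
    then have "det3 v c d * y i' = 0" "det3 v c d * z i' = 0"
      using det3_combination[OF b[of i'], of d 0 0 1] det3_combination[OF b[of i'], of c 0 1 0]
      by simp_all
    then show False using \<Delta> Spos[OF i'] by simp
  qed
  have V: "cross3 ?V v = 0" by (simp add: vtx_def row_eq cross3_cross3_left cr)
  define \<kappa> where "\<kappa> = (?V \<bullet> v) / (v \<bullet> v)"
  have V\<kappa>: "?V = \<kappa> *\<^sub>R v" unfolding \<kappa>_def by (rule cross3_eq_0_imp_scale[OF V cr(2)])
  have "?V \<noteq> 0" using cr(1) by (simp add: vtx_def row_eq)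
  then have \<kappa>0: "\<kappa> \<noteq> 0" using V\<kappa> by auto
  have Fnn: "F A B i j i' j' k l k' = \<kappa>\<^sup>2 * ((A$k \<bullet> v) * (A$l \<bullet> v) * x k' * det3 v (?b i') (?b j')
    + (A$k \<bullet> v) * (y j' * (A$l \<bullet> c) + z j' * (A$l \<bullet> d)) * det3 v (?b i') (?b k')
    + (A$l \<bullet> v) * (y i' * (A$k \<bullet> c) + z i' * (A$k \<bullet> d)) * - det3 v (?b j') (?b k'))" for k l k'
    unfolding quadruple_F_eq V\<kappa> side_det_scale side_det_combination[OF b[of i'] b[of j'] b[of k']] by simp
  have F0: "0 \<le> F A B i j i' j' k l k'" for k l k'
    unfolding Fnn using A0 xyz E G \<delta>
    by (intro mult_nonneg_nonneg add_nonneg_nonneg) (auto simp: less_imp_le)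
  show ?thesis
  proof (rule that[of i' j'])
    have dV: "det3 ?V (?b i') (?b j') \<noteq> 0" using \<delta> \<kappa>0 by (simp add: V\<kappa> det3_scale)
    have "cross3 ?V (?b i') \<noteq> 0" using dV by (auto simp: det3_inner)
    moreover have "cross3 ?V (?b j') \<noteq> 0" using dV det3_swap(2)[of ?V "?b i'" "?b j'"] by (auto simp: det3_inner)
    moreover have "same_sign_or_zero (UNIV - {i, j}) (\<lambda>k. \<kappa> * (A$k \<bullet> v))"
      by (rule same_sign_or_zero_scale) (simp add: same_sign_or_zero_def A0)
    moreover have "same_sign_or_zero (UNIV - {i'}) (\<lambda>k'. \<kappa> * det3 v (?b i') (?b k'))"
      by (rule same_sign_or_zero_scale) (simp add: same_sign_or_zero_def E)
    moreover have "same_sign_or_zero (UNIV - {j'}) (\<lambda>k'. \<kappa> * det3 v (?b j') (?b k'))"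
      by (rule same_sign_or_zero_scale) (simp add: same_sign_or_zero_def G)
    ultimately show "valid_quadruple A B i j i' j'"
      unfolding valid_quadruple_def quadruple_det_eq column_eq
      using F0 by (auto simp: V\<kappa> det3_scale intro!: mult_nonneg_nonneg)
    show "\<not> has_vanishing_product A B i j i' j'"
      if pos: "\<And>k l. 0 < (A ** B)$k$l" and str: "\<And>k. 0 < A$k \<bullet> c \<and> 0 < A$k \<bullet> d"
    proof
      assume "has_vanishing_product A B i j i' j'"
      then obtain k l k' where kl: "A$k \<bullet> v \<noteq> 0" "A$l \<bullet> v \<noteq> 0"
        and 0: "F A B i j i' j' k l k' * F A B i j i' j' l k k' = 0"
        unfolding has_vanishing_product_def quadruple_det_eq by (auto simp: V\<kappa>)
      have kl': "0 < A$k \<bullet> v" "0 < A$l \<bullet> v" using kl A0 by (simp_all add: less_le)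
      have yz: "0 < y q * (A$p \<bullet> c) + z q * (A$p \<bullet> d)" if "q \<in> S" for p q
      proof -
        have "0 \<le> y q * (A$p \<bullet> c)" "0 \<le> z q * (A$p \<bullet> d)" using xyz A0 by simp_all
        moreover have "y q * (A$p \<bullet> c) \<noteq> 0 \<or> z q * (A$p \<bullet> d) \<noteq> 0"
          using that str[of p] by (auto simp: S_def)
        ultimately show ?thesis by linarith
      qed
      \<comment> \<open>A point on both tangents is a multiple of \<open>v\<close>, hence lies on
        line \<open>i\<close>, against the positivity of the product.\<close>
      have EG: "det3 v (?b i') (?b k') \<noteq> 0 \<or> det3 v (?b j') (?b k') \<noteq> 0"
      proof (rule ccontr)
        assume "\<not> ?thesis"
        then have "det3 v (?b i') (?b j') * (A$i \<bullet> ?b k') = 0"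
          using det3_cramer_inner[of v "?b i'" "?b j'" "A$i" "?b k'"] by (simp add: cr)
        then show False using \<delta> pos[of i k'] by (simp add: AB)
      qed
      have Fpos: "0 < F A B i j i' j' p q k'" if pq: "0 < A$p \<bullet> v" "0 < A$q \<bullet> v" for p q
      proof -
        have "0 \<le> (A$p \<bullet> v) * (A$q \<bullet> v) * x k' * det3 v (?b i') (?b j')"
          using pq xyz[of k'] \<delta> by simp
        moreover have "0 < (A$p \<bullet> v) * (y j' * (A$q \<bullet> c) + z j' * (A$q \<bullet> d))" (is "0 < ?M")
          using pq yz[OF j'] by simp
        moreover have "0 < (A$q \<bullet> v) * (y i' * (A$p \<bullet> c) + z i' * (A$p \<bullet> d))" (is "0 < ?N")
          using pq yz[OF i'] by simp
        moreover have "0 < ?M * det3 v (?b i') (?b k') + ?N * - det3 v (?b j') (?b k')"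
          if "0 < ?M" "0 < ?N"
        proof -
          have "0 \<le> ?M * det3 v (?b i') (?b k')" "0 \<le> ?N * - det3 v (?b j') (?b k')"
            using that E[of k'] G[of k'] by (simp_all add: mult_nonneg_nonpos)
          moreover have "?M * det3 v (?b i') (?b k') \<noteq> 0 \<or> ?N * - det3 v (?b j') (?b k') \<noteq> 0"
            using that EG by (metis less_irrefl mult_eq_0_iff neg_equal_0_iff_equal)
          ultimately show ?thesis by linarith
        qed
        ultimately show ?thesis unfolding Fnn using \<kappa>0 by (intro mult_pos_pos) (auto simp: add.assoc intro: add_nonneg_pos)
      qed
      show False using 0 Fpos[OF kl'] Fpos[OF kl'(2,1)] by simp
    qed
  qed
qed

lemma valid_quadruple_if_corner_triangle:
  fixes A :: "real^3^'m" and B :: "real^'n^3"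
  assumes rank: "rank (A ** B) = 3" and ct: "corner_triangle A (transpose B) i j v c d"
  obtains i' j' where "valid_quadruple A B i j i' j'"
    "(\<And>k l. 0 < (A ** B)$k$l) \<Longrightarrow> (\<And>k. 0 < A$k \<bullet> c \<and> 0 < A$k \<bullet> d) \<Longrightarrow> \<not> has_vanishing_product A B i j i' j'"
proof -
  have AB: "A$k \<bullet> transpose B $ l = (A ** B)$k$l" for k l
    by (simp add: transpose_def matrix_matrix_mult_def inner_vec_def)
  have "v \<noteq> 0" and "\<exists>x y z. transpose B $ l = x *\<^sub>R v + y *\<^sub>R c + z *\<^sub>R d" for l
    using ct unfolding corner_triangle_def by blast+
  moreover have "x = 0" if "\<And>l. transpose B $ l \<bullet> x = 0" for x
    using factor_nondegenerate(2)[OF rank AB that] .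
  ultimately have "det3 v c d \<noteq> 0" using det3_nonzero_if_cone[of "transpose B" v c d] by blast
  then consider "0 < det3 v c d" | "0 < det3 v d c" using det3_swap(2)[of v d c] by linarith
  then show ?thesis
  proof cases
    case 1
    from valid_quadruple_if_corner_triangle_oriented[OF rank ct 1] that show ?thesis by metis
  next
    case 2
    have "\<exists>x y z. 0 \<le> x \<and> 0 \<le> y \<and> 0 \<le> z \<and> transpose B $ l = x *\<^sub>R v + y *\<^sub>R d + z *\<^sub>R c" for l
    proof -
      obtain x y z where "0 \<le> x" "0 \<le> y" "0 \<le> z" "transpose B $ l = x *\<^sub>R v + y *\<^sub>R c + z *\<^sub>R d"
        using ct unfolding corner_triangle_def by metis
      then show ?thesis by (intro exI[of _ x] exI[of _ z] exI[of _ y]) (simp add: algebra_simps)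
    qed
    then have "corner_triangle A (transpose B) i j v d c"
      using ct by (auto simp: corner_triangle_def)
    from valid_quadruple_if_corner_triangle_oriented[OF rank this 2] that show ?thesis by metis
  qed
qed

section \<open>Factorizations from a vertex and two side lines\<close>

lemma nonneg_factor_vectorI:
  fixes P :: "real^'n^'m"
  assumes "\<And>k. 0 \<le> p k" "\<And>k. 0 \<le> q k" "\<And>k. 0 \<le> r k" "\<And>l. 0 \<le> x l" "\<And>l. 0 \<le> y l" "\<And>l. 0 \<le> z l"
    and "\<And>k l. p k * x l + q k * y l + r k * z l = P$k$l"
  shows "nonneg_factor P (\<chi> k. vector [p k, q k, r k]) (\<chi> l. vector [x l, y l, z l])"
  using assms by (simp add: nonneg_factor_def forall_3 inner_real3)

text \<open>The triangle has vertices \<open>v\<close>, \<open>f - t v\<close> and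
  \<open>g - s v\<close>, the last two on the given side lines. The second factor consists of the
  coordinates of the points in this basis, by Cramer's rule.\<close>

lemma nonneg_factor_from_side_lines:
  fixes P :: "real^'n^'m" and A :: "real^3^'m" and B :: "real^3^'n"
  assumes AB: "\<And>k l. A$k \<bullet> B$l = P$k$l"
    and Av: "\<And>k. 0 \<le> A$k \<bullet> v" and d: "det3 v f g \<noteq> 0"
    and E: "\<And>l. 0 \<le> det3 v f (B$l) / det3 v f g" and G: "\<And>l. det3 v g (B$l) / det3 v f g \<le> 0"
    and t: "\<And>k. t * (A$k \<bullet> v) \<le> A$k \<bullet> f" and s: "\<And>k. s * (A$k \<bullet> v) \<le> A$k \<bullet> g"
    and H: "\<And>l. 0 \<le> (det3 f g (B$l) + s * det3 v f (B$l) - t * det3 v g (B$l)) / det3 v f g"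
  shows "nonneg_factor P (\<chi> k. vector [A$k \<bullet> v, A$k \<bullet> f - t * (A$k \<bullet> v), A$k \<bullet> g - s * (A$k \<bullet> v)])
    (\<chi> l. vector [(det3 f g (B$l) + s * det3 v f (B$l) - t * det3 v g (B$l)) / det3 v f g,
       - (det3 v g (B$l) / det3 v f g), det3 v f (B$l) / det3 v f g])"
proof -
  have "(A$k \<bullet> v) * ((det3 f g (B$l) + s * det3 v f (B$l) - t * det3 v g (B$l)) / det3 v f g)
      + (A$k \<bullet> f - t * (A$k \<bullet> v)) * - (det3 v g (B$l) / det3 v f g)
      + (A$k \<bullet> g - s * (A$k \<bullet> v)) * (det3 v f (B$l) / det3 v f g) = P$k$l" for k l
  proof -
    have "\<alpha> * (x / d) + p * - (y / d) + q * (z / d) = (\<alpha> * x - p * y + q * z) / d" for \<alpha> p q x y z d :: real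
      by (simp add: add_divide_distrib diff_divide_distrib)
    moreover have "(A$k \<bullet> v) * (det3 f g (B$l) + s * det3 v f (B$l) - t * det3 v g (B$l))
      - (A$k \<bullet> f - t * (A$k \<bullet> v)) * det3 v g (B$l)
      + (A$k \<bullet> g - s * (A$k \<bullet> v)) * det3 v f (B$l) = det3 v f g * P$k$l"
      unfolding AB[symmetric] det3_cramer_inner[of v f g "A$k" "B$l"] by (simp add: algebra_simps)
    ultimately show ?thesis using d by simp
  qed
  then show ?thesis using Av E G t s H by (intro nonneg_factor_vectorI) auto
qed

text \<open>Conditions (i)-(iv) with all signs normalized by \<open>det3 v f g\<close>. The vectors
  \<open>f\<close> and \<open>g\<close> are arbitrary because the second tangent has to be exchanged
  in the degenerate case.\<close>

definition side_conditions :: "real^3^'m \<Rightarrow> real^3^'n \<Rightarrow> real^3 \<Rightarrow> real^3 \<Rightarrow> real^3 \<Rightarrow> bool" where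
  "side_conditions A B v f g \<longleftrightarrow> (\<forall>k. 0 \<le> A$k \<bullet> v) \<and> det3 v f g \<noteq> 0 \<and>
     (\<forall>l. 0 \<le> det3 v f (B$l) / det3 v f g) \<and> (\<forall>l. det3 v g (B$l) / det3 v f g \<le> 0) \<and>
     (\<forall>k l k'. 0 < A$k \<bullet> v \<longrightarrow> 0 < A$l \<bullet> v \<longrightarrow> 0 \<le> side_det v f g (A$k) (A$l) (B$k') / det3 v f g)"

text \<open>Line \<open>k\<close> is where \<open>f - t v\<close> first leaves the outer polygon as
  \<open>t\<close> grows.\<close>

lemma min_exit_parameter:
  fixes A :: "real^3^'m"
  assumes nd: "\<And>x. (\<And>k. A$k \<bullet> x = 0) \<Longrightarrow> x = 0" and v0: "v \<noteq> 0"
    and Av: "\<And>k. 0 \<le> A$k \<bullet> v" and Af: "\<And>k. 0 \<le> A$k \<bullet> f"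
  obtains k where "0 < A$k \<bullet> v" "\<And>l. (A$k \<bullet> f / (A$k \<bullet> v)) * (A$l \<bullet> v) \<le> A$l \<bullet> f"
proof -
  let ?K = "{k. A$k \<bullet> v \<noteq> 0}"
  have "?K \<noteq> {}" using nd[of v] v0 by auto
  then obtain k where k: "k \<in> ?K" and min: "\<And>l. l \<in> ?K \<Longrightarrow> A$k \<bullet> f / (A$k \<bullet> v) \<le> A$l \<bullet> f / (A$l \<bullet> v)"
    using finite_ex_min[of ?K "\<lambda>l. A$l \<bullet> f / (A$l \<bullet> v)"] by auto
  have "(A$k \<bullet> f / (A$k \<bullet> v)) * (A$l \<bullet> v) \<le> A$l \<bullet> f" for l
  proof (cases "A$l \<bullet> v = 0")
    case True
    then show ?thesis using Af[of l] by (simp del: times_divide_eq_left)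
  next
    case False
    then have "0 < A$l \<bullet> v" using Av[of l] by simp
    then show ?thesis using min[of l] False pos_le_divide_eq by fastforce
  qed
  moreover have "0 < A$k \<bullet> v" using k Av[of k] by simp
  ultimately show ?thesis using that by blast
qed

lemma side_det_exit:
  assumes "p \<bullet> v \<noteq> 0" "q \<bullet> v \<noteq> 0"
  shows "side_det v f g p q b = (p \<bullet> v) * (q \<bullet> v) *
    (det3 f g b + (q \<bullet> g / (q \<bullet> v)) * det3 v f b - (p \<bullet> f / (p \<bullet> v)) * det3 v g b)"
  using assms by (simp add: side_det_expand field_simps)

text \<open>Both sides are made as long as the outer polygon permits. They end on two lines off the
  vertex, and for exactly this pair the last side condition says, through
  \<open>side_det_exit\<close>, that the points do not lie beyond the third side.\<close>

lemma nonneg_rank_if_side_conditions: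
  fixes P :: "real^'n^'m" and A :: "real^3^'m" and B :: "real^3^'n"
  assumes rank: "rank P = 3" and AB: "\<And>k l. A$k \<bullet> B$l = P$k$l" and sc: "side_conditions A B v f g"
    and Af: "\<And>k. 0 \<le> A$k \<bullet> f" and Ag: "\<And>k. 0 \<le> A$k \<bullet> g"
  shows "nonneg_rank_le_3 P"
proof -
  note nd = factor_nondegenerate(1)[OF rank AB]
  have Av: "\<And>k. 0 \<le> A$k \<bullet> v" and d: "det3 v f g \<noteq> 0"
    and E: "\<And>l. 0 \<le> det3 v f (B$l) / det3 v f g" and G: "\<And>l. det3 v g (B$l) / det3 v f g \<le> 0"
    and H: "\<And>k l k'. 0 < A$k \<bullet> v \<Longrightarrow> 0 < A$l \<bullet> v \<Longrightarrow> 0 \<le> side_det v f g (A$k) (A$l) (B$k') / det3 v f g"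
    using sc by (auto simp: side_conditions_def)
  have v0: "v \<noteq> 0" using d by (auto simp: det3_expand)
  obtain k1 where k1: "0 < A$k1 \<bullet> v" and t: "\<And>l. (A$k1 \<bullet> f / (A$k1 \<bullet> v)) * (A$l \<bullet> v) \<le> A$l \<bullet> f"
    using min_exit_parameter[of A v f] nd v0 Av Af by blast
  obtain k2 where k2: "0 < A$k2 \<bullet> v" and s: "\<And>l. (A$k2 \<bullet> g / (A$k2 \<bullet> v)) * (A$l \<bullet> v) \<le> A$l \<bullet> g"
    using min_exit_parameter[of A v g] nd v0 Av Ag by blast
  have "0 \<le> (det3 f g (B$l) + (A$k2 \<bullet> g / (A$k2 \<bullet> v)) * det3 v f (B$l)
      - (A$k1 \<bullet> f / (A$k1 \<bullet> v)) * det3 v g (B$l)) / det3 v f g" (is "0 \<le> ?x / _") for l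
  proof -
    have "0 \<le> (A$k1 \<bullet> v) * (A$k2 \<bullet> v) * (?x / det3 v f g)"
      using H[OF k1 k2, of l] side_det_exit[of "A$k1" v "A$k2" f g "B$l"] k1 k2 by simp
    moreover have "0 \<le> y" if "0 < m" "0 \<le> m * y" for m y :: real
      using that by (simp add: zero_le_mult_iff)
    ultimately show ?thesis using mult_pos_pos[OF k1 k2] by blast
  qed
  from nonneg_factor_from_side_lines[OF AB Av d E G t s this] show ?thesis
    by (auto simp: nonneg_rank_le_3_iff)
qed

text \<open>Only vertex 1 may touch the outer boundary. Lengthening the opposite side a little at
  both ends takes the points off the other two sides; this leaves enough room to pull vertex 1
  inwards, towards that side.\<close>

lemma strictly_positive_factor:
  fixes P :: "real^'n^'m"
  assumes nf: "nonneg_factor P A B" and A: "\<And>k. 0 < A$k$2 \<and> 0 < A$k$3"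
    and B: "\<And>l. 0 < B$l$1 \<and> 0 < B$l$2 + B$l$3"
  obtains A' :: "real^3^'m" and B' :: "real^3^'n" where "\<And>k l. A'$k \<bullet> B'$l = P$k$l" "\<And>k i. 0 < A'$k$i" "\<And>l i. 0 < B'$l$i"
proof -
  have A0: "0 \<le> A$k$i" and B0: "0 \<le> B$l$i" and AB: "A$k \<bullet> B$l = P$k$l" for k l i
    using nf by (auto simp: nonneg_factor_def)
  have "\<forall>\<^sub>F \<eta> in at_right 0. 0 < A$k$2 - \<eta> * A$k$3 \<and> 0 < A$k$3 - \<eta> * A$k$2" for k
    by (intro eventually_conj eventually_pos_at_right_0) (use A in \<open>auto intro!: continuous_intros\<close>)
  then have e1: "\<forall>\<^sub>F \<eta> in at_right 0. \<forall>k. 0 < A$k$2 - \<eta> * A$k$3 \<and> 0 < A$k$3 - \<eta> * A$k$2"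
    by (rule eventually_all_finite)
  have e2: "\<forall>\<^sub>F \<eta> in at_right (0::real). \<eta> < 1"
    by (rule eventually_mono[OF eventually_at_right_real[of 0 1]]) auto
  obtain \<eta> :: real where \<eta>: "0 < \<eta>" "\<eta> < 1"
    and \<eta>A: "\<And>k. 0 < A$k$2 - \<eta> * A$k$3 \<and> 0 < A$k$3 - \<eta> * A$k$2"
    using eventually_happens'[OF _ eventually_conj[OF eventually_at_right_less[of 0] eventually_conj[OF e2 e1]]]
    by auto
  have \<eta>2: "0 < 1 - \<eta> * \<eta>" using \<eta> by (simp add: mult_less_cancel_left1 less_1_mult mult_strict_mono[of \<eta> 1 \<eta> 1, simplified])
  define p q where pq: "p k = A$k$2 - \<eta> * A$k$3" "q k = A$k$3 - \<eta> * A$k$2" for k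
  \<comment> \<open>The inverse of the 2x2 matrix with rows (1, -\<eta>) and (-\<eta>, 1), which
    lengthens the side.\<close>
  define y z where yz: "y l = (B$l$2 + \<eta> * B$l$3) / (1 - \<eta> * \<eta>)" "z l = (B$l$3 + \<eta> * B$l$2) / (1 - \<eta> * \<eta>)" for l
  have pq0: "0 < p k" "0 < q k" for k using \<eta>A by (auto simp: pq)
  have yz0: "0 < y l" "0 < z l" for l
  proof -
    have "B$l$2 \<noteq> 0 \<or> B$l$3 \<noteq> 0" using B[of l] by auto
    moreover have "0 < u + \<eta> * w" if "0 \<le> u" "0 \<le> w" "u \<noteq> 0 \<or> w \<noteq> 0" for u w :: real
      using that \<eta> by (cases "u = 0") (auto intro: add_pos_nonneg)
    ultimately have "0 < B$l$2 + \<eta> * B$l$3" "0 < B$l$3 + \<eta> * B$l$2"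
      using B0[of l 2] B0[of l 3] by blast+
    then show "0 < y l" "0 < z l" using \<eta>2 by (simp_all add: yz)
  qed
  have prod: "p k * y l + q k * z l = A$k$2 * B$l$2 + A$k$3 * B$l$3" for k l
  proof -
    have "p k * y l + q k * z l = (p k * (B$l$2 + \<eta> * B$l$3) + q k * (B$l$3 + \<eta> * B$l$2)) / (1 - \<eta> * \<eta>)"
      by (simp add: yz add_divide_distrib distrib_left)
    also have "p k * (B$l$2 + \<eta> * B$l$3) + q k * (B$l$3 + \<eta> * B$l$2)
        = (A$k$2 * B$l$2 + A$k$3 * B$l$3) * (1 - \<eta> * \<eta>)" by (simp add: pq algebra_simps)
    finally show ?thesis using \<eta>2 by simp
  qed
  have "\<forall>\<^sub>F \<epsilon> in at_right 0. 0 < y l - \<epsilon> * B$l$1 \<and> 0 < z l - \<epsilon> * B$l$1" for l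
    by (intro eventually_conj eventually_pos_at_right_0) (use yz0 in \<open>auto intro!: continuous_intros\<close>)
  then have ev: "\<forall>\<^sub>F \<epsilon> in at_right 0. \<forall>l. 0 < y l - \<epsilon> * B$l$1 \<and> 0 < z l - \<epsilon> * B$l$1"
    by (rule eventually_all_finite)
  obtain \<epsilon> :: real where \<epsilon>: "0 < \<epsilon>" and \<epsilon>B: "\<And>l. 0 < y l - \<epsilon> * B$l$1 \<and> 0 < z l - \<epsilon> * B$l$1"
    using eventually_happens'[OF trivial_limit_at_right_real eventually_conj[OF eventually_at_right_less[of 0] ev]] by blast
  define A' :: "real^3^'m" where "A' = (\<chi> k. vector [A$k$1 + \<epsilon> * (p k + q k), p k, q k])"
  define B' :: "real^3^'n" where "B' = (\<chi> l. vector [B$l$1, y l - \<epsilon> * B$l$1, z l - \<epsilon> * B$l$1])"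
  show ?thesis
  proof (rule that[of A' B'])
    show "A'$k \<bullet> B'$l = P$k$l" for k l
    proof -
      have "A'$k \<bullet> B'$l = A$k$1 * B$l$1 + (p k * y l + q k * z l)"
        by (simp add: A'_def B'_def inner_real3 algebra_simps)
      also have "\<dots> = A$k \<bullet> B$l" by (simp add: prod inner_real3)
      finally show ?thesis using AB by simp
    qed
    have "0 < A$k$1 + \<epsilon> * (p k + q k)" for k
      using A0[of k 1] pq0[of k] \<epsilon> by (intro add_nonneg_pos mult_pos_pos add_pos_pos)
    then have "\<forall>i. 0 < A'$k$i" for k using pq0[of k] by (simp add: A'_def forall_3)
    then show "0 < A'$k$i" for k i by blast
    have "\<forall>i. 0 < B'$l$i" for l using B[of l] \<epsilon>B[of l] by (simp add: B'_def forall_3)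
    then show "0 < B'$l$i" for l i by blast
  qed
qed

text \<open>At the exit parameters \<open>H\<close> keeps all points strictly off the third side;
  the two tangent points have the coordinates \<open>t0\<close> and \<open>s0\<close>, which are
  positive with \<open>P\<close>. So both sides can be shortened a little, and their ends move into
  the interior of the outer polygon.\<close>

lemma positive_factor_if_side_conditions:
  fixes P :: "real^'n^'m" and A :: "real^3^'m" and B :: "real^3^'n"
  assumes rank: "rank P = 3" and AB: "\<And>k l. A$k \<bullet> B$l = P$k$l" and sc: "side_conditions A B v (B$i') (B$j')"
    and P: "\<And>k l. 0 < P$k$l" and Ai: "A$i \<bullet> v = 0"
    and H: "\<And>k l k'. 0 < A$k \<bullet> v \<Longrightarrow> 0 < A$l \<bullet> v \<Longrightarrow> k' \<noteq> i' \<Longrightarrow> k' \<noteq> j' \<Longrightarrow>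
      side_det v (B$i') (B$j') (A$k) (A$l) (B$k') \<noteq> 0"
  obtains A' :: "real^3^'m" and B' :: "real^3^'n" where "\<And>k l. A'$k \<bullet> B'$l = P$k$l" "\<And>k i. 0 < A'$k$i" "\<And>l i. 0 < B'$l$i"
proof -
  let ?f = "B$i'" and ?g = "B$j'"
  let ?d = "det3 v ?f ?g"
  note nd = factor_nondegenerate(1)[OF rank AB]
  have Av: "\<And>k. 0 \<le> A$k \<bullet> v" and d: "?d \<noteq> 0"
    and E: "\<And>l. 0 \<le> det3 v ?f (B$l) / ?d" and G: "\<And>l. det3 v ?g (B$l) / ?d \<le> 0"
    and H0: "\<And>k l k'. 0 < A$k \<bullet> v \<Longrightarrow> 0 < A$l \<bullet> v \<Longrightarrow> 0 \<le> side_det v ?f ?g (A$k) (A$l) (B$k') / ?d"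
    using sc by (auto simp: side_conditions_def)
  have v0: "v \<noteq> 0" using d by (auto simp: det3_expand)
  have Af: "0 \<le> A$k \<bullet> ?f" and Ag: "0 \<le> A$k \<bullet> ?g" for k using P by (simp_all add: AB less_imp_le)
  obtain k1 where k1: "0 < A$k1 \<bullet> v" and t: "\<And>l. (A$k1 \<bullet> ?f / (A$k1 \<bullet> v)) * (A$l \<bullet> v) \<le> A$l \<bullet> ?f"
    using min_exit_parameter[of A v ?f] nd v0 Av Af by blast
  obtain k2 where k2: "0 < A$k2 \<bullet> v" and s: "\<And>l. (A$k2 \<bullet> ?g / (A$k2 \<bullet> v)) * (A$l \<bullet> v) \<le> A$l \<bullet> ?g"
    using min_exit_parameter[of A v ?g] nd v0 Av Ag by blast
  define t0 s0 where ts: "t0 = A$k1 \<bullet> ?f / (A$k1 \<bullet> v)" "s0 = A$k2 \<bullet> ?g / (A$k2 \<bullet> v)"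
  have ts0: "0 < t0" "0 < s0" using k1 k2 P by (simp_all add: ts AB)
  let ?x = "\<lambda>t s l. (det3 ?f ?g (B$l) + s * det3 v ?f (B$l) - t * det3 v ?g (B$l)) / ?d"
  have x0: "0 < ?x t0 s0 l" for l
  proof -
    consider "l = i'" | "l = j'" | "l \<noteq> i'" "l \<noteq> j'" by blast
    then show ?thesis
    proof cases
      case 1 then show ?thesis using d ts0 by (simp add: det3_swap(2)[of v ?f ?g])
    next
      case 2 then show ?thesis using d ts0 by simp
    next
      case 3
      have "side_det v ?f ?g (A$k1) (A$k2) (B$l) / ?d = (A$k1 \<bullet> v) * (A$k2 \<bullet> v) * ?x t0 s0 l"
        using side_det_exit[of "A$k1" v "A$k2" ?f ?g "B$l"] k1 k2 by (simp add: ts)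
      moreover have "side_det v ?f ?g (A$k1) (A$k2) (B$l) / ?d \<noteq> 0" using H[OF k1 k2 3] d by simp
      ultimately have "0 < (A$k1 \<bullet> v) * (A$k2 \<bullet> v) * ?x t0 s0 l" using H0[OF k1 k2, of l] by (simp add: less_le)
      moreover have "0 < (A$k1 \<bullet> v) * (A$k2 \<bullet> v)" using k1 k2 by simp
      ultimately show ?thesis by (rule zero_less_mult_pos)
    qed
  qed
  have "\<forall>\<^sub>F \<epsilon> in at_right 0. 0 < ?x (t0 - \<epsilon>) (s0 - \<epsilon>) l" for l
    by (rule eventually_pos_at_right_0) (use x0[of l] d in \<open>auto intro!: continuous_intros\<close>)
  then have ev: "\<forall>\<^sub>F \<epsilon> in at_right 0. \<forall>l. 0 < ?x (t0 - \<epsilon>) (s0 - \<epsilon>) l"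
    by (rule eventually_all_finite)
  obtain \<epsilon> :: real where \<epsilon>: "0 < \<epsilon>" and x: "\<And>l. 0 < ?x (t0 - \<epsilon>) (s0 - \<epsilon>) l"
    using eventually_happens'[OF trivial_limit_at_right_real eventually_conj[OF eventually_at_right_less[of 0] ev]] by blast
  have lt: "(u - \<epsilon>) * (A$k \<bullet> v) < A$k \<bullet> B$l" if "u * (A$k \<bullet> v) \<le> A$k \<bullet> B$l" for u k l
  proof (cases "A$k \<bullet> v = 0")
    case True then show ?thesis using P[of k l] by (simp add: AB)
  next
    case False
    then have "0 < \<epsilon> * (A$k \<bullet> v)" using Av[of k] \<epsilon> by simp
    then show ?thesis using that by (simp add: left_diff_distrib)
  qed
  have lt1: "(t0 - \<epsilon>) * (A$k \<bullet> v) < A$k \<bullet> ?f" and lt2: "(s0 - \<epsilon>) * (A$k \<bullet> v) < A$k \<bullet> ?g" for k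
    using lt[of t0 k i'] lt[of s0 k j'] t[of k] s[of k] by (simp_all add: ts)
  have EG: "0 < - (det3 v ?g (B$l) / ?d) + det3 v ?f (B$l) / ?d" for l
  proof -
    have "det3 v ?g (B$l) \<noteq> 0 \<or> det3 v ?f (B$l) \<noteq> 0"
    proof (rule ccontr)
      assume "\<not> ?thesis"
      then have "?d * (A$i \<bullet> B$l) = 0" using det3_cramer_inner[of v ?f ?g "A$i" "B$l"] by (simp add: Ai)
      then show False using d P[of i l] by (simp add: AB)
    qed
    then have "det3 v ?g (B$l) / ?d \<noteq> 0 \<or> det3 v ?f (B$l) / ?d \<noteq> 0" using d by simp
    then show ?thesis using E[of l] G[of l] by linarith
  qed
  note nf = nonneg_factor_from_side_lines[OF AB Av d E G less_imp_le[OF lt1] less_imp_le[OF lt2] less_imp_le[OF x]]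
  let ?A = "(\<chi> k. vector [A$k \<bullet> v, A$k \<bullet> ?f - (t0 - \<epsilon>) * (A$k \<bullet> v), A$k \<bullet> ?g - (s0 - \<epsilon>) * (A$k \<bullet> v)]) :: real^3^'m"
  let ?B = "(\<chi> l. vector [?x (t0 - \<epsilon>) (s0 - \<epsilon>) l, - (det3 v ?g (B$l) / ?d), det3 v ?f (B$l) / ?d]) :: real^3^'n"
  have 1: "0 < ?A$k$2 \<and> 0 < ?A$k$3" for k using lt1[of k] lt2[of k] by simp
  have 2: "0 < ?B$l$1 \<and> 0 < ?B$l$2 + ?B$l$3" for l using x[of l] EG[of l] by simp
  show ?thesis by (rule strictly_positive_factor[OF nf 1 2]) (rule that)
qed

section \<open>Triangles from valid quadruples\<close>

text \<open>Homogeneous coordinates leave the sign of the vertex open; the scalar selects the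
  representative on the nonnegative side of all lines.\<close>

lemma valid_quadruple_vertex:
  fixes A :: "real^3^'m" and B :: "real^'n^3"
  assumes "valid_quadruple A B i j i' j'"
  obtains c :: real where "c \<noteq> 0" "\<And>k. 0 \<le> A$k \<bullet> (c *\<^sub>R vtx A i j)"
proof -
  have ij: "A$i \<bullet> vtx A i j = 0" "A$j \<bullet> vtx A i j = 0"
    by (simp_all add: vtx_def row_eq dot_cross_self)
  from assms have "(\<forall>k\<in>UNIV - {i, j}. 0 \<le> A$k \<bullet> vtx A i j) \<or> (\<forall>k\<in>UNIV - {i, j}. A$k \<bullet> vtx A i j \<le> 0)"
    unfolding valid_quadruple_def same_sign_or_zero_def quadruple_det_eq by blast
  then show ?thesis
  proof
    assume "\<forall>k\<in>UNIV - {i, j}. 0 \<le> A$k \<bullet> vtx A i j"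
    then have "0 \<le> A$k \<bullet> (1 *\<^sub>R vtx A i j)" for k using ij by (cases "k \<in> {i, j}") auto
    then show ?thesis using that[of 1] by simp
  next
    assume "\<forall>k\<in>UNIV - {i, j}. A$k \<bullet> vtx A i j \<le> 0"
    then have "0 \<le> A$k \<bullet> ((-1) *\<^sub>R vtx A i j)" for k using ij by (cases "k \<in> {i, j}") auto
    then show ?thesis using that[of "-1"] by simp
  qed
qed

lemma same_sign_quotient:
  assumes "same_sign_or_zero (UNIV - {a}) f" "f a = 0" "f b \<noteq> (0::real)"
  shows "0 \<le> f l / f b"
proof -
  have "b \<noteq> a" using assms by auto
  consider "\<And>l. l \<noteq> a \<Longrightarrow> 0 \<le> f l" | "\<And>l. l \<noteq> a \<Longrightarrow> f l \<le> 0"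
    using assms(1) by (auto simp: same_sign_or_zero_def)
  then show ?thesis
  proof cases
    case 1
    then show ?thesis using \<open>b \<noteq> a\<close> assms(2) by (cases "l = a") auto
  next
    case 2
    then show ?thesis using \<open>b \<noteq> a\<close> assms(2) by (cases "l = a") (auto intro: divide_nonpos_nonpos)
  qed
qed

context
  fixes A :: "real^3^'m" and B :: "real^'n^3" and P :: "real^'n^'m" and i j i' j' and c :: real and v f g b
  assumes rank: "rank P = 3" and P: "P = A ** B" and P0: "\<And>k l. 0 \<le> P$k$l"
    and valid: "valid_quadruple A B i j i' j'" and c0: "c \<noteq> 0"
  defines "b \<equiv> \<lambda>l. transpose B $ l"
  defines "v \<equiv> c *\<^sub>R vtx A i j" and "f \<equiv> b i'" and "g \<equiv> b j'"
  assumes Av: "\<And>k. 0 \<le> A$k \<bullet> v"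
begin

lemma quadruple_inner: "A$k \<bullet> b l = P$k$l"
  by (simp add: P b_def transpose_def matrix_matrix_mult_def inner_vec_def)

lemma quadruple_tangent:
  "same_sign_or_zero (UNIV - {i'}) (\<lambda>l. det3 v f (b l))"
  "same_sign_or_zero (UNIV - {j'}) (\<lambda>l. det3 v g (b l))"
proof -
  have "same_sign_or_zero (UNIV - {i'}) (\<lambda>l. c * det3 (vtx A i j) f (b l))"
    by (rule same_sign_or_zero_scale) (use valid in \<open>simp add: valid_quadruple_def column_eq f_def b_def\<close>)
  then show "same_sign_or_zero (UNIV - {i'}) (\<lambda>l. det3 v f (b l))" by (simp add: v_def det3_scale)
  have "same_sign_or_zero (UNIV - {j'}) (\<lambda>l. c * det3 (vtx A i j) g (b l))"
    by (rule same_sign_or_zero_scale) (use valid in \<open>simp add: valid_quadruple_def column_eq g_def b_def\<close>)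
  then show "same_sign_or_zero (UNIV - {j'}) (\<lambda>l. det3 v g (b l))" by (simp add: v_def det3_scale)
qed

lemma quadruple_off_vertex:
  assumes "A$k \<bullet> v \<noteq> 0" shows "k \<notin> {i, j}"
  using assms by (auto simp: v_def vtx_def row_eq dot_cross_self)

lemma quadruple_side_det: "side_det v f g (A$k) (A$l) (b k') = c\<^sup>2 * F A B i j i' j' k l k'"
  by (simp add: v_def f_def g_def b_def side_det_scale quadruple_F_eq)

lemma quadruple_product_nonneg:
  assumes "A$k \<bullet> v \<noteq> 0" "A$l \<bullet> v \<noteq> 0" "k' \<noteq> i'" "k' \<noteq> j'"
  shows "0 \<le> side_det v f g (A$k) (A$l) (b k') * side_det v f g (A$l) (A$k) (b k')"
proof -
  have "{k, l} \<subseteq> UNIV - {i, j}" "k' \<in> UNIV - {i', j'}"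
    using quadruple_off_vertex[OF assms(1)] quadruple_off_vertex[OF assms(2)] assms(3,4) by auto
  then have "0 \<le> F A B i j i' j' k l k' * F A B i j i' j' l k k'"
    using valid by (simp add: valid_quadruple_def)
  moreover have "side_det v f g (A$k) (A$l) (b k') * side_det v f g (A$l) (A$k) (b k')
      = (c\<^sup>2 * c\<^sup>2) * (F A B i j i' j' k l k' * F A B i j i' j' l k k')"
    unfolding quadruple_side_det by (simp add: mult_ac)
  ultimately show ?thesis by simp
qed

lemma side_conditions_if_nondegenerate:
  assumes d: "det3 v f g \<noteq> 0"
  shows "side_conditions A (transpose B) v f g"
proof -
  note s1 = quadruple_tangent(1) and s2 = quadruple_tangent(2)
  have E: "0 \<le> det3 v f (b l) / det3 v f g" for l
    using same_sign_quotient[OF s1, of j' l] d by (simp add: f_def g_def)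
  have G: "det3 v g (b l) / det3 v f g \<le> 0" for l
    using same_sign_quotient[OF s2, of i' l] d det3_swap(2)[of v g f] by (simp add: f_def g_def)
  have H: "0 \<le> side_det v f g (A$k) (A$l) (b k') / det3 v f g"
    if kl: "0 < A$k \<bullet> v" "0 < A$l \<bullet> v" for k l k'
  proof -
    \<comment> \<open>Condition (iv) is silent on the tangent points, but there the determinant
      reduces to a product of known sign.\<close>
    consider "k' = i'" | "k' = j'" | "k' \<noteq> i'" "k' \<noteq> j'" by blast
    then show ?thesis
    proof cases
      case 1
      have "side_det v f g (A$k) (A$l) (b k') / det3 v f g = (A$l \<bullet> v) * (A$k \<bullet> f)"
        using d det3_swap(2)[of v g f] 1 by (simp add: side_det_expand f_def[symmetric])
      then show ?thesis using kl P0 by (simp add: f_def quadruple_inner)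
    next
      case 2
      have "side_det v f g (A$k) (A$l) (b k') / det3 v f g = (A$k \<bullet> v) * (A$l \<bullet> g)"
        using d 2 by (simp add: side_det_expand g_def[symmetric])
      then show ?thesis using kl P0 by (simp add: g_def quadruple_inner)
    next
      case 3
      let ?x = "side_det v f g (A$k) (A$l) (b k') / det3 v f g"
      let ?y = "side_det v f g (A$l) (A$k) (b k') / det3 v f g"
      have "?x + ?y = (A$l \<bullet> v) * (A$k \<bullet> b k') + (A$k \<bullet> v) * (A$l \<bullet> b k')"
        using d by (simp add: add_divide_distrib[symmetric] side_det_sum)
      then have "0 \<le> ?x + ?y" using kl P0 by (simp add: quadruple_inner)
      moreover have "0 \<le> ?x * ?y"
        using quadruple_product_nonneg[of k l k'] 3 kl by (simp add: zero_le_divide_iff zero_le_mult_iff)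
      ultimately show ?thesis by (smt (verit) mult_neg_pos mult_neg_neg mult_pos_neg)
    qed
  qed
  show ?thesis unfolding side_conditions_def using Av d E G H by (simp add: b_def)
qed

text \<open>If the two tangent lines coincide, all lines \<open>a\<^sub>k\<close> off the vertex meet that line in the same
  point, and the other tangent through the vertex can be used as the second side.\<close>

lemma side_conditions_if_degenerate:
  assumes d: "det3 v f g = 0"
  obtains l where "side_conditions A (transpose B) v f (b l)"
proof -
  note AB = quadruple_inner
  note ndB = factor_nondegenerate(2)[OF rank, of A "transpose B", folded b_def, OF AB]
  have Vf: "cross3 (vtx A i j) f \<noteq> 0" and Vg: "cross3 (vtx A i j) g \<noteq> 0"
    using valid by (auto simp: valid_quadruple_def column_eq f_def g_def b_def)
  define w where "w = cross3 v f"
  have w0: "w \<noteq> 0" and vg0: "cross3 v g \<noteq> 0" using Vf Vg c0 by (auto simp: w_def v_def cross_mult_left)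
  have Eb: "det3 v f x = x \<bullet> w" for x by (simp add: det3_inner w_def)
  have "cross3 (cross3 v g) w = - det3 v f g *\<^sub>R v"
    by (simp add: w_def det3_expand vec3_eq_iff cross3_nth algebra_simps)
  then have "cross3 (cross3 v g) w = 0" using d by simp
  from cross3_eq_0_imp_scale[OF this w0] obtain e where e: "cross3 v g = e *\<^sub>R w" by blast
  have e0: "e \<noteq> 0" using e vg0 by auto
  obtain l0 where l0: "b l0 \<bullet> w \<noteq> 0" using ndB[of w] w0 by blast
  have "l0 \<noteq> i'" using l0 by (auto simp: w_def f_def dot_cross_self)
  have "g \<bullet> (e *\<^sub>R w) = 0" using e[symmetric] by (simp add: dot_cross_self)
  then have "l0 \<noteq> j'" using l0 e0 by (auto simp: g_def)
  \<comment> \<open>For coinciding tangents the values for (k, l) and (l, k) are opposite, so a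
    nonnegative product forces both to vanish. This is the collinearity of the two lines with the
    common tangent.\<close>
  have same: "(A$k \<bullet> v) * (A$l \<bullet> f) = (A$l \<bullet> v) * (A$k \<bullet> f)"
    if kl: "A$k \<bullet> v \<noteq> 0" "A$l \<bullet> v \<noteq> 0" for k l
  proof -
    have "side_det v f g (A$l) (A$k) (b l0) = - side_det v f g (A$k) (A$l) (b l0)"
      using side_det_sum[of v f g "A$k" "A$l" "b l0"] d by simp
    then have "\<not> 0 < side_det v f g (A$k) (A$l) (b l0) * side_det v f g (A$k) (A$l) (b l0)"
      using quadruple_product_nonneg[OF kl \<open>l0 \<noteq> i'\<close> \<open>l0 \<noteq> j'\<close>] by simp
    then have "side_det v f g (A$k) (A$l) (b l0) = 0" by (rule not_real_square_gt_zero[THEN iffD1])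
    moreover have "side_det v f g (A$k) (A$l) (b l0)
        = e * (((A$k \<bullet> v) * (A$l \<bullet> f) - (A$l \<bullet> v) * (A$k \<bullet> f)) * (b l0 \<bullet> w))"
    proof -
      have "side_det v f g (A$k) (A$l) (b l0) = e * det3 (cross3 w (A$k)) (cross3 w (A$l)) (b l0)"
        by (simp add: side_det_def e cross_mult_left det3_scale w_def)
      also have "det3 (cross3 w (A$k)) (cross3 w (A$l)) (b l0) = det3 w (A$k) (A$l) * (b l0 \<bullet> w)"
        by (simp add: det3_expand cross3_nth inner_real3 algebra_simps)
      also have "det3 w (A$k) (A$l) = (A$k \<bullet> v) * (A$l \<bullet> f) - (A$l \<bullet> v) * (A$k \<bullet> f)"
        by (simp add: det3_expand w_def cross3_nth inner_real3 algebra_simps)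
      finally show ?thesis .
    qed
    ultimately show ?thesis using e0 l0 by simp
  qed
  \<comment> \<open>\<open>z l\<close>, and \<open>y l\<close> below, are the coefficients of
    \<open>b l0\<close> and of \<open>f\<close> in the expansion of \<open>b l\<close> in the basis
    \<open>v\<close>, \<open>f\<close>, \<open>b l0\<close>.\<close>
  define z where "z l = (b l \<bullet> w) / (b l0 \<bullet> w)" for l
  have z0: "0 \<le> z l" for l
  proof -
    from same_sign_quotient[OF quadruple_tangent(1), of l0 l] show ?thesis using l0 by (simp add: f_def z_def flip: Eb)
  qed
  have z1: "z l0 = 1" using l0 by (simp add: z_def)
  define y where "y l = det3 v (b l) (b l0) / det3 v f (b l0)" for l
  have Eb0: "det3 v f (b l0) \<noteq> 0" using l0 by (simp add: Eb)
  have coord: "det3 v f (b l) = z l * det3 v f (b l0)" for l using l0 by (simp add: z_def Eb)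
  have yD: "det3 v (b l) (b l0) = y l * det3 v f (b l0)" for l using Eb0 by (simp add: y_def)
  have pair: "det3 v (b l) (b l') = (y l * z l' - z l * y l') * det3 v f (b l0)" for l l'
  proof -
    have "det3 v (b l) (b l') * det3 v f (b l0) = det3 v (b l) (b l0) * det3 v f (b l') - det3 v f (b l) * det3 v (b l') (b l0)"
      by (simp add: det3_expand) algebra
    then have "det3 v (b l) (b l') * det3 v f (b l0)
        = (y l * z l' - z l * y l') * det3 v f (b l0) * det3 v f (b l0)"
      unfolding coord[of l] coord[of l'] yD by (simp add: algebra_simps)
    then show ?thesis using Eb0 by simp
  qed
  define Z where "Z = {l. z l \<noteq> 0}"
  have "l0 \<in> Z" using z1 by (simp add: Z_def)
  then have "Z \<noteq> {}" by blast
  \<comment> \<open>The other tangent goes through the point of extreme direction among those off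
    the first one.\<close>
  obtain l1 where l1: "l1 \<in> Z" and min: "\<And>l. l \<in> Z \<Longrightarrow> y l1 / z l1 \<le> y l / z l"
    using finite_ex_min[OF finite \<open>Z \<noteq> {}\<close>, of "\<lambda>l. y l / z l"] by blast
  have zl1: "0 < z l1" using l1 z0[of l1] by (simp add: Z_def)
  have d1: "det3 v f (b l1) \<noteq> 0" using zl1 Eb0 coord[of l1] by simp
  \<comment> \<open>Points on the first tangent are on the same side of \<open>v\<close> as
    \<open>f\<close>: lines \<open>i\<close> and \<open>j\<close> vanish at \<open>v\<close>, one of
    them is positive at \<open>f\<close>, and none is negative at a point.\<close>
  have y0: "0 \<le> y l" if "z l = 0" for l
  proof -
    have cr: "det3 v f (b l0) * (A$k \<bullet> b l) = det3 v f (b l0) * y l * (A$k \<bullet> f)" if "A$k \<bullet> v = 0" for k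
    proof -
      have "det3 v f (b l0) * (A$k \<bullet> b l) = - det3 v (b l0) (b l) * (A$k \<bullet> f)"
        using det3_cramer_inner[of v f "b l0" "A$k" "b l"] that coord[of l] \<open>z l = 0\<close> by simp
      also have "- det3 v (b l0) (b l) = det3 v f (b l0) * y l"
        using Eb0 det3_swap(2)[of v "b l0" "b l"] by (simp add: y_def)
      finally show ?thesis .
    qed
    have V0: "A$i \<bullet> v = 0" "A$j \<bullet> v = 0" by (simp_all add: v_def vtx_def row_eq dot_cross_self)
    have "A$i \<bullet> f \<noteq> 0 \<or> A$j \<bullet> f \<noteq> 0"
    proof (rule ccontr)
      assume "\<not> ?thesis"
      then have "cross3 (vtx A i j) f = 0" by (simp add: vtx_def row_eq cross3_cross3_left)
      then show False using Vf by blast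
    qed
    moreover have "0 \<le> A$k \<bullet> f" for k using P0 by (simp add: f_def AB)
    ultimately have "0 < A$i \<bullet> f \<or> 0 < A$j \<bullet> f" by (simp add: less_le)
    then obtain k where k: "A$k \<bullet> v = 0" "0 < A$k \<bullet> f" using V0 by blast
    have "A$k \<bullet> b l = y l * (A$k \<bullet> f)" using cr[OF k(1)] Eb0 by simp
    then show ?thesis using k(2) P0[of k l] by (simp add: AB zero_le_mult_iff)
  qed
  have E: "0 \<le> det3 v f (b l) / det3 v f (b l1)" for l
    using Eb0 z0[of l] zl1 by (simp add: coord[of l] coord[of l1])
  have G: "det3 v (b l1) (b l) / det3 v f (b l1) \<le> 0" for l
  proof -
    have "y l1 * z l - z l1 * y l \<le> 0"
    proof (cases "z l = 0")
      case True then show ?thesis using y0[OF True] zl1 by simp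
    next
      case False
      then have "0 < z l" using z0[of l] by simp
      then show ?thesis using min[of l] False zl1 by (simp add: Z_def field_simps)
    qed
    moreover have "det3 v (b l1) (b l) / det3 v f (b l1) = (y l1 * z l - z l1 * y l) / z l1"
      unfolding pair coord[of l1] using Eb0 by simp
    ultimately show ?thesis using zl1 by (simp add: divide_nonpos_pos)
  qed
  \<comment> \<open>By \<open>same\<close>, line \<open>k\<close> may be replaced by
    \<open>l\<close> up to a positive factor, and for equal lines \<open>side_det_same\<close> gives
    the sign.\<close>
  have H: "0 \<le> side_det v f (b l1) (A$k) (A$l) (b k') / det3 v f (b l1)"
    if kl: "0 < A$k \<bullet> v" "0 < A$l \<bullet> v" for k l k'
  proof -
    have "side_det v f (b l1) (A$k) (A$l) (b k') * (A$l \<bullet> v) = (A$k \<bullet> v) * side_det v f (b l1) (A$l) (A$l) (b k')"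
      using same[of k l] kl unfolding side_det_expand by (simp add: algebra_simps)
    then have "side_det v f (b l1) (A$k) (A$l) (b k') = (A$k \<bullet> v) * det3 v f (b l1) * (A$l \<bullet> b k')"
      using kl by (simp add: side_det_same)
    then show ?thesis using d1 kl P0 by (simp add: AB)
  qed
  have "side_conditions A (transpose B) v f (b l1)"
    unfolding side_conditions_def using Av d1 E G H by (simp add: b_def)
  then show ?thesis using that by blast
qed

lemma nonneg_rank_if_valid_quadruple_aux: "nonneg_rank_le_3 P"
proof -
  have "\<exists>l. side_conditions A (transpose B) v f (b l)"
    using side_conditions_if_nondegenerate side_conditions_if_degenerate
    by (cases "det3 v f g = 0") (auto simp: g_def)
  then obtain l where "side_conditions A (transpose B) v f (b l)" by blast
  then show ?thesis
    using nonneg_rank_if_side_conditions[OF rank, of A "transpose B"] quadruple_inner P0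
    by (simp add: b_def f_def)
qed

lemma positive_factor_if_nonvanishing_aux:
  assumes P1: "\<And>k l. 0 < P$k$l" and nv: "\<not> has_vanishing_product A B i j i' j'"
  obtains A' :: "real^3^'m" and B' :: "real^3^'n" where "\<And>k l. A'$k \<bullet> B'$l = P$k$l" "\<And>k i. 0 < A'$k$i" "\<And>l i. 0 < B'$l$i"
proof -
  have nv': "side_det v f g (A$k) (A$l) (b k') \<noteq> 0"
    if kl: "A$k \<bullet> v \<noteq> 0" "A$l \<bullet> v \<noteq> 0" and "k' \<noteq> i'" "k' \<noteq> j'" for k l k'
  proof -
    have "A$k \<bullet> vtx A i j \<noteq> 0" "A$l \<bullet> vtx A i j \<noteq> 0" using kl by (auto simp: v_def)
    moreover have "{k, l} \<subseteq> UNIV - {i, j}" "k' \<in> UNIV - {i', j'}"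
      using quadruple_off_vertex[OF kl(1)] quadruple_off_vertex[OF kl(2)] that(3,4) by auto
    ultimately have "F A B i j i' j' k l k' * F A B i j i' j' l k k' \<noteq> 0"
      using nv unfolding has_vanishing_product_def quadruple_det_eq by metis
    then show ?thesis using c0 by (simp add: quadruple_side_det)
  qed
  have v0: "v \<noteq> 0" using valid c0 by (auto simp: valid_quadruple_def v_def)
  obtain k where k: "A$k \<bullet> v \<noteq> 0"
    using factor_nondegenerate(1)[OF rank, of A "transpose B" v] quadruple_inner v0 by (auto simp: b_def)
  \<comment> \<open>Rank 3 requires three columns, so some \<open>k'\<close> differs from both
    tangent points. For equal lines the determinant has the factor \<open>det3 v f g\<close>, so its
    nonvanishing rules out coinciding tangents.\<close>
  have "card {i', j'} \<le> 2" by (simp add: card_insert_if)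
  moreover have "3 \<le> CARD('n)" using rank_bound[of P] rank by simp
  ultimately have "card {i', j'} \<noteq> CARD('n)" by linarith
  then have "{i', j'} \<noteq> UNIV" by metis
  then obtain k' where k': "k' \<noteq> i'" "k' \<noteq> j'" by auto
  have "det3 v f g \<noteq> 0" using nv'[OF k k k'] by (auto simp: side_det_same)
  then have sc: "side_conditions A (transpose B) v (transpose B $ i') (transpose B $ j')"
    using side_conditions_if_nondegenerate by (simp add: f_def g_def b_def)
  have Ai: "A$i \<bullet> v = 0" by (simp add: v_def vtx_def row_eq dot_cross_self)
  show ?thesis
  proof (rule positive_factor_if_side_conditions[OF rank _ sc P1 Ai])
    show "A$k \<bullet> transpose B $ l = P$k$l" for k l using quadruple_inner by (simp add: b_def)
    show "side_det v (transpose B $ i') (transpose B $ j') (A$k) (A$l) (transpose B $ k') \<noteq> 0"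
      if "0 < A$k \<bullet> v" "0 < A$l \<bullet> v" "k' \<noteq> i'" "k' \<noteq> j'" for k l k'
      using nv'[of k l k'] that by (simp add: f_def g_def b_def)
  qed (rule that)
qed

end

lemma nonneg_rank_if_valid_quadruple:
  fixes A :: "real^3^'m" and B :: "real^'n^3"
  assumes "rank (A ** B) = 3" "nonneg_matrix (A ** B)" "valid_quadruple A B i j i' j'"
  shows "nonneg_rank_le_3 (A ** B)"
proof -
  obtain c where "c \<noteq> 0" "\<And>k. 0 \<le> A$k \<bullet> (c *\<^sub>R vtx A i j)" using valid_quadruple_vertex[OF assms(3)] by blast
  then show ?thesis
    using nonneg_rank_if_valid_quadruple_aux[OF assms(1) refl _ assms(3)] assms(2) by (simp add: nonneg_matrix_def)
qed

lemma positive_factor_if_nonvanishing_quadruple: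
  fixes A :: "real^3^'m" and B :: "real^'n^3"
  assumes "rank (A ** B) = 3" "\<And>k l. 0 < (A ** B)$k$l" "valid_quadruple A B i j i' j'"
    "\<not> has_vanishing_product A B i j i' j'"
  obtains A' :: "real^3^'m" and B' :: "real^3^'n"
    where "\<And>k l. A'$k \<bullet> B'$l = (A ** B)$k$l" "\<And>k i. 0 < A'$k$i" "\<And>l i. 0 < B'$l$i"
proof -
  obtain c where c: "c \<noteq> 0" "\<And>k. 0 \<le> A$k \<bullet> (c *\<^sub>R vtx A i j)" using valid_quadruple_vertex[OF assms(3)] by blast
  show ?thesis
    by (rule positive_factor_if_nonvanishing_aux[OF assms(1) refl less_imp_le[OF assms(2)] assms(3) c assms(2,4)])
      (rule that)
qed

section \<open>Interior points of the model\<close>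

lemma orthonormal_expansion:
  fixes U :: "'a::euclidean_space set"
  assumes fin: "finite U" and orth: "pairwise orthogonal U" and unit: "\<And>b. b \<in> U \<Longrightarrow> norm b = 1"
    and v: "v \<in> span U"
  shows "(\<Sum>b\<in>U. (v \<bullet> b) *\<^sub>R b) = v"
proof -
  let ?u = "v - (\<Sum>b\<in>U. (v \<bullet> b) *\<^sub>R b)"
  have "?u \<bullet> c = 0" if c: "c \<in> U" for c
  proof -
    have "(\<Sum>b\<in>U. (v \<bullet> b) * (b \<bullet> c)) = (\<Sum>b\<in>U. if b = c then v \<bullet> c else 0)"
      using orth unit c by (intro sum.cong) (auto simp: pairwise_def orthogonal_def norm_eq_1)
    then show ?thesis using fin c by (simp add: inner_diff_left inner_sum_left)
  qed
  then have "orthogonal ?u x" if "x \<in> span U" for x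
    using that by (intro orthogonal_to_span[of x U]) (auto simp: orthogonal_def)
  moreover have "?u \<in> span U" by (intro span_diff v span_sum span_scale span_base)
  ultimately have "orthogonal ?u ?u" by blast
  then show ?thesis by (simp add: orthogonal_self)
qed

text \<open>Take an orthonormal basis of the column space as columns of \<open>A\<close>. The
  coordinates in \<open>B\<close> are then bounded by the norms of the columns of \<open>X\<close>,
  which are at most 1 in the simplex.\<close>

lemma bounded_factor:
  fixes X :: "real^'n^'m"
  assumes rank: "rank X \<le> 3" and X: "X \<in> matrix_simplex"
  obtains A :: "real^3^'m" and B :: "real^3^'n" where "\<And>k l. A$k \<bullet> B$l = X$k$l"
    "\<And>k i. \<bar>A$k$i\<bar> \<le> 1" "\<And>l i. \<bar>B$l$i\<bar> \<le> 1"
proof -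
  have X0: "0 \<le> X$k$l" and X1: "(\<Sum>k\<in>UNIV. \<Sum>l\<in>UNIV. X$k$l) = 1" for k l
    using X by (auto simp: matrix_simplex_def nonneg_matrix_def entry_sum_def)
  obtain U where orth: "pairwise orthogonal U" and unit: "\<And>x. x \<in> U \<Longrightarrow> norm x = 1"
    and ind: "independent U" and card: "card U = dim (span (columns X))" and spanU: "span U = span (columns X)"
    using orthonormal_basis_subspace[OF subspace_span] by metis
  have fin: "finite U" using ind by (rule finiteI_independent)
  have "card U \<le> card (UNIV :: 3 set)" using rank card by (simp add: column_rank_def)
  then obtain h :: "real^'m \<Rightarrow> 3" where h: "inj_on h U" using card_le_inj[OF fin, of "UNIV :: 3 set"] by auto
  \<comment> \<open>The basis may have fewer than three vectors; the remaining indices carry the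
    zero vector.\<close>
  define u where "u i = (if i \<in> h ` U then inv_into U h i else 0)" for i
  have u1: "norm (u i) \<le> 1" for i
    using unit by (auto simp: u_def inv_into_into inv_into_f_f[OF h])
  define A :: "real^3^'m" where "A = (\<chi> k i. u i $ k)"
  define B :: "real^3^'n" where "B = (\<chi> l i. column l X \<bullet> u i)"
  show ?thesis
  proof (rule that[of A B])
    fix k l i
    have "column l X \<in> span U" unfolding spanU by (rule span_base) (auto simp: columns_def)
    then have "column l X = (\<Sum>b\<in>U. (column l X \<bullet> b) *\<^sub>R b)"
      using orthonormal_expansion[OF fin orth unit] by simp
    also have "\<dots> = (\<Sum>i\<in>h ` U. (column l X \<bullet> u i) *\<^sub>R u i)"
      by (simp add: sum.reindex[OF h] u_def inv_into_f_f[OF h])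
    also have "\<dots> = (\<Sum>i\<in>UNIV. (column l X \<bullet> u i) *\<^sub>R u i)"
      by (rule sum.mono_neutral_left) (auto simp: u_def)
    finally have "column l X $ k = (\<Sum>i\<in>UNIV. (column l X \<bullet> u i) *\<^sub>R u i) $ k" by (rule arg_cong)
    then show "A$k \<bullet> B$l = X$k$l"
      by (simp add: A_def B_def inner_vec_def[of "A$k"] sum_component mult.commute column_def inner_real3 sum_3)
    have "\<bar>u i $ k\<bar> \<le> norm (u i)" by (rule component_le_norm_cart)
    then show "\<bar>A$k$i\<bar> \<le> 1" using u1[of i] by (simp add: A_def)
    have "norm (column l X) \<le> (\<Sum>k\<in>UNIV. \<bar>column l X $ k\<bar>)" by (rule norm_le_l1_cart)
    also have "\<dots> = (\<Sum>k\<in>UNIV. X$k$l)" using X0 by (simp add: column_def)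
    also have "\<dots> \<le> (\<Sum>k\<in>UNIV. \<Sum>l\<in>UNIV. X$k$l)"
      by (intro sum_mono member_le_sum) (auto intro: X0)
    finally have "norm (column l X) \<le> 1" using X1 by simp
    then have "norm (column l X) * norm (u i) \<le> 1" using u1[of i] by (simp add: mult_le_one)
    then show "\<bar>B$l$i\<bar> \<le> 1"
      using Cauchy_Schwarz_ineq2[of "column l X" "u i"] by (simp add: B_def)
  qed
qed

lemma rank_le_3_if_nonneg_rank_le_3: "nonneg_rank_le_3 X \<Longrightarrow> rank X \<le> 3"
proof -
  assume "nonneg_rank_le_3 X"
  then obtain A :: "real^3^_" and B where "X = A ** B" by (auto simp: nonneg_rank_le_3_def)
  then show ?thesis using rank_mul_le_left[of A B] rank_bound[of A] by simp
qed

lemma positive_neighbourhood: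
  fixes P :: "real^'n^'m"
  assumes "\<And>k l. 0 < P$k$l"
  obtains r where "0 < r" "\<And>X k l. X \<in> ball P r \<Longrightarrow> 0 < X$k$l"
proof -
  define S where "S = (\<Inter>k. \<Inter>l. {X :: real^'n^'m. 0 < X$k$l})"
  have "open S" unfolding S_def
    by (intro open_INT ballI open_Collect_less continuous_intros) auto
  moreover have "P \<in> S" using assms by (simp add: S_def)
  ultimately obtain r where r: "0 < r" "ball P r \<subseteq> S" by (rule openE)
  have "0 < X$k$l" if "X \<in> ball P r" for X k l
    using subsetD[OF r(2) that] by (simp add: S_def)
  then show ?thesis using that r(1) by blast
qed

text \<open>A triangle strictly between the polygons, recorded as a change of coordinates relative
  to the factors. The inequalities are open in \<open>A\<close> and \<open>B\<close>, so one frame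
  serves all nearby factor pairs.\<close>

definition positive_frame :: "real^3^'m \<Rightarrow> real^3^'n \<Rightarrow> real^3^3 \<Rightarrow> real^3^3 \<Rightarrow> bool" where
  "positive_frame A B C D \<longleftrightarrow> C ** D = mat 1 \<and>
     (\<forall>k i. 0 < (A$k v* C)$i) \<and> (\<forall>l i. 0 < (D *v B$l)$i)"

lemma nonneg_rank_if_positive_frame:
  fixes X :: "real^'n^'m"
  assumes AB: "\<And>k l. A$k \<bullet> B$l = X$k$l" and C: "positive_frame A B C D"
  shows "nonneg_rank_le_3 X"
proof -
  have "C *v (D *v x) = x" for x
    using C by (simp add: positive_frame_def matrix_vector_mul_assoc)
  then have "(A$k v* C) \<bullet> (D *v B$l) = X$k$l" for k l by (simp only: dot_lmul_matrix AB)
  then have "nonneg_factor X (\<chi> k. A$k v* C) (\<chi> l. D *v B$l)"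
    using C by (simp add: nonneg_factor_def positive_frame_def less_imp_le)
  then show ?thesis by (auto simp: nonneg_rank_le_3_iff)
qed

text \<open>Compactness: the factors of matrices of rank at most 3 tending to \<open>P\<close> can be chosen to
  accumulate at factors of \<open>P\<close>, whose positive frame is then positive for nearby factors.\<close>

lemma model_interior_if_positive_frames:
  fixes P :: "real^'n^'m"
  assumes pos: "\<And>k l. 0 < P$k$l" and sum1: "entry_sum P = 1" and rank: "rank P \<le> 3"
    and frame: "\<And>A B. (\<And>k l. A$k \<bullet> B$l = P$k$l) \<Longrightarrow> \<exists>C D. positive_frame A B C D"
  shows "P \<in> model_interior"
proof -
  have PS: "P \<in> matrix_simplex" using pos sum1 by (auto simp: matrix_simplex_def nonneg_matrix_def less_imp_le)
  obtain A0 :: "real^3^'m" and B0 :: "real^3^'n" where AB0: "\<And>k l. A0$k \<bullet> B0$l = P$k$l"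
    using bounded_factor[OF rank PS] by metis
  obtain C0 D0 where "positive_frame A0 B0 C0 D0" using frame[OF AB0] by blast
  from nonneg_rank_if_positive_frame[OF AB0 this] have PM: "P \<in> mixture_model"
    using PS by (simp add: mixture_model_def)
  obtain r where r: "0 < r" and rpos: "\<And>X k l. X \<in> ball P r \<Longrightarrow> 0 < X$k$l"
    using positive_neighbourhood pos by blast
  have simplex: "X \<in> matrix_simplex" if "X \<in> ball P r" "entry_sum X = 1" for X
    using that rpos by (auto simp: matrix_simplex_def nonneg_matrix_def less_imp_le)
  show ?thesis
  proof (rule ccontr)
    assume notint: "P \<notin> model_interior"
    have "\<exists>X. X \<in> ball P (min r (1 / Suc n)) \<and> entry_sum X = 1 \<and> rank X \<le> 3 \<and> \<not> nonneg_rank_le_3 X" for n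
    proof (rule ccontr)
      assume none: "\<not> ?thesis"
      let ?W = "ball P (min r (1 / Suc n)) \<inter> {X. entry_sum X = 1}"
      have W: "?W \<subseteq> matrix_simplex" using simplex by auto
      have "simplex_ball ?W" unfolding simplex_ball_def
        using W r sum1 by (intro conjI exI[of _ P] exI[of _ "min r (1 / Suc n)"]) auto
      moreover have "P \<in> ?W" using r sum1 by simp
      moreover have "?W \<inter> rank_variety = ?W \<inter> mixture_model"
        using none W rank_le_3_if_nonneg_rank_le_3
        by (auto simp: rank_variety_def mixture_model_def)
      ultimately show False using notint PM by (auto simp: model_interior_def)
    qed
    then obtain X where X: "\<And>n. X n \<in> ball P (min r (1 / Suc n))" "\<And>n. entry_sum (X n) = 1"
      "\<And>n. rank (X n) \<le> 3" "\<And>n. \<not> nonneg_rank_le_3 (X n)" by metis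
    have XS: "X n \<in> matrix_simplex" for n using simplex[of "X n"] X(1,2)[of n] by simp
    have lim: "X \<longlonglongrightarrow> P"
    proof (rule metric_LIMSEQ_I)
      fix e :: real assume "0 < e"
      then obtain N where N: "1 / Suc N < e" using nat_approx_posE by blast
      have "dist (X n) P < e" if "N \<le> n" for n
      proof -
        have "dist (X n) P < 1 / Suc n" using X(1)[of n] by (simp add: dist_commute)
        also have "\<dots> \<le> 1 / Suc N" using that by (simp add: frac_le)
        finally show ?thesis using N by simp
      qed
      then show "\<exists>N. \<forall>n\<ge>N. dist (X n) P < e" by blast
    qed
    have "\<exists>Y :: (real^3^'m) \<times> (real^3^'n). (\<forall>k l. fst Y$k \<bullet> snd Y$l = X n$k$l) \<and>
        (\<forall>k i. \<bar>fst Y$k$i\<bar> \<le> 1) \<and> (\<forall>l i. \<bar>snd Y$l$i\<bar> \<le> 1)" for n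
    proof -
      obtain A :: "real^3^'m" and B :: "real^3^'n" where "\<And>k l. A$k \<bullet> B$l = X n$k$l"
        "\<And>k i. \<bar>A$k$i\<bar> \<le> 1" "\<And>l i. \<bar>B$l$i\<bar> \<le> 1"
        using bounded_factor[OF X(3) XS, of n] by blast
      then show ?thesis by (intro exI[of _ "(A, B)"]) simp
    qed
    then obtain Y :: "nat \<Rightarrow> (real^3^'m) \<times> (real^3^'n)" where Y: "\<And>n k l. fst (Y n)$k \<bullet> snd (Y n)$l = X n$k$l"
      and Yb: "\<And>n k i. \<bar>fst (Y n)$k$i\<bar> \<le> 1" "\<And>n l i. \<bar>snd (Y n)$l$i\<bar> \<le> 1" by metis
    let ?K = "{A :: real^3^'m. \<forall>k i. -1 \<le> A$k$i \<and> A$k$i \<le> 1} \<times> {B :: real^3^'n. \<forall>k i. -1 \<le> B$k$i \<and> B$k$i \<le> 1}"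
    have "compact ?K" by (intro compact_Times compact_bounded_matrices)
    moreover have "Y n \<in> ?K" for n using Yb[of n] by (auto simp: abs_le_iff mem_Times_iff minus_le_iff)
    ultimately obtain Z \<phi> where \<phi>: "strict_mono (\<phi> :: nat \<Rightarrow> nat)" and Z: "(Y \<circ> \<phi>) \<longlonglongrightarrow> Z"
      unfolding compact_def by blast
    define A where "A = fst Z"
    define B where "B = snd Z"
    have limA: "(\<lambda>n. fst (Y (\<phi> n))) \<longlonglongrightarrow> A" and limB: "(\<lambda>n. snd (Y (\<phi> n))) \<longlonglongrightarrow> B"
      using tendsto_fst[OF Z] tendsto_snd[OF Z] by (simp_all add: A_def B_def o_def)
    have "A$k \<bullet> B$l = P$k$l" for k l
    proof (rule LIMSEQ_unique)
      show "(\<lambda>n. fst (Y (\<phi> n))$k \<bullet> snd (Y (\<phi> n))$l) \<longlonglongrightarrow> A$k \<bullet> B$l"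
        by (intro tendsto_intros limA limB)
      have "(\<lambda>n. X (\<phi> n)$k$l) \<longlonglongrightarrow> P$k$l"
        using LIMSEQ_subseq_LIMSEQ[OF lim \<phi>] by (intro tendsto_vec_nth) (simp add: o_def)
      then show "(\<lambda>n. fst (Y (\<phi> n))$k \<bullet> snd (Y (\<phi> n))$l) \<longlonglongrightarrow> P$k$l" by (simp add: Y)
    qed
    then obtain C D where CD: "positive_frame A B C D" using frame by blast
    have "\<forall>\<^sub>F n in sequentially. 0 < (fst (Y (\<phi> n))$k v* C)$i" for k i
    proof (rule order_tendstoD(1))
      show "(\<lambda>n. (fst (Y (\<phi> n))$k v* C)$i) \<longlonglongrightarrow> (A$k v* C)$i"
        unfolding vector_matrix_mult_def vec_lambda_beta by (intro tendsto_intros limA)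
    qed (use CD in \<open>simp add: positive_frame_def\<close>)
    then have "\<forall>\<^sub>F n in sequentially. \<forall>k i. 0 < (fst (Y (\<phi> n))$k v* C)$i"
      by (intro eventually_all_finite)
    moreover have "\<forall>\<^sub>F n in sequentially. 0 < (D *v snd (Y (\<phi> n))$l)$i" for l i
    proof (rule order_tendstoD(1))
      show "(\<lambda>n. (D *v snd (Y (\<phi> n))$l)$i) \<longlonglongrightarrow> (D *v B$l)$i"
        unfolding matrix_vector_mult_def vec_lambda_beta by (intro tendsto_intros limB)
    qed (use CD in \<open>simp add: positive_frame_def\<close>)
    then have "\<forall>\<^sub>F n in sequentially. \<forall>l i. 0 < (D *v snd (Y (\<phi> n))$l)$i"
      by (intro eventually_all_finite)
    ultimately have "\<forall>\<^sub>F n in sequentially. positive_frame (fst (Y (\<phi> n))) (snd (Y (\<phi> n))) C D"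
      using CD by (auto simp: positive_frame_def elim: eventually_elim2)
    then obtain n where "positive_frame (fst (Y (\<phi> n))) (snd (Y (\<phi> n))) C D"
      using eventually_happens'[OF sequentially_bot] by blast
    from nonneg_rank_if_positive_frame[OF Y this] show False using X(4) by blast
  qed
qed

text \<open>In rank 3 any two factorizations differ by an invertible 3x3 matrix, so one strictly
  positive factorization supplies a frame for all others. Left inverses of its factors yield
  \<open>C\<close> and \<open>D\<close>.\<close>

lemma model_interior_if_positive_factor:
  fixes P :: "real^'n^'m" and A' :: "real^3^'m" and B' :: "real^3^'n"
  assumes rank: "rank P = 3" and pos: "\<And>k l. 0 < P$k$l" and sum1: "entry_sum P = 1"
    and AB': "\<And>k l. A'$k \<bullet> B'$l = P$k$l" and A': "\<And>k i. 0 < A'$k$i" and B': "\<And>l i. 0 < B'$l$i"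
  shows "P \<in> model_interior"
proof (rule model_interior_if_positive_frames[OF pos sum1])
  fix A :: "real^3^'m" and B :: "real^3^'n"
  assume AB: "\<And>k l. A$k \<bullet> B$l = P$k$l"
  obtain L where L: "\<And>r s. (\<Sum>k\<in>UNIV. L$r$k * A'$k$s) = (if r = s then 1 else 0)"
    using nondegenerate_left_inverse[of A'] factor_nondegenerate(1)[OF rank AB'] by blast
  obtain R where R: "\<And>r s. (\<Sum>l\<in>UNIV. R$r$l * B'$l$s) = (if r = s then 1 else 0)"
    using nondegenerate_left_inverse[of B'] factor_nondegenerate(2)[OF rank AB'] by blast
  define c where "c r = (\<Sum>l\<in>UNIV. R$r$l *\<^sub>R B$l)" for r
  define d where "d r = (\<Sum>k\<in>UNIV. L$r$k *\<^sub>R A$k)" for r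
  define C :: "real^3^3" where "C = (\<chi> s r. c r $ s)"
  define D :: "real^3^3" where "D = (\<chi> r. d r)"
  have sum_delta: "(\<Sum>s\<in>UNIV. x$s * (if r = s then 1 else 0)) = x$r" for x :: "real^3" and r
    by (simp add: if_distrib cong: if_cong)
  have AC: "A$k \<bullet> c r = A'$k$r" for k r
  proof -
    have "A$k \<bullet> c r = (\<Sum>l\<in>UNIV. R$r$l * (A'$k \<bullet> B'$l))" by (simp add: c_def inner_sum_right AB AB')
    also have "\<dots> = (\<Sum>l\<in>UNIV. \<Sum>s\<in>UNIV. A'$k$s * (R$r$l * B'$l$s))"
      by (simp add: inner_vec_def sum_distrib_left mult_ac)
    also have "\<dots> = (\<Sum>s\<in>UNIV. A'$k$s * (\<Sum>l\<in>UNIV. R$r$l * B'$l$s))"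
      by (subst sum.swap) (simp add: sum_distrib_left)
    finally show ?thesis by (simp add: R sum_delta)
  qed
  have DB: "d r \<bullet> B$l = B'$l$r" for l r
  proof -
    have "d r \<bullet> B$l = (\<Sum>k\<in>UNIV. L$r$k * (A'$k \<bullet> B'$l))" by (simp add: d_def inner_sum_left AB AB')
    also have "\<dots> = (\<Sum>k\<in>UNIV. \<Sum>s\<in>UNIV. B'$l$s * (L$r$k * A'$k$s))"
      by (simp add: inner_vec_def sum_distrib_left mult_ac)
    also have "\<dots> = (\<Sum>s\<in>UNIV. B'$l$s * (\<Sum>k\<in>UNIV. L$r$k * A'$k$s))"
      by (subst sum.swap) (simp add: sum_distrib_left)
    finally show ?thesis by (simp add: L sum_delta)
  qed
  have "d r \<bullet> c s = (if r = s then 1 else 0)" for r s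
    by (simp add: d_def inner_sum_left AC L)
  then have "D ** C = mat 1"
    by (simp add: vec_eq_iff matrix_matrix_mult_def mat_def C_def D_def inner_vec_def)
  then have "C ** D = mat 1" by (simp add: matrix_left_right_inverse)
  moreover have "(A$k v* C)$r = A'$k$r" for k r
    unfolding AC[symmetric] by (simp add: vector_matrix_mult_def C_def inner_vec_def mult.commute)
  moreover have "(D *v B$l)$r = B'$l$r" for l r
    unfolding DB[symmetric] by (simp add: matrix_vector_mult_def D_def inner_vec_def)
  ultimately show "\<exists>C D. positive_frame A B C D"
    using A' B' unfolding positive_frame_def by metis
qed (use rank in simp)

section \<open>Matrices of rank less than 3\<close>

text \<open>In the plane orthogonal to \<open>w\<close> the points with nonzero column sum,
  normalized by that sum, lie on the line where \<open>h\<close> takes the value 1, with direction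
  \<open>cross3 w h\<close>. They span a segment on it; \<open>l1\<close> and \<open>l2\<close> are
  its ends.\<close>

lemma planar_columns:
  fixes A :: "real^3^'m" and B :: "real^3^'n" and P :: "real^'n^'m"
  assumes AB: "\<And>k l. A$k \<bullet> B$l = P$k$l" and sum1: "entry_sum P = 1"
    and w: "w \<noteq> 0" "\<And>l. B$l \<bullet> w = 0"
  defines "\<phi> \<equiv> \<lambda>l. \<Sum>k\<in>UNIV. P$k$l"
  obtains f e \<rho> l1 l2 where "det3 f e w \<noteq> 0" "\<phi> l1 \<noteq> 0" "\<phi> l2 \<noteq> 0"
    "\<And>l. \<phi> l \<noteq> 0 \<Longrightarrow> B$l = \<phi> l *\<^sub>R (f + \<rho> l *\<^sub>R e) \<and> \<rho> l1 \<le> \<rho> l \<and> \<rho> l \<le> \<rho> l2"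
proof -
  define h where "h = (\<Sum>k\<in>UNIV. A$k)"
  have h: "h \<bullet> B$l = \<phi> l" for l by (simp add: h_def inner_sum_left AB \<phi>_def)
  have "(\<Sum>l\<in>UNIV. \<phi> l) = 1" using sum1 by (simp add: entry_sum_alt \<phi>_def)
  then obtain l0 where l0: "\<phi> l0 \<noteq> 0" by (metis sum.neutral zero_neq_one)
  define e where "e = cross3 w h"
  have e0: "e \<noteq> 0"
  proof
    assume "e = 0"
    then have "cross3 h w = 0" using cross_skew[of h w] by (simp add: e_def)
    from cross3_eq_0_imp_scale[OF this w(1)] obtain c where "h = c *\<^sub>R w" by blast
    then show False using h[of l0] l0 w(2)[of l0] by (simp add: inner_commute)
  qed
  define f where "f = (1 / \<phi> l0) *\<^sub>R B$l0"
  have f: "h \<bullet> f = 1" "f \<bullet> w = 0" using l0 w(2) by (simp_all add: f_def h)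
  define \<rho> where "\<rho> l = ((B$l - \<phi> l *\<^sub>R f) \<bullet> e / (e \<bullet> e)) / \<phi> l" for l
  have B: "B$l = \<phi> l *\<^sub>R (f + \<rho> l *\<^sub>R e)" if "\<phi> l \<noteq> 0" for l
  proof -
    let ?x = "B$l - \<phi> l *\<^sub>R f"
    have "B$l \<bullet> h = \<phi> l" "f \<bullet> h = 1" using h f(1) by (simp_all add: inner_commute)
    then have "?x \<bullet> w = 0" "?x \<bullet> h = 0" using w(2) f(2) by (simp_all add: inner_diff_left)
    then have "cross3 e ?x = 0" by (simp add: e_def cross3_cross3_left inner_commute)
    then have "cross3 ?x e = 0" using cross_skew[of ?x e] by simp
    from cross3_eq_0_imp_scale[OF this e0] have "?x = (\<phi> l * \<rho> l) *\<^sub>R e"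
      using that by (simp add: \<rho>_def)
    then show ?thesis by (simp add: algebra_simps)
  qed
  let ?L = "{l. \<phi> l \<noteq> 0}"
  have L: "?L \<noteq> {}" using l0 by blast
  obtain l1 where l1: "l1 \<in> ?L" "\<And>l. l \<in> ?L \<Longrightarrow> \<rho> l1 \<le> \<rho> l"
    using finite_ex_min[OF finite L, of \<rho>] by blast
  obtain l2 where l2: "l2 \<in> ?L" "\<And>l. l \<in> ?L \<Longrightarrow> - \<rho> l2 \<le> - \<rho> l"
    using finite_ex_min[OF finite L, of "\<lambda>l. - \<rho> l"] by blast
  have "det3 f e w = (f \<bullet> h) * (w \<bullet> w) - (f \<bullet> w) * (h \<bullet> w)"
    by (simp add: e_def det3_expand cross3_nth inner_real3 algebra_simps)
  then have "det3 f e w \<noteq> 0" using f w(1) by (simp add: inner_commute)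
  then show ?thesis using that[of f e l1 l2 \<rho>] B l1 l2 by simp
qed

text \<open>The ends of the segment already surround all points, so they serve as two vertices and
  the third column of each factor is zero.\<close>

lemma nonneg_rank_if_planar:
  fixes A :: "real^3^'m" and B :: "real^3^'n" and P :: "real^'n^'m"
  assumes AB: "\<And>k l. A$k \<bullet> B$l = P$k$l" and nn: "nonneg_matrix P" and sum1: "entry_sum P = 1"
    and w: "w \<noteq> 0" "\<And>l. B$l \<bullet> w = 0"
  shows "nonneg_rank_le_3 P"
proof -
  let ?\<phi> = "\<lambda>l. \<Sum>k\<in>UNIV. P$k$l"
  obtain f e \<rho> l1 l2 where l12: "?\<phi> l1 \<noteq> 0" "?\<phi> l2 \<noteq> 0"
    and B: "\<And>l. ?\<phi> l \<noteq> 0 \<Longrightarrow> B$l = ?\<phi> l *\<^sub>R (f + \<rho> l *\<^sub>R e) \<and> \<rho> l1 \<le> \<rho> l \<and> \<rho> l \<le> \<rho> l2"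
    using planar_columns[OF AB sum1 w] by metis
  have P0: "0 \<le> P$k$l" for k l using nn by (simp add: nonneg_matrix_def)
  have \<phi>0: "0 \<le> ?\<phi> l" for l by (intro sum_nonneg) (simp add: P0)
  have P\<phi>: "P$k$l = ?\<phi> l * (A$k \<bullet> f + \<rho> l * (A$k \<bullet> e))" if "?\<phi> l \<noteq> 0" for k l
  proof -
    have "A$k \<bullet> B$l = A$k \<bullet> (?\<phi> l *\<^sub>R (f + \<rho> l *\<^sub>R e))" using B[OF that] by simp
    then show ?thesis by (simp add: AB inner_add_right)
  qed
  have nonneg: "0 \<le> A$k \<bullet> f + \<rho> l * (A$k \<bullet> e)" if "?\<phi> l \<noteq> 0" for k l
    using P\<phi>[OF that, of k] P0[of k l] \<phi>0[of l] that by (simp add: zero_le_mult_iff)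
  define t where "t l = (if \<rho> l1 = \<rho> l2 then 0 else (\<rho> l - \<rho> l1) / (\<rho> l2 - \<rho> l1))" for l
  have t: "0 \<le> t l \<and> t l \<le> 1 \<and> \<rho> l = (1 - t l) * \<rho> l1 + t l * \<rho> l2" if "?\<phi> l \<noteq> 0" for l
  proof (cases "\<rho> l1 = \<rho> l2")
    case False
    then have "\<rho> l1 < \<rho> l2" using B[OF that] by simp
    then have "t l * (\<rho> l2 - \<rho> l1) = \<rho> l - \<rho> l1" "0 \<le> t l" "t l \<le> 1"
      using B[OF that] by (auto simp: t_def)
    then show ?thesis by (simp add: algebra_simps)
  qed (use B[OF that] in \<open>auto simp: t_def\<close>)
  \<comment> \<open>A column of \<open>P\<close> with sum 0 is zero because \<open>P\<close> is
    nonnegative, so it gets coordinates 0, whatever its vector in \<open>B\<close> is.\<close>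
  have "nonneg_factor P
      (\<chi> k. vector [A$k \<bullet> f + \<rho> l1 * (A$k \<bullet> e), A$k \<bullet> f + \<rho> l2 * (A$k \<bullet> e), 0])
      (\<chi> l. vector [if ?\<phi> l = 0 then 0 else ?\<phi> l * (1 - t l), if ?\<phi> l = 0 then 0 else ?\<phi> l * t l, 0])"
  proof (rule nonneg_factor_vectorI)
    fix k l
    show "(A$k \<bullet> f + \<rho> l1 * (A$k \<bullet> e)) * (if ?\<phi> l = 0 then 0 else ?\<phi> l * (1 - t l))
        + (A$k \<bullet> f + \<rho> l2 * (A$k \<bullet> e)) * (if ?\<phi> l = 0 then 0 else ?\<phi> l * t l) + 0 * 0 = P$k$l"
    proof (cases "?\<phi> l = 0")
      case True
      then have "P$k$l = 0" using P0 by (simp add: sum_nonneg_eq_0_iff)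
      then show ?thesis using True by simp
    next
      case False
      have "?\<phi> l * (A$k \<bullet> f + ((1 - t l) * \<rho> l1 + t l * \<rho> l2) * (A$k \<bullet> e)) = P$k$l"
        using P\<phi>[OF False, of k] t[OF False] by simp
      then show ?thesis using False by (simp add: algebra_simps)
    qed
  next
    fix l
    have t': "0 \<le> t l" "t l \<le> 1" if "?\<phi> l \<noteq> 0" using t[OF that] by simp_all
    show "0 \<le> (if ?\<phi> l = 0 then 0 else ?\<phi> l * (1 - t l))"
      using t' \<phi>0[of l] by (simp del: mult_eq_0_iff)
    show "0 \<le> (if ?\<phi> l = 0 then 0 else ?\<phi> l * t l)" using t' \<phi>0[of l] by simp
  qed (simp_all add: nonneg[OF l12(1)] nonneg[OF l12(2)])
  then show ?thesis by (auto simp: nonneg_rank_le_3_iff)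
qed

lemma frame_from_vectors:
  fixes c1 c2 c3 :: "real^3"
  assumes "det3 c1 c2 c3 \<noteq> 0"
  obtains C D :: "real^3^3" where "C ** D = mat 1" "\<And>a. a v* C = vector [a \<bullet> c1, a \<bullet> c2, a \<bullet> c3]"
    "\<And>x y z. D *v (x *\<^sub>R c1 + y *\<^sub>R c2 + z *\<^sub>R c3) = vector [x, y, z]"
proof -
  define C :: "real^3^3" where "C = transpose (vector [c1, c2, c3])"
  have "det C \<noteq> 0" using assms by (simp add: C_def det3_def)
  then obtain D where CD: "C ** D = mat 1" and DC: "D ** C = mat 1"
    using invertible_det_nz[of C] by (auto simp: invertible_def)
  have aC: "a v* C = vector [a \<bullet> c1, a \<bullet> c2, a \<bullet> c3]" for a
    by (simp add: vec3_eq_iff vector_matrix_mult_def C_def transpose_def inner_vec_def mult.commute)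
  have "C *v vector [x, y, z] = x *\<^sub>R c1 + y *\<^sub>R c2 + z *\<^sub>R c3" for x y z
    by (simp add: vec3_eq_iff matrix_vector_mult_def sum_3 C_def transpose_def algebra_simps)
  then have "D *v (x *\<^sub>R c1 + y *\<^sub>R c2 + z *\<^sub>R c3) = vector [x, y, z]" for x y z
    by (metis DC matrix_vector_mul_assoc matrix_vector_mul_lid)
  then show ?thesis using that CD aC by blast
qed

text \<open>A thin triangle surrounds the segment: one vertex just beyond the end \<open>l1\<close>,
  two just beyond \<open>l2\<close>, displaced by \<open>u\<close> along \<open>w\<close> in both
  directions. For small \<open>u\<close> it stays inside the outer polygon because \<open>P\<close>
  is positive.\<close>

lemma positive_frame_if_planar:
  fixes A :: "real^3^'m" and B :: "real^3^'n" and P :: "real^'n^'m"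
  assumes AB: "\<And>k l. A$k \<bullet> B$l = P$k$l" and pos: "\<And>k l. 0 < P$k$l" and sum1: "entry_sum P = 1"
    and w: "w \<noteq> 0" "\<And>l. B$l \<bullet> w = 0"
  obtains C D where "positive_frame A B C D"
proof -
  let ?\<phi> = "\<lambda>l. \<Sum>k\<in>UNIV. P$k$l"
  have \<phi>0: "0 < ?\<phi> l" for l by (intro sum_pos) (auto simp: pos)
  obtain f e \<rho> l1 l2 where det: "det3 f e w \<noteq> 0"
    and B': "\<And>l. ?\<phi> l \<noteq> 0 \<Longrightarrow> B$l = ?\<phi> l *\<^sub>R (f + \<rho> l *\<^sub>R e) \<and> \<rho> l1 \<le> \<rho> l \<and> \<rho> l \<le> \<rho> l2"
    using planar_columns[OF AB sum1 w] by metis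
  have B: "B$l = ?\<phi> l *\<^sub>R (f + \<rho> l *\<^sub>R e)" "\<rho> l1 \<le> \<rho> l" "\<rho> l \<le> \<rho> l2" for l
    using B'[of l] \<phi>0[of l] by auto
  have fe: "0 < A$k \<bullet> f + \<rho> l * (A$k \<bullet> e)" for k l
  proof -
    have "A$k \<bullet> B$l = ?\<phi> l * (A$k \<bullet> f + \<rho> l * (A$k \<bullet> e))"
      by (subst B(1)) (simp add: inner_add_right)
    then have "0 < ?\<phi> l * (A$k \<bullet> f + \<rho> l * (A$k \<bullet> e))" using pos[of k l] by (simp add: AB)
    then show ?thesis using \<phi>0[of l] by (simp add: zero_less_mult_iff)
  qed
  have "\<forall>\<^sub>F u in at_right 0. 0 < A$k \<bullet> f + (\<rho> l1 - u) * (A$k \<bullet> e)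
      \<and> 0 < A$k \<bullet> f + (\<rho> l2 + u) * (A$k \<bullet> e) + u * (A$k \<bullet> w)
      \<and> 0 < A$k \<bullet> f + (\<rho> l2 + u) * (A$k \<bullet> e) - u * (A$k \<bullet> w)" for k
    by (intro eventually_conj eventually_pos_at_right_0) (use fe in \<open>auto intro!: continuous_intros\<close>)
  then have ev: "\<forall>\<^sub>F u in at_right 0. \<forall>k. 0 < A$k \<bullet> f + (\<rho> l1 - u) * (A$k \<bullet> e)
      \<and> 0 < A$k \<bullet> f + (\<rho> l2 + u) * (A$k \<bullet> e) + u * (A$k \<bullet> w)
      \<and> 0 < A$k \<bullet> f + (\<rho> l2 + u) * (A$k \<bullet> e) - u * (A$k \<bullet> w)"
    by (rule eventually_all_finite)
  obtain u :: real where u: "0 < u" and uA: "\<And>k. 0 < A$k \<bullet> f + (\<rho> l1 - u) * (A$k \<bullet> e)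
      \<and> 0 < A$k \<bullet> f + (\<rho> l2 + u) * (A$k \<bullet> e) + u * (A$k \<bullet> w)
      \<and> 0 < A$k \<bullet> f + (\<rho> l2 + u) * (A$k \<bullet> e) - u * (A$k \<bullet> w)"
    using eventually_happens'[OF trivial_limit_at_right_real eventually_conj[OF eventually_at_right_less[of 0] ev]] by blast
  define c1 where "c1 = 1 *\<^sub>R f + (\<rho> l1 - u) *\<^sub>R e + 0 *\<^sub>R w"
  define c2 where "c2 = 1 *\<^sub>R f + (\<rho> l2 + u) *\<^sub>R e + u *\<^sub>R w"
  define c3 where "c3 = 1 *\<^sub>R f + (\<rho> l2 + u) *\<^sub>R e + (- u) *\<^sub>R w"
  have gap: "0 < \<rho> l2 - \<rho> l1 + 2 * u" using B(2)[of l2] u by simp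
  have "det3 c1 c2 c3 = det3 f e w * (- 2 * u * (\<rho> l2 - \<rho> l1 + 2 * u))"
    unfolding c1_def c2_def c3_def det3_coordinates by (simp add: algebra_simps)
  then have "det3 c1 c2 c3 \<noteq> 0" using det u gap by simp
  then obtain C D :: "real^3^3" where CD: "C ** D = mat 1"
    and aC: "\<And>a. a v* C = vector [a \<bullet> c1, a \<bullet> c2, a \<bullet> c3]"
    and D: "\<And>x y z. D *v (x *\<^sub>R c1 + y *\<^sub>R c2 + z *\<^sub>R c3) = vector [x, y, z]"
    using frame_from_vectors[of c1 c2 c3] by blast
  have "\<forall>i. 0 < (A$k v* C)$i" for k
    using uA[of k] by (simp add: aC forall_3 c1_def c2_def c3_def inner_add_right inner_diff_right)
  moreover have "\<forall>i. 0 < (D *v B$l)$i" for l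
  proof -
    \<comment> \<open>Position on the lengthened segment; the share of its far end is split evenly
      between \<open>c2\<close> and \<open>c3\<close>, which cancels the displacement along
      \<open>w\<close>.\<close>
    define t where "t = (\<rho> l - \<rho> l1 + u) / (\<rho> l2 - \<rho> l1 + 2 * u)"
    have t: "0 < t" "t < 1" using B(2,3)[of l] u gap by (simp_all add: t_def)
    have "t * (\<rho> l2 - \<rho> l1 + 2 * u) = \<rho> l - \<rho> l1 + u" using gap by (simp add: t_def)
    then have \<rho>: "\<rho> l = (1 - t) * (\<rho> l1 - u) + t * (\<rho> l2 + u)" by (simp add: algebra_simps)
    have "f + \<rho> l *\<^sub>R e = (1 - t) *\<^sub>R c1 + (t / 2) *\<^sub>R c2 + (t / 2) *\<^sub>R c3"
      unfolding \<rho> by (simp add: c1_def c2_def c3_def vec_eq_iff algebra_simps)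
    then have "B$l = (?\<phi> l * (1 - t)) *\<^sub>R c1 + (?\<phi> l * (t / 2)) *\<^sub>R c2 + (?\<phi> l * (t / 2)) *\<^sub>R c3"
      by (subst B(1)) (simp add: scaleR_add_right)
    then have "D *v B$l = vector [?\<phi> l * (1 - t), ?\<phi> l * (t / 2), ?\<phi> l * (t / 2)]" by (simp only: D)
    then show ?thesis using \<phi>0[of l] t by (simp add: forall_3)
  qed
  ultimately have "positive_frame A B C D" using CD by (simp add: positive_frame_def)
  then show ?thesis using that by blast
qed

lemma positive_frame_transpose:
  assumes "positive_frame B A C D" shows "positive_frame A B (transpose D) (transpose C)"
proof -
  have "transpose D ** transpose C = mat 1"
    using assms by (simp add: positive_frame_def flip: matrix_transpose_mul)
  moreover have "x v* transpose D = D *v x" "transpose C *v x = x v* C" for x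
    by (simp_all add: vec_eq_iff vector_matrix_mult_def matrix_vector_mult_def transpose_def mult.commute)
  ultimately show ?thesis using assms by (simp add: positive_frame_def)
qed

text \<open>Otherwise both factors have left inverses, and multiplying \<open>P\<close> by these
  reduces it to the identity of order 3.\<close>

lemma planar_if_rank_less_3:
  fixes A :: "real^3^'m" and B :: "real^3^'n" and P :: "real^'n^'m"
  assumes AB: "\<And>k l. A$k \<bullet> B$l = P$k$l" and rank: "rank P < 3"
  obtains w where "w \<noteq> 0" "\<And>l. B$l \<bullet> w = 0" | w where "w \<noteq> 0" "\<And>k. A$k \<bullet> w = 0"
proof -
  have "(\<exists>w. w \<noteq> 0 \<and> (\<forall>l. B$l \<bullet> w = 0)) \<or> (\<exists>w. w \<noteq> 0 \<and> (\<forall>k. A$k \<bullet> w = 0))"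
  proof (rule ccontr)
    assume neg: "\<not> ?thesis"
    have ker: "M *v x = 0 \<longleftrightarrow> (\<forall>k. M$k \<bullet> x = 0)" for M :: "real^3^'k" and x
      by (simp add: vec_eq_iff matrix_vector_mult_def inner_vec_def)
    obtain L where L: "L ** A = mat 1" using matrix_left_invertible_ker[of A] neg by (auto simp: ker)
    obtain R where R: "R ** B = mat 1" using matrix_left_invertible_ker[of B] neg by (auto simp: ker)
    have P: "P = A ** transpose B"
      using AB by (simp add: vec_eq_iff matrix_matrix_mult_def transpose_def inner_vec_def)
    have "L ** P = transpose B" by (simp add: P matrix_mul_assoc L)
    then have "transpose B ** transpose R = L ** P ** transpose R" by simp
    then have "L ** P ** transpose R = mat 1" by (simp add: R flip: matrix_transpose_mul)
    then have "3 = rank (L ** P ** transpose R)" by (simp add: rank_I)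
    also have "\<dots> \<le> rank (L ** P)" by (rule rank_mul_le_left)
    also have "\<dots> \<le> rank P" by (rule rank_mul_le_right)
    finally show False using rank by simp
  qed
  then show ?thesis using that by blast
qed

lemma nonneg_rank_le_3_transpose: "nonneg_rank_le_3 (transpose P) \<longleftrightarrow> nonneg_rank_le_3 P"
  using nonneg_factor_transpose by (metis nonneg_rank_le_3_iff transpose_transpose)

lemma nonneg_matrix_transpose: "nonneg_matrix (transpose P) \<longleftrightarrow> nonneg_matrix P"
  by (auto simp: nonneg_matrix_def transpose_def)

lemma nonneg_rank_if_rank_less_3:
  fixes A :: "real^3^'m" and B :: "real^'n^3"
  assumes "rank (A ** B) < 3" and nn: "nonneg_matrix (A ** B)" and sum1: "entry_sum (A ** B) = 1"
  shows "nonneg_rank_le_3 (A ** B)"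
proof -
  have AB: "A$k \<bullet> transpose B $ l = (A ** B)$k$l" for k l
    by (simp add: transpose_def matrix_matrix_mult_def inner_vec_def)
  from planar_if_rank_less_3[OF AB assms(1)] show ?thesis
  proof cases
    case (1 w)
    then show ?thesis using nonneg_rank_if_planar[OF AB nn sum1] by blast
  next
    case (2 w)
    have "transpose B $ l \<bullet> A$k = transpose (A ** B) $ l $ k" for k l
      using AB[of k l] by (simp add: transpose_def inner_commute)
    then have "nonneg_rank_le_3 (transpose (A ** B))"
      using nonneg_rank_if_planar[of "transpose B" A "transpose (A ** B)"] 2 nn sum1
      by (simp add: nonneg_matrix_transpose entry_sum_transpose)
    then show ?thesis by (simp add: nonneg_rank_le_3_transpose)
  qed
qed

lemma model_interior_if_rank_less_3:
  fixes P :: "real^'n^'m"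
  assumes rank: "rank P < 3" and pos: "\<And>k l. 0 < P$k$l" and sum1: "entry_sum P = 1"
  shows "P \<in> model_interior"
proof (rule model_interior_if_positive_frames[OF pos sum1])
  fix A :: "real^3^'m" and B :: "real^3^'n"
  assume AB: "\<And>k l. A$k \<bullet> B$l = P$k$l"
  from planar_if_rank_less_3[OF AB rank] show "\<exists>C D. positive_frame A B C D"
  proof cases
    case (1 w)
    then show ?thesis using positive_frame_if_planar[OF AB pos sum1] by blast
  next
    case (2 w)
    have "B$l \<bullet> A$k = transpose P $ l $ k" for k l using AB[of k l] by (simp add: transpose_def inner_commute)
    moreover have "0 < transpose P $ l $ k" for l k using pos by (simp add: transpose_def)
    moreover have "entry_sum (transpose P) = 1" using sum1 by (simp add: entry_sum_transpose)
    ultimately obtain C D where "positive_frame B A C D" by (rule positive_frame_if_planar[OF _ _ _ 2])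
    then show ?thesis using positive_frame_transpose by blast
  qed
qed (use rank in simp)

section \<open>The boundary of the model\<close>

text \<open>Moving a little mass from a zero entry to a nonzero one keeps the sum of the entries but
  leaves the simplex.\<close>

lemma nonzero_entry_if_model_interior:
  fixes P :: "real^'n^'m"
  assumes "P \<in> model_interior"
  shows "P$k$l \<noteq> 0"
proof
  assume 0: "P$k$l = 0"
  obtain Q r where W: "ball Q r \<inter> {X. entry_sum X = 1} \<subseteq> matrix_simplex" and P: "P \<in> ball Q r" "entry_sum P = 1"
    using assms unfolding model_interior_def simplex_ball_def by blast
  have "\<exists>k' l'. P$k'$l' \<noteq> 0"
  proof (rule ccontr)
    assume "\<not> ?thesis"
    then have "entry_sum P = 0" by (simp add: entry_sum_def)
    then show False using P(2) by simp
  qed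
  then obtain k' l' where kl': "P$k'$l' \<noteq> 0" by blast
  define X where "X \<epsilon> = (\<chi> p q. P$p$q + \<epsilon> * (if p = k' \<and> q = l' then 1 else 0) - \<epsilon> * (if p = k \<and> q = l then 1 else 0))" for \<epsilon> :: real
  have X0: "X 0 = P" by (simp add: X_def vec_eq_iff)
  have "continuous_on UNIV X" unfolding X_def by (intro continuous_intros)
  then have "isCont X 0" by (simp add: continuous_on_eq_continuous_at)
  then have "(X \<longlongrightarrow> P) (at_right 0)" unfolding isCont_def X0 by (simp add: filterlim_at_split)
  then have "\<forall>\<^sub>F \<epsilon> in at_right 0. X \<epsilon> \<in> ball Q r" using P(1) by (intro topological_tendstoD) auto
  then obtain \<epsilon> :: real where \<epsilon>: "0 < \<epsilon>" "X \<epsilon> \<in> ball Q r"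
    using eventually_happens'[OF trivial_limit_at_right_real eventually_conj[OF eventually_at_right_less[of 0]]] by blast
  have delta: "(\<Sum>p\<in>UNIV. \<Sum>q\<in>UNIV. \<epsilon> * (if p = a \<and> q = b then 1 else 0)) = \<epsilon>" for a :: 'm and b :: 'n
  proof -
    have "(\<Sum>q\<in>UNIV. \<epsilon> * (if p = a \<and> q = b then 1 else 0)) = (if p = a then \<epsilon> else 0)" for p
      by (cases "p = a") (simp_all add: sum_distrib_left[symmetric])
    then show ?thesis by simp
  qed
  have "entry_sum (X \<epsilon>) = 1"
    using P(2) delta by (simp add: entry_sum_def X_def sum.distrib sum_subtractf)
  then have "X \<epsilon> \<in> matrix_simplex" using W \<epsilon>(2) by blast
  then have "0 \<le> X \<epsilon> $ k $ l" by (simp add: matrix_simplex_def nonneg_matrix_def)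
  moreover have "X \<epsilon> $ k $ l = - \<epsilon>" using 0 kl' by (auto simp: X_def)
  ultimately show False using \<epsilon>(1) by simp
qed

section \<open>From interior points and factorizations to quadruples\<close>

lemma nonneg_rank_le_3_scale:
  assumes "nonneg_rank_le_3 X" "0 \<le> c"
  shows "nonneg_rank_le_3 (c *\<^sub>R X)"
proof -
  obtain A B where "nonneg_factor X A B" using assms(1) by (auto simp: nonneg_rank_le_3_iff)
  then have "nonneg_factor (c *\<^sub>R X) (c *\<^sub>R A) B" using assms(2) by (simp add: nonneg_factor_def)
  then show ?thesis by (auto simp: nonneg_rank_le_3_iff)
qed

text \<open>Division by 1 - \<delta> restores the entry sum 1, so the rescaled shift stays in the
  variety of rank at most 3 and, for small \<delta>, in the ball around \<open>P\<close>.\<close>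

lemma marginal_shift_if_model_interior:
  fixes P :: "real^'n^'m"
  assumes int: "P \<in> model_interior" and rank: "rank P = 3"
  obtains \<delta> where "0 < \<delta>" "\<delta> < 1" "nonneg_rank_le_3 (marginal_shift P \<delta>)"
proof -
  obtain Q r where W: "ball Q r \<inter> {X. entry_sum X = 1} \<inter> rank_variety = ball Q r \<inter> {X. entry_sum X = 1} \<inter> mixture_model"
    and P: "P \<in> ball Q r" "entry_sum P = 1"
    using int unfolding model_interior_def simplex_ball_def by blast
  define X where "X \<delta> = (1 / (1 - \<delta>)) *\<^sub>R marginal_shift P \<delta>" for \<delta>
  have "continuous_on UNIV (marginal_shift P)" unfolding marginal_shift_def by (intro continuous_intros)
  then have "isCont (marginal_shift P) 0" by (simp add: continuous_on_eq_continuous_at)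
  then have "isCont X 0" unfolding X_def by (intro continuous_intros) auto
  then have "(X \<longlongrightarrow> P) (at_right 0)" unfolding isCont_def by (simp add: filterlim_at_split X_def)
  then have e1: "\<forall>\<^sub>F \<delta> in at_right 0. X \<delta> \<in> ball Q r" using P(1) by (intro topological_tendstoD) auto
  have e2: "\<forall>\<^sub>F \<delta> in at_right (0::real). \<delta> < 1"
    by (rule eventually_mono[OF eventually_at_right_real[of 0 1]]) auto
  obtain \<delta> :: real where \<delta>: "0 < \<delta>" "\<delta> < 1" "X \<delta> \<in> ball Q r"
    using eventually_happens'[OF trivial_limit_at_right_real
        eventually_conj[OF eventually_at_right_less[of 0] eventually_conj[OF e2 e1]]] by blast
  have "entry_sum (X \<delta>) = (1 / (1 - \<delta>)) * entry_sum (marginal_shift P \<delta>)"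
    by (simp add: X_def entry_sum_def sum_distrib_left)
  then have sum1: "entry_sum (X \<delta>) = 1" using \<delta> by (simp add: entry_sum_marginal_shift[OF P(2)])
  have "X \<delta> = marginal_shift P \<delta> ** mat (1 / (1 - \<delta>))"
    by (simp add: X_def vec_eq_iff matrix_matrix_mult_def mat_def if_distrib cong: if_cong)
  then have "rank (X \<delta>) \<le> rank (marginal_shift P \<delta>)" by (simp add: rank_mul_le_left)
  then have "rank (X \<delta>) \<le> 3" using rank_marginal_shift[OF P(2), of \<delta>] rank \<delta> by simp
  then have "X \<delta> \<in> ball Q r \<inter> {X. entry_sum X = 1} \<inter> rank_variety"
    using \<delta>(3) sum1 by (simp add: rank_variety_def)
  then have "X \<delta> \<in> mixture_model" unfolding W by simp
  then have "nonneg_rank_le_3 ((1 - \<delta>) *\<^sub>R X \<delta>)"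
    using \<delta> by (intro nonneg_rank_le_3_scale) (simp_all add: mixture_model_def)
  then have "nonneg_rank_le_3 (marginal_shift P \<delta>)" using \<delta> by (simp add: X_def)
  then show ?thesis using that \<delta> by blast
qed

lemma valid_quadruple_if_tight_corner:
  fixes A :: "real^3^'m" and B :: "real^'n^3"
  assumes rank: "rank (A ** B) = 3" and nn: "nonneg_matrix (A ** B)" and sum1: "entry_sum (A ** B) = 1"
    and \<delta>: "0 \<le> \<delta>" "\<delta> < 1" and nf: "nonneg_factor (marginal_shift (A ** B) \<delta>) A' B'" and tc: "tight_corner A'"
  shows "\<exists>i j i' j'. valid_quadruple A B i j i' j' \<and>
    (0 < \<delta> \<longrightarrow> (\<forall>k l. 0 < (A ** B)$k$l) \<longrightarrow> \<not> has_vanishing_product A B i j i' j')"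
proof -
  have AB: "A$k \<bullet> transpose B $ l = (A ** B)$k$l" for k l
    by (simp add: transpose_def matrix_matrix_mult_def inner_vec_def)
  obtain i j v c d where ct: "corner_triangle A (transpose B) i j v c d"
    and str: "0 < \<delta> \<Longrightarrow> (\<And>k l. 0 < (A ** B)$k$l) \<Longrightarrow> \<forall>k. 0 < A$k \<bullet> c \<and> 0 < A$k \<bullet> d"
    by (rule corner_triangle_if_tight_corner[OF rank nn sum1 AB \<delta> nf tc]) blast
  obtain i' j' where "valid_quadruple A B i j i' j'"
    "(\<And>k l. 0 < (A ** B)$k$l) \<Longrightarrow> (\<And>k. 0 < A$k \<bullet> c \<and> 0 < A$k \<bullet> d) \<Longrightarrow> \<not> has_vanishing_product A B i j i' j'"
    by (rule valid_quadruple_if_corner_triangle[OF rank ct]) blast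
  then show ?thesis using str by blast
qed

text \<open>The starting value serves two purposes: 0 turns a nonnegative factorization into a valid
  quadruple, and a positive value gives one without vanishing product if the matrix is positive. A
  special side becomes a special vertex after transposition, hence the second alternative.\<close>

lemma valid_quadruple_if_marginal_shift:
  fixes A :: "real^3^'m" and B :: "real^'n^3"
  assumes rank: "rank (A ** B) = 3" and nn: "nonneg_matrix (A ** B)" and sum1: "entry_sum (A ** B) = 1"
    and \<delta>0: "0 \<le> \<delta>\<^sub>0" "\<delta>\<^sub>0 \<le> 1" "nonneg_rank_le_3 (marginal_shift (A ** B) \<delta>\<^sub>0)"
  shows "(\<exists>i j i' j'. valid_quadruple A B i j i' j' \<and>
      (0 < \<delta>\<^sub>0 \<longrightarrow> (\<forall>k l. 0 < (A ** B)$k$l) \<longrightarrow> \<not> has_vanishing_product A B i j i' j')) \<or>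
    (\<exists>i j i' j'. valid_quadruple (transpose B) (transpose A) i j i' j' \<and>
      (0 < \<delta>\<^sub>0 \<longrightarrow> (\<forall>k l. 0 < (A ** B)$k$l) \<longrightarrow> \<not> has_vanishing_product (transpose B) (transpose A) i j i' j'))"
proof -
  obtain \<delta> A' B' where \<delta>: "\<delta>\<^sub>0 \<le> \<delta>" "\<delta> < 1" and nf: "nonneg_factor (marginal_shift (A ** B) \<delta>) A' B'"
    and tc: "tight_corner A' \<or> tight_corner B'"
    by (rule critical_marginal_shift[OF rank nn sum1 \<delta>0])
  have \<delta>': "0 \<le> \<delta>" "0 < \<delta>\<^sub>0 \<Longrightarrow> 0 < \<delta>" using \<delta> \<delta>0 by auto
  from tc show ?thesis
  proof
    assume "tight_corner A'"
    from valid_quadruple_if_tight_corner[OF rank nn sum1 \<delta>'(1) \<delta>(2) nf this]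
    show ?thesis using \<delta>'(2) by blast
  next
    assume tc: "tight_corner B'"
    have T: "transpose B ** transpose A = transpose (A ** B)" by (simp add: matrix_transpose_mul)
    have nf': "nonneg_factor (marginal_shift (transpose B ** transpose A) \<delta>) B' A'"
      using nonneg_factor_transpose[OF nf] by (simp add: T transpose_marginal_shift)
    have "rank (transpose B ** transpose A) = 3" "nonneg_matrix (transpose B ** transpose A)"
      "entry_sum (transpose B ** transpose A) = 1"
      using rank nn sum1 by (simp_all add: T rank_transpose nonneg_matrix_transpose entry_sum_transpose)
    from valid_quadruple_if_tight_corner[OF this \<delta>'(1) \<delta>(2) nf' tc]
    obtain i j i' j' where *: "valid_quadruple (transpose B) (transpose A) i j i' j'"
      "0 < \<delta> \<Longrightarrow> (\<forall>l k. 0 < (transpose B ** transpose A)$l$k) \<Longrightarrow> \<not> has_vanishing_product (transpose B) (transpose A) i j i' j'"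
      by blast
    have "(\<forall>l k. 0 < (transpose B ** transpose A)$l$k) \<longleftrightarrow> (\<forall>k l. 0 < (A ** B)$k$l)"
      unfolding T by (auto simp: transpose_def)
    then show ?thesis using * \<delta>'(2) by blast
  qed
qed

theorem corollary6p6:
  fixes P :: "real^'n^'m" and A :: "real^3^'m" and B :: "real^'n^3"
  assumes "entry_sum P = 1" and "P = A ** B"
  shows "P \<in> model_boundary \<longleftrightarrow>
    (nonneg_matrix P \<and>
      (rank P < 3 \<or>
       (rank P = 3 \<and>
         ((\<exists>i j i' j'. valid_quadruple A B i j i' j') \<or>
          (\<exists>i j i' j'. valid_quadruple (transpose B) (transpose A) i j i' j'))))) \<and>
    ((\<exists>p q. P $ p $ q = 0) \<or>
      (rank P = 3 \<and>
        (\<forall>i j i' j'. valid_quadruple A B i j i' j' \<longrightarrow> has_vanishing_product A B i j i' j') \<and>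
        (\<forall>i j i' j'. valid_quadruple (transpose B) (transpose A) i j i' j' \<longrightarrow>
           has_vanishing_product (transpose B) (transpose A) i j i' j')))"
proof (cases "nonneg_matrix P")
  case False
  then show ?thesis by (auto simp: model_boundary_def mixture_model_def matrix_simplex_def)
next
  case nn: True
  note sum1 = assms(1)
  have T: "transpose B ** transpose A = transpose P" by (simp add: matrix_transpose_mul assms(2))
  have M: "P \<in> mixture_model \<longleftrightarrow> nonneg_rank_le_3 P"
    using nn sum1 by (simp add: mixture_model_def matrix_simplex_def)
  have zero: "P \<in> model_boundary \<longleftrightarrow> nonneg_rank_le_3 P" if "\<exists>p q. P $ p $ q = 0"
    using that nonzero_entry_if_model_interior[of P] M by (auto simp: model_boundary_def)
  have pos: "0 < P$k$l" if "\<not> (\<exists>p q. P $ p $ q = 0)" for k l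
    using that nn by (auto simp: nonneg_matrix_def less_le)
  have "rank P \<le> 3" using rank_mul_le_left[of A B] rank_bound[of A] assms(2) by simp
  then consider "rank P < 3" | "rank P = 3" by linarith
  then show ?thesis
  proof cases
    case 1
    have nr: "nonneg_rank_le_3 P"
      using nonneg_rank_if_rank_less_3[of A B] 1 nn sum1 by (simp add: assms(2)[symmetric])
    show ?thesis
    proof (cases "\<exists>p q. P $ p $ q = 0")
      case True then show ?thesis using zero[OF True] nr nn 1 by simp
    next
      case False
      have "P \<in> model_interior" using model_interior_if_rank_less_3[OF 1 pos[OF False] sum1] .
      then have "P \<notin> model_boundary" by (simp add: model_boundary_def)
      moreover have "rank P \<noteq> 3" using 1 by simp
      ultimately show ?thesis using False by blast
    qed
  next
    case 2
    have rankT: "rank (transpose P) = 3" and nnT: "nonneg_matrix (transpose P)"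
      using 2 nn by (simp_all add: rank_transpose nonneg_matrix_transpose)
    have nr: "nonneg_rank_le_3 P \<longleftrightarrow> (\<exists>i j i' j'. valid_quadruple A B i j i' j') \<or>
          (\<exists>i j i' j'. valid_quadruple (transpose B) (transpose A) i j i' j')" (is "_ \<longleftrightarrow> ?V")
    proof
      assume "nonneg_rank_le_3 P"
      then show ?V
        using valid_quadruple_if_marginal_shift[of A B 0] 2 nn sum1 unfolding assms(2)[symmetric] by auto
    next
      assume ?V
      then show "nonneg_rank_le_3 P"
      proof
        assume "\<exists>i j i' j'. valid_quadruple A B i j i' j'"
        then show ?thesis
          using nonneg_rank_if_valid_quadruple[of A B] 2 nn unfolding assms(2)[symmetric] by blast
      next
        assume "\<exists>i j i' j'. valid_quadruple (transpose B) (transpose A) i j i' j'"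
        then have "nonneg_rank_le_3 (transpose P)"
          using nonneg_rank_if_valid_quadruple[of "transpose B" "transpose A"] rankT nnT unfolding T by blast
        then show ?thesis by (simp add: nonneg_rank_le_3_transpose)
      qed
    qed
    show ?thesis
    proof (cases "\<exists>p q. P $ p $ q = 0")
      case True then show ?thesis using zero[OF True] nr nn 2 by simp
    next
      case False
      note pos = pos[OF False]
      \<comment> \<open>The negation of condition (2) for a positive matrix of rank 3.\<close>
      let ?N = "(\<exists>i j i' j'. valid_quadruple A B i j i' j' \<and> \<not> has_vanishing_product A B i j i' j') \<or>
        (\<exists>i j i' j'. valid_quadruple (transpose B) (transpose A) i j i' j' \<and>
          \<not> has_vanishing_product (transpose B) (transpose A) i j i' j')"
      have "P \<in> model_interior \<longleftrightarrow> ?N"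
      proof
        assume "P \<in> model_interior"
        then obtain \<delta> where "0 < \<delta>" "\<delta> < 1" "nonneg_rank_le_3 (marginal_shift P \<delta>)"
          using marginal_shift_if_model_interior 2 by blast
        then show ?N
          using valid_quadruple_if_marginal_shift[of A B \<delta>] 2 nn sum1 pos unfolding assms(2)[symmetric] by auto
      next
        assume ?N
        then show "P \<in> model_interior"
        proof
          assume "\<exists>i j i' j'. valid_quadruple A B i j i' j' \<and> \<not> has_vanishing_product A B i j i' j'"
          then obtain i j i' j' where v: "valid_quadruple A B i j i' j'" "\<not> has_vanishing_product A B i j i' j'" by blast
          obtain A' :: "real^3^'m" and B' :: "real^3^'n" where "\<And>k l. A'$k \<bullet> B'$l = P$k$l"
            "\<And>k i. 0 < A'$k$i" "\<And>l i. 0 < B'$l$i"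
            using positive_factor_if_nonvanishing_quadruple[OF _ _ v] 2 pos unfolding assms(2)[symmetric] by metis
          from model_interior_if_positive_factor[OF 2 pos sum1 this] show ?thesis .
        next
          assume "\<exists>i j i' j'. valid_quadruple (transpose B) (transpose A) i j i' j' \<and>
            \<not> has_vanishing_product (transpose B) (transpose A) i j i' j'"
          then obtain i j i' j' where v: "valid_quadruple (transpose B) (transpose A) i j i' j'"
            "\<not> has_vanishing_product (transpose B) (transpose A) i j i' j'" by blast
          have posT: "0 < transpose P $ l $ k" for k l using pos by (simp add: transpose_def)
          obtain B' :: "real^3^'n" and A' :: "real^3^'m" where BA: "\<And>k l. B'$k \<bullet> A'$l = transpose P $ k $ l"
            and pos': "\<And>k i. 0 < B'$k$i" "\<And>l i. 0 < A'$l$i"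
            using positive_factor_if_nonvanishing_quadruple[OF _ _ v] rankT posT unfolding T by metis
          have "A'$k \<bullet> B'$l = P$k$l" for k l
            using BA[of l k] by (simp add: transpose_def inner_commute)
          from model_interior_if_positive_factor[OF 2 pos sum1 this pos'(2,1)] show ?thesis .
        qed
      qed
      then have "P \<in> model_boundary \<longleftrightarrow> ?V \<and> \<not> ?N"
        using M nr by (simp add: model_boundary_def)
      then show ?thesis using nn 2 False by simp
    qed
  qed
qed

end
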